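(* For every $n\ge0$, $$\mathbb{P}^-(I^{n+1})\cong\bigoplus_{1\le p\le n+1}(\Delta^{p-1})^{\oplus\binom{n+1}{p}},$$ where $\oplus$ is the direct sum (coproduct) in the category of $\omega$-categories, which corresponds to disjoint union on underlying sets.
   Context: **$\omega$-categories.** An $\omega$-category is a set $A$ with maps $s_n=d_n^-,\ t_n=d_n^+:A\to A$ ($n\ge 0$) and partial binary operations $*_n$, with $a*_n b$ defined exactly when $t_n a=s_n b$, such that for all $\alpha,\beta\in\{-,+\}$: (1) $d_m^\beta d_n^\alpha x=d_m^\beta x$ if $m<n$ and $=d_n^\alpha x$ if $m\ge n$; (2) $s_nx*_nx=x*_nt_nx=x$; (3) if $x*_ny$ is defined then $s_n(x*_ny)=s_nx$, $t_n(x*_ny)=t_ny$, and $d_m^\alpha(x*_ny)=d_m^\alpha x*_n d_m^\alpha y$ for $m\ne n$; (4) $(x*_ny)*_nz=x*_n(y*_nz)$ when both sides exist; (5) for $m\neq n$, $(x*_ny)*_m(z*_nw)=(x*_mz)*_n(y*_mw)$ when both sides make sense; (6) for each $x$ there is $n$ with $s_nx=t_nx=x$; the least such $n$ is $\dim(x)$. $\omega$-functors are the structure-preserving maps; $\omega Cat$ is the resulting category. $\mathcal{C}_n$ is the set of morphisms of dimension exactly $n$. $\mathcal{C}$ is non-contracting if $s_1x$ and $t_1x$ are $1$-dimensional whenever $\dim(x)\ge1$. For $\mathcal{C}$ non-contracting, the path $\omega$-category $\mathbb{P}\mathcal{C}$ has $(\mathbb{P}\mathcal{C})_i=\mathcal{C}_{i+1}$,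 $i\geq 0$, with the operations $s_{i+1},t_{i+1},*_{i+1}$ of $\mathcal{C}$ as $i$-source, $i$-target, $i$-composition. **Negative semi-path $\omega$-category.** $\mathbb{U}$ is the forgetful functor from $\omega Cat$ to globular sets and $\mathbb{F}$ its left adjoint (free $\omega$-category), with counit $\eta$. Let $\mathcal{R}^-$ be the equivalence relation on $\mathbb{P}\mathcal{C}$ generated by the pairs $(x,x*_0y)$ with $x,y,x*_0y\in\mathbb{P}\mathcal{C}$; the maps $s_i,t_i$ ($i\ge1$) pass to the quotient, giving a morphism of globular sets $\phi:\mathbb{U}\mathbb{P}\mathcal{C}\to\mathbb{U}\mathbb{P}\mathcal{C}/\mathcal{R}^-$. The $\omega$-category $\mathbb{P}^-\mathcal{C}$ is the pushout in $\omega Cat$ of $\mathbb{F}(\phi):\mathbb{F}(\mathbb{U}\mathbb{P}\mathcal{C})\to\mathbb{F}(\mathbb{U}\mathbb{P}\mathcal{C}/\mathcal{R}^-)$ along $\eta_{\mathbb{P}\mathcal{C}}:\mathbb{F}(\mathbb{U}\mathbb{P}\mathcal{C})\to\mathbb{P}\mathcal{C}$. **Cubes and simplices.** Faces of the $n$-cube are words of length $n$ in $\{-,0,+\}$, of dimension the number of $0$'s; subfaces are obtained by replacing some zeros by signs. Faces of the $n$-simplex are nonempty strictly increasing sequences in $\{0,\dots,n\}$, a sequence of length $p+1$ having dimension $p$; subfaces are nonempty subsequences. $R(x)$ is the set of subfaces of $x$ (including $x$), $R(X)=\bigcup_{x\in X}R(x)$. For a face $x$ of dimension $p\ge1$: for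 the cube, $s_x$ (resp. $t_x$) is the set of the $p$ words obtained by replacing, for one $i\in\{1,\dots,p\}$, the $i$-th zero by the sign $(-)^i$ (resp. $(-)^{i+1}$), with $(-)^i=-$ for $i$ odd and $+$ for $i$ even; for the simplex, $s_x$ (resp. $t_x$) is the set of sequences obtained by deleting one entry in odd (resp. even) position, positions counted from $1$. $I^n$ (resp. $\Delta^n$) is the unique $\omega$-category, generated under composition by the $R(x)$ for $x$ a face of the cube (resp. simplex), with underlying set a subset of $\{R(X)\}$, with $s_{p-1}R(x)=R(s_x)$, $t_{p-1}R(x)=R(t_x)$ for $x$ of dimension $p\ge1$, and such that $t_p(X)=s_p(Y)$ implies that $X\cup Y$ is an element and $X*_pY=X\cup Y$. $I^n$ is non-contracting. *)

theory Defs
  imports Complex_Main "HOL-Library.Sublist"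
begin

section \<open>Globular sets and omega-categories\<close>

datatype sign = Minus | Plus

text \<open>Globular sets are one-sorted: a set of cells with all the source and target maps
  \<open>s\<^sub>n = bd Minus n\<close> and \<open>t\<^sub>n = bd Plus n\<close>. The operations of the records below are total functions,
  but only their values on cells (for composition, on composable pairs of cells) are meaningful.\<close>

record 'a globset =
  cells :: "'a set"
  bd :: "sign \<Rightarrow> nat \<Rightarrow> 'a \<Rightarrow> 'a"

record 'a ocat = "'a globset" +
  cmp :: "nat \<Rightarrow> 'a \<Rightarrow> 'a \<Rightarrow> 'a"

abbreviation src :: "('a, 'm) globset_scheme \<Rightarrow> nat \<Rightarrow> 'a \<Rightarrow> 'a" where
  "src G \<equiv> bd G Minus"

abbreviation tgt :: "('a, 'm) globset_scheme \<Rightarrow> nat \<Rightarrow> 'a \<Rightarrow> 'a" where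
  "tgt G \<equiv> bd G Plus"

definition globular_set :: "('a, 'm) globset_scheme \<Rightarrow> bool" where
  "globular_set G \<longleftrightarrow>
     (\<forall>x\<in>cells G. \<forall>\<alpha> n. bd G \<alpha> n x \<in> cells G) \<and>
     (\<forall>x\<in>cells G. \<forall>\<alpha> \<beta> m n. bd G \<beta> m (bd G \<alpha> n x) = (if m < n then bd G \<beta> m x else bd G \<alpha> n x)) \<and>
     (\<forall>x\<in>cells G. \<exists>n. src G n x = x \<and> tgt G n x = x)"

definition composable :: "('a, 'm) globset_scheme \<Rightarrow> nat \<Rightarrow> 'a \<Rightarrow> 'a \<Rightarrow> bool" where
  "composable G n x y \<longleftrightarrow> x \<in> cells G \<and> y \<in> cells G \<and> tgt G n x = src G n y"

definition omega_category :: "'a ocat \<Rightarrow> bool" where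
  "omega_category C \<longleftrightarrow>
     globular_set C \<and>
     (\<forall>n x y. composable C n x y \<longrightarrow> cmp C n x y \<in> cells C) \<and>
     (\<forall>n. \<forall>x\<in>cells C. cmp C n (src C n x) x = x \<and> cmp C n x (tgt C n x) = x) \<and>
     (\<forall>n x y. composable C n x y \<longrightarrow>
        src C n (cmp C n x y) = src C n x \<and>
        tgt C n (cmp C n x y) = tgt C n y \<and>
        (\<forall>\<alpha> m. m \<noteq> n \<longrightarrow> bd C \<alpha> m (cmp C n x y) = cmp C n (bd C \<alpha> m x) (bd C \<alpha> m y))) \<and>
     (\<forall>n x y z.
        composable C n x y \<longrightarrow> composable C n (cmp C n x y) z \<longrightarrow>
        composable C n y z \<longrightarrow> composable C n x (cmp C n y z) \<longrightarrow>
        cmp C n (cmp C n x y) z = cmp C n x (cmp C n y z)) \<and>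
     (\<forall>m n x y z w. m \<noteq> n \<longrightarrow>
        composable C n x y \<longrightarrow> composable C n z w \<longrightarrow> composable C m (cmp C n x y) (cmp C n z w) \<longrightarrow>
        composable C m x z \<longrightarrow> composable C m y w \<longrightarrow> composable C n (cmp C m x z) (cmp C m y w) \<longrightarrow>
        cmp C m (cmp C n x y) (cmp C n z w) = cmp C n (cmp C m x z) (cmp C m y w))"

definition odim :: "('a, 'm) globset_scheme \<Rightarrow> 'a \<Rightarrow> nat" where
  "odim C x = (LEAST n. src C n x = x \<and> tgt C n x = x)"

definition glob_map :: "('a \<Rightarrow> 'b) \<Rightarrow> ('a, 'm) globset_scheme \<Rightarrow> ('b, 'l) globset_scheme \<Rightarrow> bool" where
  "glob_map h G H \<longleftrightarrow>
     (\<forall>x\<in>cells G. h x \<in> cells H \<and> (\<forall>\<alpha> n. h (bd G \<alpha> n x) = bd H \<alpha> n (h x)))"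

definition omega_functor :: "('a \<Rightarrow> 'b) \<Rightarrow> 'a ocat \<Rightarrow> 'b ocat \<Rightarrow> bool" where
  "omega_functor h C D \<longleftrightarrow> glob_map h C D \<and>
     (\<forall>n x y. composable C n x y \<longrightarrow> h (cmp C n x y) = cmp D n (h x) (h y))"

definition ocat_iso :: "'a ocat \<Rightarrow> 'b ocat \<Rightarrow> bool" where
  "ocat_iso C D \<longleftrightarrow> (\<exists>h k. omega_functor h C D \<and> omega_functor k D C \<and>
     (\<forall>x\<in>cells C. k (h x) = x) \<and> (\<forall>y\<in>cells D. h (k y) = y))"

text \<open>The forgetful functor to globular sets.\<close>

definition forget :: "'a ocat \<Rightarrow> 'a globset" where
  "forget C = \<lparr>cells = cells C, bd = bd C\<rparr>"

lemma forget_simps [simp]: "cells (forget C) = cells C" "bd (forget C) = bd C"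
  by (simp_all add: forget_def)

lemma omega_categoryD:
  assumes "omega_category C"
  shows "globular_set C"
    "composable C n x y \<Longrightarrow> cmp C n x y \<in> cells C"
    "x \<in> cells C \<Longrightarrow> bd C \<alpha> n x \<in> cells C"
    "x \<in> cells C \<Longrightarrow> bd C \<beta> m (bd C \<alpha> n x) = (if m < n then bd C \<beta> m x else bd C \<alpha> n x)"
    "x \<in> cells C \<Longrightarrow> \<exists>n. src C n x = x \<and> tgt C n x = x"
    "x \<in> cells C \<Longrightarrow> cmp C n (src C n x) x = x"
    "x \<in> cells C \<Longrightarrow> cmp C n x (tgt C n x) = x"
    "composable C n x y \<Longrightarrow> src C n (cmp C n x y) = src C n x"
    "composable C n x y \<Longrightarrow> tgt C n (cmp C n x y) = tgt C n y"
    "composable C n x y \<Longrightarrow> m \<noteq> n \<Longrightarrow> bd C \<alpha> m (cmp C n x y) = cmp C n (bd C \<alpha> m x) (bd C \<alpha> m y)"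
    "composable C n x y \<Longrightarrow> composable C n (cmp C n x y) z \<Longrightarrow>
       composable C n y z \<Longrightarrow> composable C n x (cmp C n y z) \<Longrightarrow>
       cmp C n (cmp C n x y) z = cmp C n x (cmp C n y z)"
    "m \<noteq> n \<Longrightarrow> composable C n x y \<Longrightarrow> composable C n z w \<Longrightarrow>
       composable C m (cmp C n x y) (cmp C n z w) \<Longrightarrow>
       composable C m x z \<Longrightarrow> composable C m y w \<Longrightarrow> composable C n (cmp C m x z) (cmp C m y w) \<Longrightarrow>
       cmp C m (cmp C n x y) (cmp C n z w) = cmp C n (cmp C m x z) (cmp C m y w)"
proof -
  note C = assms[unfolded omega_category_def]
  show "globular_set C" using C by (elim conjE)
  then show "x \<in> cells C \<Longrightarrow> bd C \<alpha> n x \<in> cells C"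
    "x \<in> cells C \<Longrightarrow> bd C \<beta> m (bd C \<alpha> n x) = (if m < n then bd C \<beta> m x else bd C \<alpha> n x)"
    "x \<in> cells C \<Longrightarrow> \<exists>n. src C n x = x \<and> tgt C n x = x"
    unfolding globular_set_def by blast+
qed (use assms[unfolded omega_category_def] in \<open>elim conjE, blast\<close>)+

lemma composable_bd:
  assumes C: "omega_category C" and "composable C n x y" and "m \<noteq> n"
  shows "composable C n (bd C \<alpha> m x) (bd C \<alpha> m y)"
proof -
  have xy: "x \<in> cells C" "y \<in> cells C" and e: "tgt C n x = src C n y"
    using assms(2) by (simp_all add: composable_def)
  note D4 = omega_categoryD(4)[OF C]
  have "tgt C n (bd C \<alpha> m x) = src C n (bd C \<alpha> m y)"
  proof (cases "n < m")
    case True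
    then show ?thesis using e by (simp add: D4 xy)
  next
    case False
    then have m: "m < n" using assms(3) by simp
    have "bd C \<alpha> m x = bd C \<alpha> m (tgt C n x)" using m by (simp add: D4 xy)
    also have "\<dots> = bd C \<alpha> m (src C n y)" by (simp only: e)
    also have "\<dots> = bd C \<alpha> m y" using m by (simp add: D4 xy)
    finally have "bd C \<alpha> m x = bd C \<alpha> m y" .
    moreover have "tgt C n (bd C \<alpha> m y) = bd C \<alpha> m y" "src C n (bd C \<alpha> m y) = bd C \<alpha> m y"
      using m by (simp_all add: D4 xy)
    ultimately show ?thesis by simp
  qed
  then show ?thesis by (simp add: composable_def xy omega_categoryD(3)[OF C])
qed


section \<open>Omega-categories given by generators and relations\<close>

text \<open>Free omega-categories and pushouts are both constructed as omega-categories presented by a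
  set \<open>X\<close> of generators and a set \<open>R\<close> of relations. As composition is partial, \<open>ceq X R\<close> is only a
  partial equivalence relation on formal expressions: \<open>ceq X R t t\<close> means that \<open>t\<close> is defined.
  The universal properties are \<open>free_universal\<close> and \<open>pushout_universal\<close> below.\<close>

datatype 'a cterm = Gen 'a | Bd sign nat "'a cterm" | Cmp nat "'a cterm" "'a cterm"

inductive ceq :: "'a set \<Rightarrow> ('a cterm \<times> 'a cterm) set \<Rightarrow> 'a cterm \<Rightarrow> 'a cterm \<Rightarrow> bool"
  for X R where
  gen: "x \<in> X \<Longrightarrow> ceq X R (Gen x) (Gen x)"
| rel: "(t, u) \<in> R \<Longrightarrow> ceq X R t u"
| sym: "ceq X R t u \<Longrightarrow> ceq X R u t"
| trans: "ceq X R t u \<Longrightarrow> ceq X R u v \<Longrightarrow> ceq X R t v"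
| bd: "ceq X R t u \<Longrightarrow> ceq X R (Bd \<alpha> n t) (Bd \<alpha> n u)"
| cmp: "ceq X R t t' \<Longrightarrow> ceq X R u u' \<Longrightarrow> ceq X R (Bd Plus n t) (Bd Minus n u) \<Longrightarrow>
    ceq X R (Cmp n t u) (Cmp n t' u')"
| bd_bd: "ceq X R t t \<Longrightarrow> ceq X R (Bd \<beta> m (Bd \<alpha> n t)) (if m < n then Bd \<beta> m t else Bd \<alpha> n t)"
| unit_left: "ceq X R t t \<Longrightarrow> ceq X R (Cmp n (Bd Minus n t) t) t"
| unit_right: "ceq X R t t \<Longrightarrow> ceq X R (Cmp n t (Bd Plus n t)) t"
| src_cmp: "ceq X R (Cmp n t u) (Cmp n t u) \<Longrightarrow> ceq X R (Bd Minus n (Cmp n t u)) (Bd Minus n t)"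
| tgt_cmp: "ceq X R (Cmp n t u) (Cmp n t u) \<Longrightarrow> ceq X R (Bd Plus n (Cmp n t u)) (Bd Plus n u)"
| bd_cmp: "ceq X R (Cmp n t u) (Cmp n t u) \<Longrightarrow> m \<noteq> n \<Longrightarrow>
    ceq X R (Bd \<alpha> m (Cmp n t u)) (Cmp n (Bd \<alpha> m t) (Bd \<alpha> m u))"
| assoc: "ceq X R (Cmp n (Cmp n t u) v) (Cmp n (Cmp n t u) v) \<Longrightarrow>
    ceq X R (Cmp n t (Cmp n u v)) (Cmp n t (Cmp n u v)) \<Longrightarrow>
    ceq X R (Cmp n (Cmp n t u) v) (Cmp n t (Cmp n u v))"
| interchange: "m \<noteq> n \<Longrightarrow>
    ceq X R (Cmp m (Cmp n t u) (Cmp n v w)) (Cmp m (Cmp n t u) (Cmp n v w)) \<Longrightarrow>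
    ceq X R (Cmp n (Cmp m t v) (Cmp m u w)) (Cmp n (Cmp m t v) (Cmp m u w)) \<Longrightarrow>
    ceq X R (Cmp m (Cmp n t u) (Cmp n v w)) (Cmp n (Cmp m t v) (Cmp m u w))"

definition presented :: "'a set \<Rightarrow> ('a cterm \<times> 'a cterm) set \<Rightarrow> 'a cterm set ocat" where
  "presented X R =
     \<lparr>cells = {Collect (ceq X R t) | t. ceq X R t t},
      bd = (\<lambda>\<alpha> n c. {u. \<exists>t\<in>c. ceq X R (Bd \<alpha> n t) u}),
      cmp = (\<lambda>n c d. {v. \<exists>t\<in>c. \<exists>u\<in>d. ceq X R (Cmp n t u) v})\<rparr>"

primrec eval :: "'d ocat \<Rightarrow> ('a \<Rightarrow> 'd) \<Rightarrow> 'a cterm \<Rightarrow> 'd" where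
  "eval D v (Gen x) = v x"
| "eval D v (Bd \<alpha> n t) = bd D \<alpha> n (eval D v t)"
| "eval D v (Cmp n t u) = cmp D n (eval D v t) (eval D v u)"

text \<open>The map on classes of expressions that is induced by an assignment of the generators; it is
  well defined as soon as the assignment respects the relations.\<close>

definition lift :: "'d ocat \<Rightarrow> ('a \<Rightarrow> 'd) \<Rightarrow> 'a cterm set \<Rightarrow> 'd" where
  "lift D v c = the_elem (eval D v ` c)"

definition bd_rels :: "('a \<Rightarrow> 'b) \<Rightarrow> ('a, 'm) globset_scheme \<Rightarrow> ('b cterm \<times> 'b cterm) set" where
  "bd_rels i G = {(Bd \<alpha> n (Gen (i x)), Gen (i (bd G \<alpha> n x))) | \<alpha> n x. x \<in> cells G}"

definition cmp_rels :: "('a \<Rightarrow> 'b) \<Rightarrow> 'a ocat \<Rightarrow> ('b cterm \<times> 'b cterm) set" where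
  "cmp_rels i C =
     {(Cmp n (Gen (i x)) (Gen (i y)), Gen (i (cmp C n x y))) | n x y. composable C n x y}"


subsection \<open>The free omega-category functor and its counit\<close>

definition free_ocat :: "('a, 'm) globset_scheme \<Rightarrow> 'a cterm set ocat" where
  "free_ocat G = presented (cells G) (bd_rels (\<lambda>x. x) G)"

definition free_unit :: "('a, 'm) globset_scheme \<Rightarrow> 'a \<Rightarrow> 'a cterm set" where
  "free_unit G x = Collect (ceq (cells G) (bd_rels (\<lambda>x. x) G) (Gen x))"

definition free_map :: "('b, 'm) globset_scheme \<Rightarrow> ('a \<Rightarrow> 'b) \<Rightarrow> 'a cterm set \<Rightarrow> 'b cterm set" where
  "free_map H h = lift (free_ocat H) (\<lambda>x. free_unit H (h x))"

definition counit :: "'a ocat \<Rightarrow> 'a cterm set \<Rightarrow> 'a" where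
  "counit C = lift C (\<lambda>x. x)"


subsection \<open>Pushouts\<close>

definition pushout_rels :: "'a ocat \<Rightarrow> ('a \<Rightarrow> 'b) \<Rightarrow> 'b ocat \<Rightarrow> ('a \<Rightarrow> 'c) \<Rightarrow> 'c ocat \<Rightarrow>
    (('b + 'c) cterm \<times> ('b + 'c) cterm) set" where
  "pushout_rels A f B g C =
     bd_rels Inl B \<union> cmp_rels Inl B \<union> bd_rels Inr C \<union> cmp_rels Inr C \<union>
     {(Gen (Inl (f a)), Gen (Inr (g a))) | a. a \<in> cells A}"

text \<open>The pushout of \<open>f : A \<rightarrow> B\<close> and \<open>g : A \<rightarrow> C\<close>.\<close>

definition pushout :: "'a ocat \<Rightarrow> ('a \<Rightarrow> 'b) \<Rightarrow> 'b ocat \<Rightarrow> ('a \<Rightarrow> 'c) \<Rightarrow> 'c ocat \<Rightarrow>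
    ('b + 'c) cterm set ocat" where
  "pushout A f B g C = presented (Inl ` cells B \<union> Inr ` cells C) (pushout_rels A f B g C)"

definition pushout_in :: "'a ocat \<Rightarrow> ('a \<Rightarrow> 'b) \<Rightarrow> 'b ocat \<Rightarrow> ('a \<Rightarrow> 'c) \<Rightarrow> 'c ocat \<Rightarrow>
    'b + 'c \<Rightarrow> ('b + 'c) cterm set" where
  "pushout_in A f B g C z =
     Collect (ceq (Inl ` cells B \<union> Inr ` cells C) (pushout_rels A f B g C) (Gen z))"


subsection \<open>Universal properties\<close>

primrec defd :: "'a set \<Rightarrow> 'd ocat \<Rightarrow> ('a \<Rightarrow> 'd) \<Rightarrow> 'a cterm \<Rightarrow> bool" where
  "defd X D v (Gen x) \<longleftrightarrow> x \<in> X"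
| "defd X D v (Bd \<alpha> n t) \<longleftrightarrow> defd X D v t"
| "defd X D v (Cmp n t u) \<longleftrightarrow>
     defd X D v t \<and> defd X D v u \<and> composable D n (eval D v t) (eval D v u)"

definition models :: "'a set \<Rightarrow> ('a cterm \<times> 'a cterm) set \<Rightarrow> 'd ocat \<Rightarrow> ('a \<Rightarrow> 'd) \<Rightarrow> bool" where
  "models X R D v \<longleftrightarrow> (\<forall>x\<in>X. v x \<in> cells D) \<and>
     (\<forall>(t, u)\<in>R. defd X D v t \<and> defd X D v u \<and> eval D v t = eval D v u)"

lemma eval_cells:
  assumes "omega_category D" "\<forall>x\<in>X. v x \<in> cells D" "defd X D v t"
  shows "eval D v t \<in> cells D"
  using assms(3)
  by (induction t) (simp_all add: assms(2) omega_categoryD(2,3)[OF assms(1)])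

lemma eval_sound:
  assumes D: "omega_category D" and v: "models X R D v" and "ceq X R t u"
  shows "defd X D v t \<and> defd X D v u \<and> eval D v t = eval D v u"
proof -
  have vX: "\<forall>x\<in>X. v x \<in> cells D" using v by (simp add: models_def)
  note cells = eval_cells[OF D vX]
  note D' = omega_categoryD[OF D]
  show ?thesis
    using assms(3)
  proof (induction rule: ceq.induct)
    case (rel t u)
    then show ?case using v by (auto simp: models_def)
  next
    case (bd_bd t \<beta> m \<alpha> n)
    then show ?case by (simp add: cells D'(4))
  next
    case (cmp t t' u u' n)
    then show ?case by (simp add: cells composable_def)
  next
    case (unit_left t n)
    then show ?case by (simp add: cells composable_def D'(3,4,6))
  next
    case (unit_right t n)
    then show ?case by (simp add: cells composable_def D'(3,4,7))
  next
    case (src_cmp n t u)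
    then show ?case by (simp add: D'(8))
  next
    case (tgt_cmp n t u)
    then show ?case by (simp add: D'(9))
  next
    case (bd_cmp n t u m \<alpha>)
    then show ?case by (simp add: D'(10) composable_bd[OF D])
  next
    case (assoc n t u v)
    then show ?case by (simp add: D'(11))
  next
    case (interchange m n t u v w)
    then show ?case by (simp add: D'(12))
  qed simp_all
qed

locale presentation =
  fixes X :: "'a set" and R :: "('a cterm \<times> 'a cterm) set"
begin

abbreviation eqv (infix "\<approx>" 50) where "t \<approx> u \<equiv> ceq X R t u"
abbreviation cls where "cls t \<equiv> Collect (ceq X R t)"

primrec well_formed :: "'a cterm \<Rightarrow> bool" where
  "well_formed (Gen x) \<longleftrightarrow> x \<in> X"
| "well_formed (Bd \<alpha> n t) \<longleftrightarrow> t \<approx> t"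
| "well_formed (Cmp n t u) \<longleftrightarrow> t \<approx> t \<and> u \<approx> u \<and> Bd Plus n t \<approx> Bd Minus n u"

lemma refl_l: "t \<approx> u \<Longrightarrow> t \<approx> t" and refl_r: "t \<approx> u \<Longrightarrow> u \<approx> u"
  by (meson ceq.sym ceq.trans)+

lemma cls_eq: "t \<approx> t \<Longrightarrow> cls t = cls u \<longleftrightarrow> t \<approx> u"
  by (metis (no_types) Collect_cong ceq.sym ceq.trans mem_Collect_eq)

lemma cellsE: assumes "c \<in> cells (presented X R)" obtains t where "t \<approx> t" "c = cls t"
  using assms by (auto simp: presented_def)

lemma cells_cls: "t \<approx> t \<Longrightarrow> cls t \<in> cells (presented X R)"
  by (auto simp: presented_def)

lemma bd_cls: "t \<approx> t \<Longrightarrow> bd (presented X R) \<alpha> n (cls t) = cls (Bd \<alpha> n t)"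
  unfolding presented_def by (simp add: set_eq_iff) (meson ceq.bd ceq.trans)

lemma cmp_cls:
  assumes "t \<approx> t" "u \<approx> u" "Bd Plus n t \<approx> Bd Minus n u"
  shows "cmp (presented X R) n (cls t) (cls u) = cls (Cmp n t u)"
  using assms unfolding presented_def by (simp add: set_eq_iff) (meson ceq.cmp ceq.trans)

lemma composable_cls:
  assumes "t \<approx> t" "u \<approx> u"
  shows "composable (presented X R) n (cls t) (cls u) \<longleftrightarrow> Bd Plus n t \<approx> Bd Minus n u"
  using assms by (simp add: composable_def cells_cls bd_cls cls_eq ceq.bd)

lemma composableE:
  assumes "composable (presented X R) n c d"
  obtains t u where "t \<approx> t" "u \<approx> u" "Bd Plus n t \<approx> Bd Minus n u" "c = cls t" "d = cls u"
  using assms by (metis cellsE composable_cls composable_def)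

lemma bd_bd_le: "t \<approx> t \<Longrightarrow> n \<le> m \<Longrightarrow> Bd \<beta> m (Bd \<alpha> n t) \<approx> Bd \<alpha> n t"
  using ceq.bd_bd[of X R t \<beta> m \<alpha> n] by simp

lemma bd_bd_less: "t \<approx> t \<Longrightarrow> m < n \<Longrightarrow> Bd \<beta> m (Bd \<alpha> n t) \<approx> Bd \<beta> m t"
  using ceq.bd_bd[of X R t \<beta> m \<alpha> n] by simp

lemma composable_Bd:
  assumes t: "t \<approx> t" and u: "u \<approx> u" and e: "Bd Plus n t \<approx> Bd Minus n u" and "m \<noteq> n"
  shows "Bd Plus n (Bd \<alpha> m t) \<approx> Bd Minus n (Bd \<alpha> m u)"
proof (cases "n < m")
  case True
  show ?thesis
    using bd_bd_less[OF t True] e ceq.sym[OF bd_bd_less[OF u True]] by (meson ceq.trans)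
next
  case False
  then have m: "m < n" using assms(4) by simp
  have "Bd \<alpha> m t \<approx> Bd \<alpha> m u"
    using ceq.sym[OF bd_bd_less[OF t m]] ceq.bd[OF e] bd_bd_less[OF u m] by (meson ceq.trans)
  then show ?thesis
    using bd_bd_le[OF t less_imp_le[OF m]] ceq.sym[OF bd_bd_le[OF u less_imp_le[OF m]]]
    by (meson ceq.trans)
qed

end

locale well_formed_presentation = presentation +
  assumes finite_dim: "x \<in> X \<Longrightarrow> \<exists>n. \<forall>\<alpha>. Bd \<alpha> n (Gen x) \<approx> Gen x"
    and well_formed_rel: "(t, u) \<in> R \<Longrightarrow> well_formed t \<and> well_formed u"
begin

lemma well_formed: "t \<approx> u \<Longrightarrow> well_formed t \<and> well_formed u"
proof (induction rule: ceq.induct)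
  case (rel t u)
  then show ?case by (rule well_formed_rel)
next
  case (bd t u \<alpha> n)
  then show ?case by (simp add: refl_l refl_r)
next
  case (cmp t t' u u' n)
  have "Bd Plus n t' \<approx> Bd Minus n u'"
    using ceq.sym[OF ceq.bd[OF cmp.hyps(1)]] cmp.hyps(3) ceq.bd[OF cmp.hyps(2)]
    by (meson ceq.trans)
  then show ?case using cmp.hyps by (simp add: refl_l[OF cmp.hyps(1)] refl_l[OF cmp.hyps(2)]
        refl_r[OF cmp.hyps(1)] refl_r[OF cmp.hyps(2)])
next
  case (bd_bd t \<beta> m \<alpha> n)
  then show ?case by (simp add: ceq.bd)
next
  case (unit_left t n)
  then show ?case by (simp add: ceq.bd bd_bd_le)
next
  case (unit_right t n)
  then show ?case by (simp add: ceq.bd ceq.sym[OF bd_bd_le])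
next
  case (bd_cmp n t u m \<alpha>)
  then show ?case by (simp add: ceq.bd composable_Bd)
qed simp_all

lemma CmpD:
  assumes "Cmp n t u \<approx> Cmp n t u"
  shows "t \<approx> t" "u \<approx> u" "Bd Plus n t \<approx> Bd Minus n u"
  using well_formed[OF assms] by simp_all

lemma finite_dim_term: "t \<approx> t \<Longrightarrow> \<exists>n. \<forall>\<alpha>. \<forall>m\<ge>n. Bd \<alpha> m t \<approx> t"
proof (induction t)
  case (Gen x)
  then have "x \<in> X" using well_formed[OF Gen] by simp
  then obtain n where n: "Bd \<alpha> n (Gen x) \<approx> Gen x" for \<alpha> using finite_dim by blast
  have "Bd \<alpha> m (Gen x) \<approx> Gen x" if "n \<le> m" for \<alpha> m
    using ceq.sym[OF ceq.bd[OF n]] bd_bd_le[OF Gen that] n by (meson ceq.trans)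
  then show ?case by blast
next
  case (Bd \<alpha> k t)
  then have "t \<approx> t" using well_formed[OF Bd.prems] by simp
  then show ?case using bd_bd_le by blast
next
  case (Cmp k t u)
  note w = CmpD[OF Cmp.prems]
  obtain n1 where n1: "Bd \<alpha> m t \<approx> t" if "n1 \<le> m" for \<alpha> m using Cmp.IH(1)[OF w(1)] by blast
  obtain n2 where n2: "Bd \<alpha> m u \<approx> u" if "n2 \<le> m" for \<alpha> m using Cmp.IH(2)[OF w(2)] by blast
  have "Bd \<alpha> m (Cmp k t u) \<approx> Cmp k t u" if m: "max (Suc k) (max n1 n2) \<le> m" for \<alpha> m
  proof -
    have "Bd \<alpha> m (Cmp k t u) \<approx> Cmp k (Bd \<alpha> m t) (Bd \<alpha> m u)"
      using m by (intro ceq.bd_cmp Cmp.prems) simp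
    moreover have "Cmp k (Bd \<alpha> m t) (Bd \<alpha> m u) \<approx> Cmp k t u"
      using m by (intro ceq.cmp n1 n2 composable_Bd w) simp_all
    ultimately show ?thesis by (rule ceq.trans)
  qed
  then show ?case by blast
qed

lemma globular_set_presented: "globular_set (presented X R)"
  unfolding globular_set_def
proof (intro conjI ballI allI)
  fix c \<alpha> \<beta> m n
  assume "c \<in> cells (presented X R)"
  then obtain t where t: "t \<approx> t" "c = cls t" by (rule cellsE)
  then show "bd (presented X R) \<alpha> n c \<in> cells (presented X R)"
    by (simp add: bd_cls cells_cls ceq.bd)
  show "bd (presented X R) \<beta> m (bd (presented X R) \<alpha> n c) =
      (if m < n then bd (presented X R) \<beta> m c else bd (presented X R) \<alpha> n c)"
    using t by (simp add: bd_cls ceq.bd cls_eq bd_bd_le bd_bd_less)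
  obtain k where "Bd \<alpha> k t \<approx> t" for \<alpha> using finite_dim_term[OF t(1)] by blast
  then show "\<exists>n. src (presented X R) n c = c \<and> tgt (presented X R) n c = c"
    using t by (metis bd_cls cls_eq ceq.bd)
qed

theorem omega_category_presented: "omega_category (presented X R)"
  unfolding omega_category_def
proof (intro conjI allI impI ballI globular_set_presented)
  fix n x y assume "composable (presented X R) n x y"
  then obtain t u where t: "t \<approx> t" "u \<approx> u" "Bd Plus n t \<approx> Bd Minus n u" "x = cls t" "y = cls u"
    by (rule composableE)
  note tu = ceq.cmp[OF t(1-3)]
  show "cmp (presented X R) n x y \<in> cells (presented X R)"
    using t tu by (simp add: cmp_cls cells_cls)
  show "src (presented X R) n (cmp (presented X R) n x y) = src (presented X R) n x"
    using t tu by (simp add: cmp_cls bd_cls cls_eq ceq.bd ceq.src_cmp)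
  show "tgt (presented X R) n (cmp (presented X R) n x y) = tgt (presented X R) n y"
    using t tu by (simp add: cmp_cls bd_cls cls_eq ceq.bd ceq.tgt_cmp)
  fix \<alpha> m assume "m \<noteq> n"
  then show "bd (presented X R) \<alpha> m (cmp (presented X R) n x y) =
      cmp (presented X R) n (bd (presented X R) \<alpha> m x) (bd (presented X R) \<alpha> m y)"
    using t tu by (simp add: cmp_cls bd_cls cls_eq ceq.bd ceq.bd_cmp composable_Bd)
next
  fix n x assume "x \<in> cells (presented X R)"
  then obtain t where t: "t \<approx> t" "x = cls t" by (rule cellsE)
  show "cmp (presented X R) n (src (presented X R) n x) x = x"
    "cmp (presented X R) n x (tgt (presented X R) n x) = x"
    using t ceq.unit_left[OF t(1), of n] ceq.unit_right[OF t(1), of n]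
    by (simp_all add: bd_cls cmp_cls ceq.bd bd_bd_le ceq.sym[OF bd_bd_le] cls_eq refl_l)
next
  fix n x y z
  assume 1: "composable (presented X R) n x y" "composable (presented X R) n (cmp (presented X R) n x y) z"
    and 2: "composable (presented X R) n y z" "composable (presented X R) n x (cmp (presented X R) n y z)"
  obtain t u where t: "t \<approx> t" "u \<approx> u" "Bd Plus n t \<approx> Bd Minus n u" "x = cls t" "y = cls u"
    using 1(1) by (rule composableE)
  obtain v where v: "v \<approx> v" "z = cls v"
    using 2(1) by (metis cellsE composable_def)
  have uv: "Bd Plus n u \<approx> Bd Minus n v"
    using 2(1) t v by (simp add: composable_cls)
  note d = ceq.cmp[OF t(1-3)] ceq.cmp[OF t(2) v(1) uv]
  have "Bd Plus n (Cmp n t u) \<approx> Bd Minus n v"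
    using 1(2) t v d by (simp add: cmp_cls composable_cls)
  moreover have "Bd Plus n t \<approx> Bd Minus n (Cmp n u v)"
    using 2(2) t v d uv by (simp add: cmp_cls composable_cls)
  ultimately show "cmp (presented X R) n (cmp (presented X R) n x y) z =
      cmp (presented X R) n x (cmp (presented X R) n y z)"
    using t v uv d by (simp add: cmp_cls cls_eq ceq.cmp ceq.assoc)
next
  fix m n x y z w
  let ?P = "presented X R"
  assume mn: "m \<noteq> (n::nat)"
    and 1: "composable ?P n x y" "composable ?P n z w" "composable ?P m (cmp ?P n x y) (cmp ?P n z w)"
    and 2: "composable ?P m x z" "composable ?P m y w" "composable ?P n (cmp ?P m x z) (cmp ?P m y w)"
  obtain t u where t: "t \<approx> t" "u \<approx> u" "Bd Plus n t \<approx> Bd Minus n u" "x = cls t" "y = cls u"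
    using 1(1) by (rule composableE)
  obtain v q where v: "v \<approx> v" "q \<approx> q" "Bd Plus n v \<approx> Bd Minus n q" "z = cls v" "w = cls q"
    using 1(2) by (rule composableE)
  have e: "Bd Plus m t \<approx> Bd Minus m v" "Bd Plus m u \<approx> Bd Minus m q"
    using 2(1,2) t v by (simp_all add: composable_cls)
  note d = ceq.cmp[OF t(1-3)] ceq.cmp[OF v(1-3)] ceq.cmp[OF t(1) v(1) e(1)] ceq.cmp[OF t(2) v(2) e(2)]
  have "Bd Plus m (Cmp n t u) \<approx> Bd Minus m (Cmp n v q)"
    using 1(3) t v d by (simp add: cmp_cls composable_cls)
  moreover have "Bd Plus n (Cmp m t v) \<approx> Bd Minus n (Cmp m u q)"
    using 2(3) t v d e by (simp add: cmp_cls composable_cls)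
  ultimately show "cmp ?P m (cmp ?P n x y) (cmp ?P n z w) = cmp ?P n (cmp ?P m x z) (cmp ?P m y w)"
    using t v d e mn by (simp add: cmp_cls cls_eq ceq.cmp ceq.interchange)
qed

lemma lift_cls:
  assumes "omega_category D" "models X R D v" "t \<approx> t"
  shows "lift D v (cls t) = eval D v t"
proof -
  have "eval D v u = eval D v t" if "u \<in> cls t" for u
    using eval_sound[OF assms(1,2), of t u] that by simp
  moreover have "cls t \<noteq> {}" using assms(3) by blast
  ultimately show ?thesis unfolding lift_def by (metis the_elem_image_unique)
qed

theorem presented_universal:
  assumes D: "omega_category D" and v: "models X R D v"
  shows "omega_functor (lift D v) (presented X R) D"
    and "x \<in> X \<Longrightarrow> lift D v (cls (Gen x)) = v x"
    and "omega_functor h (presented X R) D \<Longrightarrow> (\<And>x. x \<in> X \<Longrightarrow> h (cls (Gen x)) = v x) \<Longrightarrow>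
           c \<in> cells (presented X R) \<Longrightarrow> h c = lift D v c"
proof -
  note l = lift_cls[OF D v]
  have vX: "\<forall>x\<in>X. v x \<in> cells D" using v by (simp add: models_def)
  show "omega_functor (lift D v) (presented X R) D"
    unfolding omega_functor_def glob_map_def
  proof (intro conjI ballI allI impI)
    fix c \<alpha> n assume "c \<in> cells (presented X R)"
    then obtain t where t: "t \<approx> t" "c = cls t" by (rule cellsE)
    show "lift D v c \<in> cells D"
      using t eval_cells[OF D vX] eval_sound[OF D v t(1)] by (simp add: l)
    show "lift D v (bd (presented X R) \<alpha> n c) = bd D \<alpha> n (lift D v c)"
      using t by (simp add: bd_cls l ceq.bd)
  next
    fix n x y assume "composable (presented X R) n x y"
    then obtain t u where t: "t \<approx> t" "u \<approx> u" "Bd Plus n t \<approx> Bd Minus n u" "x = cls t" "y = cls u"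
      by (rule composableE)
    then show "lift D v (cmp (presented X R) n x y) = cmp D n (lift D v x) (lift D v y)"
      by (simp add: cmp_cls l ceq.cmp)
  qed
  show "x \<in> X \<Longrightarrow> lift D v (cls (Gen x)) = v x"
    by (simp add: l ceq.gen)
  assume h: "omega_functor h (presented X R) D" "\<And>x. x \<in> X \<Longrightarrow> h (cls (Gen x)) = v x"
    and "c \<in> cells (presented X R)"
  then obtain t where t: "t \<approx> t" "c = cls t" by (metis cellsE)
  have "t \<approx> t \<Longrightarrow> h (cls t) = eval D v t" for t
  proof (induction t)
    case (Gen x)
    then show ?case using well_formed[OF Gen] by (simp add: h(2))
  next
    case (Bd \<alpha> n t)
    then have t: "t \<approx> t" using well_formed[OF Bd.prems] by simp
    then have "h (cls (Bd \<alpha> n t)) = bd D \<alpha> n (h (cls t))"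
      using h(1) cells_cls[OF t] by (simp add: bd_cls[symmetric] omega_functor_def glob_map_def)
    then show ?case using Bd.IH t by simp
  next
    case (Cmp n t u)
    note w = CmpD[OF Cmp.prems]
    have "h (cls (Cmp n t u)) = cmp D n (h (cls t)) (h (cls u))"
      using h(1) w by (simp add: cmp_cls[symmetric] omega_functor_def composable_cls)
    then show ?case using Cmp.IH w by simp
  qed
  then show "h c = lift D v c" using t by (simp add: l)
qed

end

lemma well_formed_presentation_free:
  assumes "globular_set G"
  shows "well_formed_presentation (cells G) (bd_rels (\<lambda>x. x) G)"
proof
  fix x assume x: "x \<in> cells G"
  then obtain n where "src G n x = x" "tgt G n x = x"
    using assms unfolding globular_set_def by blast
  then have "bd G \<alpha> n x = x" for \<alpha> by (cases \<alpha>) simp_all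
  then have "(Bd \<alpha> n (Gen x), Gen x) \<in> bd_rels (\<lambda>x. x) G" for \<alpha>
    using x unfolding bd_rels_def by force
  then show "\<exists>n. \<forall>\<alpha>. ceq (cells G) (bd_rels (\<lambda>x. x) G) (Bd \<alpha> n (Gen x)) (Gen x)"
    by (meson ceq.rel)
next
  fix t u assume "(t, u) \<in> bd_rels (\<lambda>x. x) G"
  then show "presentation.well_formed (cells G) (bd_rels (\<lambda>x. x) G) t \<and>
      presentation.well_formed (cells G) (bd_rels (\<lambda>x. x) G) u"
    using assms unfolding globular_set_def bd_rels_def
    by (auto simp: presentation.well_formed.simps ceq.gen)
qed

theorem omega_category_free: "globular_set G \<Longrightarrow> omega_category (free_ocat G)"
  unfolding free_ocat_def
  by (rule well_formed_presentation.omega_category_presented) (rule well_formed_presentation_free)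

theorem glob_map_free_unit:
  assumes "globular_set G"
  shows "glob_map (free_unit G) G (forget (free_ocat G))"
proof -
  interpret well_formed_presentation "cells G" "bd_rels (\<lambda>x. x) G"
    using assms by (rule well_formed_presentation_free)
  have "eqv (Bd \<alpha> n (Gen x)) (Gen (bd G \<alpha> n x))" if "x \<in> cells G" for \<alpha> n x
    using that by (intro ceq.rel) (auto simp: bd_rels_def)
  then show ?thesis
    unfolding glob_map_def free_ocat_def free_unit_def
    by (simp add: cells_cls ceq.gen bd_cls) (metis cls_eq ceq.bd ceq.gen)
qed

theorem free_universal:
  assumes G: "globular_set G" and D: "omega_category D" and v: "glob_map v G (forget D)"
  shows "omega_functor (lift D v) (free_ocat G) D"
    and "x \<in> cells G \<Longrightarrow> lift D v (free_unit G x) = v x"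
    and "omega_functor h (free_ocat G) D \<Longrightarrow> (\<And>x. x \<in> cells G \<Longrightarrow> h (free_unit G x) = v x) \<Longrightarrow>
           c \<in> cells (free_ocat G) \<Longrightarrow> h c = lift D v c"
proof -
  interpret well_formed_presentation "cells G" "bd_rels (\<lambda>x. x) G"
    using G by (rule well_formed_presentation_free)
  have "models (cells G) (bd_rels (\<lambda>x. x) G) D v"
    using v G by (auto simp: models_def bd_rels_def glob_map_def globular_set_def)
  note u = presented_universal[OF D this]
  show "omega_functor (lift D v) (free_ocat G) D"
    using u(1) by (simp add: free_ocat_def)
  show "x \<in> cells G \<Longrightarrow> lift D v (free_unit G x) = v x"
    using u(2) by (simp add: free_unit_def)
  show "omega_functor h (free_ocat G) D \<Longrightarrow> (\<And>x. x \<in> cells G \<Longrightarrow> h (free_unit G x) = v x) \<Longrightarrow>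
           c \<in> cells (free_ocat G) \<Longrightarrow> h c = lift D v c"
    using u(3)[of h c] by (simp add: free_ocat_def free_unit_def)
qed

corollary omega_functor_free_map:
  assumes "globular_set G" "globular_set H" "glob_map h G H"
  shows "omega_functor (free_map H h) (free_ocat G) (free_ocat H)"
    and "x \<in> cells G \<Longrightarrow> free_map H h (free_unit G x) = free_unit H (h x)"
proof -
  have g: "glob_map (\<lambda>x. free_unit H (h x)) G (forget (free_ocat H))"
    using glob_map_free_unit[OF assms(2)] assms(3) unfolding glob_map_def by simp
  show "omega_functor (free_map H h) (free_ocat G) (free_ocat H)"
    "x \<in> cells G \<Longrightarrow> free_map H h (free_unit G x) = free_unit H (h x)"
    unfolding free_map_def
    using free_universal(1,2)[OF assms(1) omega_category_free[OF assms(2)] g] by blast+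
qed

lemma globular_set_forget: "omega_category C \<Longrightarrow> globular_set (forget C)"
  using omega_categoryD(1)[of C] unfolding globular_set_def by simp

corollary omega_functor_counit:
  assumes "omega_category C"
  shows "omega_functor (counit C) (free_ocat (forget C)) C"
    and "x \<in> cells C \<Longrightarrow> counit C (free_unit (forget C) x) = x"
proof -
  have g: "glob_map (\<lambda>x. x) (forget C) (forget C)"
    using globular_set_forget[OF assms] unfolding glob_map_def globular_set_def by simp
  show "omega_functor (counit C) (free_ocat (forget C)) C"
    "x \<in> cells C \<Longrightarrow> counit C (free_unit (forget C) x) = x"
    unfolding counit_def
    using free_universal(1,2)[OF globular_set_forget[OF assms] assms g] by simp_all
qed

lemma well_formed_presentation_pushout:
  assumes B: "omega_category B" and C: "omega_category C"
    and f: "\<And>a. a \<in> cells A \<Longrightarrow> f a \<in> cells B" and g: "\<And>a. a \<in> cells A \<Longrightarrow> g a \<in> cells C"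
  shows "well_formed_presentation (Inl ` cells B \<union> Inr ` cells C) (pushout_rels A f B g C)"
    (is "well_formed_presentation ?X ?R")
proof
  have bdB: "ceq ?X ?R (Bd \<alpha> n (Gen (Inl x))) (Gen (Inl (bd B \<alpha> n x)))" if "x \<in> cells B" for \<alpha> n x
    using that by (intro ceq.rel) (auto simp: pushout_rels_def bd_rels_def)
  have bdC: "ceq ?X ?R (Bd \<alpha> n (Gen (Inr x))) (Gen (Inr (bd C \<alpha> n x)))" if "x \<in> cells C" for \<alpha> n x
    using that by (intro ceq.rel) (auto simp: pushout_rels_def bd_rels_def)
  show "\<exists>n. \<forall>\<alpha>. ceq ?X ?R (Bd \<alpha> n (Gen z)) (Gen z)" if "z \<in> ?X" for z
    using that
  proof
    assume "z \<in> Inl ` cells B"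
    then obtain x where x: "z = Inl x" "x \<in> cells B" by blast
    then obtain n where "src B n x = x" "tgt B n x = x" using omega_categoryD(5)[OF B] by blast
    then have "bd B \<alpha> n x = x" for \<alpha> by (cases \<alpha>) simp_all
    then show ?thesis using x bdB by metis
  next
    assume "z \<in> Inr ` cells C"
    then obtain x where x: "z = Inr x" "x \<in> cells C" by blast
    then obtain n where "src C n x = x" "tgt C n x = x" using omega_categoryD(5)[OF C] by blast
    then have "bd C \<alpha> n x = x" for \<alpha> by (cases \<alpha>) simp_all
    then show ?thesis using x bdC by metis
  qed
  have cB: "ceq ?X ?R (Bd Plus n (Gen (Inl x))) (Bd Minus n (Gen (Inl y)))" if "composable B n x y" for n x y
  proof -
    have x: "x \<in> cells B" and y: "y \<in> cells B" and e: "tgt B n x = src B n y"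
      using that by (auto simp: composable_def)
    show ?thesis
      by (rule ceq.trans[OF bdB[OF x, of Plus n, unfolded e] ceq.sym[OF bdB[OF y, of Minus n]]])
  qed
  have cC: "ceq ?X ?R (Bd Plus n (Gen (Inr x))) (Bd Minus n (Gen (Inr y)))" if "composable C n x y" for n x y
  proof -
    have x: "x \<in> cells C" and y: "y \<in> cells C" and e: "tgt C n x = src C n y"
      using that by (auto simp: composable_def)
    show ?thesis
      by (rule ceq.trans[OF bdC[OF x, of Plus n, unfolded e] ceq.sym[OF bdC[OF y, of Minus n]]])
  qed
  fix t u assume "(t, u) \<in> ?R"
  then consider "(t, u) \<in> bd_rels Inl B" | "(t, u) \<in> cmp_rels Inl B" | "(t, u) \<in> bd_rels Inr C"
    | "(t, u) \<in> cmp_rels Inr C" | a where "a \<in> cells A" "t = Gen (Inl (f a))" "u = Gen (Inr (g a))"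
    unfolding pushout_rels_def by blast
  then show "presentation.well_formed ?X ?R t \<and> presentation.well_formed ?X ?R u"
  proof cases
    case 1
    then show ?thesis using omega_categoryD(3)[OF B]
      by (auto simp: bd_rels_def presentation.well_formed.simps ceq.gen)
  next
    case 2
    then obtain n x y where "t = Cmp n (Gen (Inl x)) (Gen (Inl y))" "u = Gen (Inl (cmp B n x y))"
      "composable B n x y" unfolding cmp_rels_def by blast
    moreover from this(3) have "x \<in> cells B" "y \<in> cells B" by (auto simp: composable_def)
    ultimately show ?thesis
      by (simp add: presentation.well_formed.simps ceq.gen cB omega_categoryD(2)[OF B])
  next
    case 3
    then show ?thesis using omega_categoryD(3)[OF C]
      by (auto simp: bd_rels_def presentation.well_formed.simps ceq.gen)
  next
    case 4
    then obtain n x y where "t = Cmp n (Gen (Inr x)) (Gen (Inr y))" "u = Gen (Inr (cmp C n x y))"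
      "composable C n x y" unfolding cmp_rels_def by blast
    moreover from this(3) have "x \<in> cells C" "y \<in> cells C" by (auto simp: composable_def)
    ultimately show ?thesis
      by (simp add: presentation.well_formed.simps ceq.gen cC omega_categoryD(2)[OF C])
  next
    case 5
    then show ?thesis using f g by (simp add: presentation.well_formed.simps)
  qed
qed

theorem omega_category_pushout:
  assumes "omega_category B" "omega_category C" "omega_functor f A B" "omega_functor g A C"
  shows "omega_category (pushout A f B g C)"
  unfolding pushout_def
  by (rule well_formed_presentation.omega_category_presented, rule well_formed_presentation_pushout)
    (use assms in \<open>auto simp: omega_functor_def glob_map_def\<close>)

theorem pushout_square:
  assumes B: "omega_category B" and C: "omega_category C"
    and f: "omega_functor f A B" and g: "omega_functor g A C"
  shows "omega_functor (\<lambda>x. pushout_in A f B g C (Inl x)) B (pushout A f B g C)"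
    and "omega_functor (\<lambda>x. pushout_in A f B g C (Inr x)) C (pushout A f B g C)"
    and "a \<in> cells A \<Longrightarrow> pushout_in A f B g C (Inl (f a)) = pushout_in A f B g C (Inr (g a))"
proof -
  let ?X = "Inl ` cells B \<union> Inr ` cells C" and ?R = "pushout_rels A f B g C"
  have fg: "\<And>a. a \<in> cells A \<Longrightarrow> f a \<in> cells B" "\<And>a. a \<in> cells A \<Longrightarrow> g a \<in> cells C"
    using f g by (simp_all add: omega_functor_def glob_map_def)
  interpret well_formed_presentation ?X ?R
    using well_formed_presentation_pushout[where A = A and f = f and g = g, OF B C fg] .
  have P: "pushout A f B g C = presented ?X ?R" "pushout_in A f B g C z = cls (Gen z)" for z
    by (simp_all add: pushout_def pushout_in_def)
  have gB: "eqv (Gen (Inl x)) (Gen (Inl x))" if "x \<in> cells B" for x using that by (intro ceq.gen) blast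
  have gC: "eqv (Gen (Inr x)) (Gen (Inr x))" if "x \<in> cells C" for x using that by (intro ceq.gen) blast
  have r: "eqv (t) (u)" if "(t, u) \<in> ?R" for t u using that by (rule ceq.rel)
  show "omega_functor (\<lambda>x. pushout_in A f B g C (Inl x)) B (pushout A f B g C)"
    unfolding omega_functor_def glob_map_def P
  proof (intro conjI ballI allI impI)
    fix x \<alpha> n assume x: "x \<in> cells B"
    then show "cls (Gen (Inl x)) \<in> cells (presented ?X ?R)" by (intro cells_cls gB)
    have "eqv (Bd \<alpha> n (Gen (Inl x))) (Gen (Inl (bd B \<alpha> n x)))" using x by (intro r) (auto simp: pushout_rels_def bd_rels_def cmp_rels_def)
    then show "cls (Gen (Inl (bd B \<alpha> n x))) = bd (presented ?X ?R) \<alpha> n (cls (Gen (Inl x)))"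
      using gB[OF x] by (simp add: bd_cls) (metis cls_eq ceq.bd)
  next
    fix n x y assume xy: "composable B n x y"
    have e: "eqv (Cmp n (Gen (Inl x)) (Gen (Inl y))) (Gen (Inl (cmp B n x y)))" using xy by (intro r) (auto simp: pushout_rels_def bd_rels_def cmp_rels_def)
    note w = CmpD[OF refl_l[OF e]]
    show "cls (Gen (Inl (cmp B n x y))) = cmp (presented ?X ?R) n (cls (Gen (Inl x))) (cls (Gen (Inl y)))"
      unfolding cmp_cls[OF w] using e by (metis cls_eq refl_l)
  qed
  show "omega_functor (\<lambda>x. pushout_in A f B g C (Inr x)) C (pushout A f B g C)"
    unfolding omega_functor_def glob_map_def P
  proof (intro conjI ballI allI impI)
    fix x \<alpha> n assume x: "x \<in> cells C"
    then show "cls (Gen (Inr x)) \<in> cells (presented ?X ?R)" by (intro cells_cls gC)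
    have "eqv (Bd \<alpha> n (Gen (Inr x))) (Gen (Inr (bd C \<alpha> n x)))" using x by (intro r) (auto simp: pushout_rels_def bd_rels_def cmp_rels_def)
    then show "cls (Gen (Inr (bd C \<alpha> n x))) = bd (presented ?X ?R) \<alpha> n (cls (Gen (Inr x)))"
      using gC[OF x] by (simp add: bd_cls) (metis cls_eq ceq.bd)
  next
    fix n x y assume xy: "composable C n x y"
    have e: "eqv (Cmp n (Gen (Inr x)) (Gen (Inr y))) (Gen (Inr (cmp C n x y)))" using xy by (intro r) (auto simp: pushout_rels_def bd_rels_def cmp_rels_def)
    note w = CmpD[OF refl_l[OF e]]
    show "cls (Gen (Inr (cmp C n x y))) = cmp (presented ?X ?R) n (cls (Gen (Inr x))) (cls (Gen (Inr y)))"
      unfolding cmp_cls[OF w] using e by (metis cls_eq refl_l)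
  qed
  assume a: "a \<in> cells A"
  have "eqv (Gen (Inl (f a))) (Gen (Inr (g a)))" using a by (intro r) (auto simp: pushout_rels_def bd_rels_def cmp_rels_def)
  then show "pushout_in A f B g C (Inl (f a)) = pushout_in A f B g C (Inr (g a))"
    unfolding P by (metis cls_eq refl_l)
qed

theorem pushout_universal:
  assumes B: "omega_category B" and C: "omega_category C"
    and f: "omega_functor f A B" and g: "omega_functor g A C"
    and D: "omega_category D" and h: "omega_functor h B D" and k: "omega_functor k C D"
    and hk: "\<And>a. a \<in> cells A \<Longrightarrow> h (f a) = k (g a)"
  shows "omega_functor (lift D (case_sum h k)) (pushout A f B g C) D"
    and "x \<in> cells B \<Longrightarrow> lift D (case_sum h k) (pushout_in A f B g C (Inl x)) = h x"
    and "y \<in> cells C \<Longrightarrow> lift D (case_sum h k) (pushout_in A f B g C (Inr y)) = k y"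
    and "omega_functor l (pushout A f B g C) D \<Longrightarrow>
           (\<And>x. x \<in> cells B \<Longrightarrow> l (pushout_in A f B g C (Inl x)) = h x) \<Longrightarrow>
           (\<And>y. y \<in> cells C \<Longrightarrow> l (pushout_in A f B g C (Inr y)) = k y) \<Longrightarrow>
           c \<in> cells (pushout A f B g C) \<Longrightarrow> l c = lift D (case_sum h k) c"
proof -
  let ?X = "Inl ` cells B \<union> Inr ` cells C" and ?R = "pushout_rels A f B g C"
  have fg: "\<And>a. a \<in> cells A \<Longrightarrow> f a \<in> cells B" "\<And>a. a \<in> cells A \<Longrightarrow> g a \<in> cells C"
    using f g by (simp_all add: omega_functor_def glob_map_def)
  interpret well_formed_presentation ?X ?R
    using well_formed_presentation_pushout[where A = A and f = f and g = g, OF B C fg] .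
  have h': "x \<in> cells B \<Longrightarrow> h x \<in> cells D" "x \<in> cells B \<Longrightarrow> h (bd B \<alpha> n x) = bd D \<alpha> n (h x)"
    "composable B n x y \<Longrightarrow> h (cmp B n x y) = cmp D n (h x) (h y)" for x y \<alpha> n
    using h by (simp_all add: omega_functor_def glob_map_def)
  have k': "x \<in> cells C \<Longrightarrow> k x \<in> cells D" "x \<in> cells C \<Longrightarrow> k (bd C \<alpha> n x) = bd D \<alpha> n (k x)"
    "composable C n x y \<Longrightarrow> k (cmp C n x y) = cmp D n (k x) (k y)" for x y \<alpha> n
    using k by (simp_all add: omega_functor_def glob_map_def)
  have ch: "composable D n (h x) (h y)" if "composable B n x y" for n x y
    using that unfolding composable_def by (metis h'(1,2))
  have ck: "composable D n (k x) (k y)" if "composable C n x y" for n x y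
    using that unfolding composable_def by (metis k'(1,2))
  have "defd ?X D (case_sum h k) t \<and> defd ?X D (case_sum h k) u \<and>
      eval D (case_sum h k) t = eval D (case_sum h k) u" if tu: "(t, u) \<in> ?R" for t u
  proof -
    consider "(t, u) \<in> bd_rels Inl B" | "(t, u) \<in> cmp_rels Inl B" | "(t, u) \<in> bd_rels Inr C"
      | "(t, u) \<in> cmp_rels Inr C" | a where "a \<in> cells A" "t = Gen (Inl (f a))" "u = Gen (Inr (g a))"
      using tu unfolding pushout_rels_def by blast
    then show ?thesis
    proof cases
      case 1
      then show ?thesis by (auto simp: bd_rels_def h'(2) omega_categoryD(3)[OF B])
    next
      case 2
      then obtain n x y where xy: "t = Cmp n (Gen (Inl x)) (Gen (Inl y))" "u = Gen (Inl (cmp B n x y))"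
        "composable B n x y" unfolding cmp_rels_def by blast
      then have "x \<in> cells B" "y \<in> cells B" by (simp_all add: composable_def)
      then show ?thesis using xy by (simp add: h'(3) ch omega_categoryD(2)[OF B])
    next
      case 3
      then show ?thesis by (auto simp: bd_rels_def k'(2) omega_categoryD(3)[OF C])
    next
      case 4
      then obtain n x y where xy: "t = Cmp n (Gen (Inr x)) (Gen (Inr y))" "u = Gen (Inr (cmp C n x y))"
        "composable C n x y" unfolding cmp_rels_def by blast
      then have "x \<in> cells C" "y \<in> cells C" by (simp_all add: composable_def)
      then show ?thesis using xy by (simp add: k'(3) ck omega_categoryD(2)[OF C])
    next
      case 5
      then show ?thesis using fg hk by simp
    qed
  qed
  moreover have "\<forall>z\<in>?X. case_sum h k z \<in> cells D" using h'(1) k'(1) by auto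
  ultimately have "models ?X ?R D (case_sum h k)" unfolding models_def by blast
  note u = presented_universal[OF D this, folded pushout_def pushout_in_def]
  show "omega_functor (lift D (case_sum h k)) (pushout A f B g C) D"
    by (rule u(1))
  show "x \<in> cells B \<Longrightarrow> lift D (case_sum h k) (pushout_in A f B g C (Inl x)) = h x"
    using u(2)[of "Inl x"] by simp
  show "y \<in> cells C \<Longrightarrow> lift D (case_sum h k) (pushout_in A f B g C (Inr y)) = k y"
    using u(2)[of "Inr y"] by simp
  show "omega_functor l (pushout A f B g C) D \<Longrightarrow>
           (\<And>x. x \<in> cells B \<Longrightarrow> l (pushout_in A f B g C (Inl x)) = h x) \<Longrightarrow>
           (\<And>y. y \<in> cells C \<Longrightarrow> l (pushout_in A f B g C (Inr y)) = k y) \<Longrightarrow>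
           c \<in> cells (pushout A f B g C) \<Longrightarrow> l c = lift D (case_sum h k) c"
    by (rule u(3)) auto
qed


section \<open>Coproducts\<close>

text \<open>The disjoint union of a family of omega-categories.\<close>

definition coprod :: "'i set \<Rightarrow> ('i \<Rightarrow> 'a ocat) \<Rightarrow> ('i \<times> 'a) ocat" where
  "coprod J C =
     \<lparr>cells = Sigma J (\<lambda>i. cells (C i)),
      bd = (\<lambda>\<alpha> n (i, x). (i, bd (C i) \<alpha> n x)),
      cmp = (\<lambda>n (i, x) (j, y). (i, cmp (C i) n x y))\<rparr>"

lemma coprod_simps [simp]:
  "cells (coprod J C) = Sigma J (\<lambda>i. cells (C i))"
  "bd (coprod J C) \<alpha> n (i, x) = (i, bd (C i) \<alpha> n x)"
  "cmp (coprod J C) n (i, x) (j, y) = (i, cmp (C i) n x y)"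
  "composable (coprod J C) n (i, x) (j, y) \<longleftrightarrow> i \<in> J \<and> i = j \<and> composable (C i) n x y"
  by (auto simp: coprod_def composable_def)

theorem omega_category_coprod:
  assumes "\<And>i. i \<in> J \<Longrightarrow> omega_category (C i)"
  shows "omega_category (coprod J C)"
proof -
  have g: "globular_set (C i)" if "i \<in> J" for i
    using omega_categoryD(1)[OF assms[OF that]] .
  have "globular_set (coprod J C)"
    using g unfolding globular_set_def by (simp add: Ball_def)
  then show ?thesis
    unfolding omega_category_def
    by (simp add: Ball_def omega_categoryD(2,6-10)[OF assms] omega_categoryD(11,12)[OF assms])
qed

theorem coprod_universal:
  assumes h: "\<And>i. i \<in> J \<Longrightarrow> omega_functor (h i) (C i) D"
  shows "i \<in> J \<Longrightarrow> omega_functor (\<lambda>x. (i, x)) (C i) (coprod J C)"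
    and "omega_functor (\<lambda>(i, x). h i x) (coprod J C) D"
    and "(\<And>i x. i \<in> J \<Longrightarrow> x \<in> cells (C i) \<Longrightarrow> k (i, x) = h i x) \<Longrightarrow>
           c \<in> cells (coprod J C) \<Longrightarrow> k c = (\<lambda>(i, x). h i x) c"
proof -
  have h': "i \<in> J \<Longrightarrow> x \<in> cells (C i) \<Longrightarrow> h i x \<in> cells D"
    "i \<in> J \<Longrightarrow> x \<in> cells (C i) \<Longrightarrow> h i (bd (C i) \<alpha> n x) = bd D \<alpha> n (h i x)"
    "i \<in> J \<Longrightarrow> composable (C i) n x y \<Longrightarrow> h i (cmp (C i) n x y) = cmp D n (h i x) (h i y)"
    for i \<alpha> n x y
    using h[of i] by (simp_all add: omega_functor_def glob_map_def)
  show "i \<in> J \<Longrightarrow> omega_functor (\<lambda>x. (i, x)) (C i) (coprod J C)"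
    by (simp add: omega_functor_def glob_map_def)
  show "omega_functor (\<lambda>(i, x). h i x) (coprod J C) D"
    by (auto simp: omega_functor_def glob_map_def h')
  show "(\<And>i x. i \<in> J \<Longrightarrow> x \<in> cells (C i) \<Longrightarrow> k (i, x) = h i x) \<Longrightarrow>
      c \<in> cells (coprod J C) \<Longrightarrow> k c = (\<lambda>(i, x). h i x) c"
    by auto
qed


section \<open>The path and negative semi-path omega-categories\<close>

definition non_contracting :: "'a ocat \<Rightarrow> bool" where
  "non_contracting C \<longleftrightarrow>
     (\<forall>x\<in>cells C. odim C x \<ge> 1 \<longrightarrow> odim C (src C 1 x) = 1 \<and> odim C (tgt C 1 x) = 1)"

text \<open>The path omega-category is meant for non-contracting \<open>C\<close>; only then are its cells closed
  under the shifted source and target maps.\<close>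

definition path_ocat :: "'a ocat \<Rightarrow> 'a ocat" where
  "path_ocat C =
     \<lparr>cells = {x \<in> cells C. odim C x \<ge> 1},
      bd = (\<lambda>\<alpha> i. bd C \<alpha> (Suc i)),
      cmp = (\<lambda>i. cmp C (Suc i))\<rparr>"

text \<open>The pairs \<open>(x, x *\<^sub>0 y)\<close> are formed with the composition of \<open>C\<close>, which is not part of the
  structure of \<open>path_ocat C\<close>. As an \<open>x *\<^sub>0 y\<close> can have a larger dimension than \<open>x\<close>, the relation
  also identifies cells of different dimensions.\<close>

definition neg_gen :: "'a ocat \<Rightarrow> ('a \<times> 'a) set" where
  "neg_gen C = {(x, cmp C 0 x y) | x y. composable C 0 x y \<and> x \<in> cells (path_ocat C) \<and>
     y \<in> cells (path_ocat C) \<and> cmp C 0 x y \<in> cells (path_ocat C)}"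

definition neg_rel :: "'a ocat \<Rightarrow> ('a \<times> 'a) set" where
  "neg_rel C = (neg_gen C \<union> (neg_gen C)\<inverse>)\<^sup>* \<inter> cells (path_ocat C) \<times> cells (path_ocat C)"

definition neg_class :: "'a ocat \<Rightarrow> 'a \<Rightarrow> 'a set" where
  "neg_class C x = neg_rel C `` {x}"

definition neg_quot :: "'a ocat \<Rightarrow> 'a set globset" where
  "neg_quot C =
     \<lparr>cells = cells (path_ocat C) // neg_rel C,
      bd = (\<lambda>\<alpha> i c. neg_rel C `` (bd (path_ocat C) \<alpha> i ` c))\<rparr>"

definition neg_path_ocat :: "'a ocat \<Rightarrow> ('a set cterm set + 'a) cterm set ocat" where
  "neg_path_ocat C =
     pushout (free_ocat (forget (path_ocat C)))
       (free_map (neg_quot C) (neg_class C)) (free_ocat (neg_quot C))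
       (counit (path_ocat C)) (path_ocat C)"

lemma odim_bd_iff:
  assumes C: "omega_category C" and x: "x \<in> cells C"
  shows "odim C x \<le> n \<longleftrightarrow> src C n x = x \<and> tgt C n x = x"
proof
  obtain k where k: "src C k x = x \<and> tgt C k x = x" using omega_categoryD(5)[OF C x] by blast
  have d: "src C (odim C x) x = x \<and> tgt C (odim C x) x = x"
    unfolding odim_def by (rule LeastI[of "\<lambda>n. src C n x = x \<and> tgt C n x = x", OF k])
  assume n: "odim C x \<le> n"
  have "bd C \<beta> n (src C (odim C x) x) = src C (odim C x) x" for \<beta>
    using n by (simp add: omega_categoryD(4)[OF C x])
  then show "src C n x = x \<and> tgt C n x = x" using d by metis
next
  show "src C n x = x \<and> tgt C n x = x \<Longrightarrow> odim C x \<le> n"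
    unfolding odim_def by (rule Least_le)
qed

lemma path_cells_iff:
  assumes C: "omega_category C"
  shows "x \<in> cells (path_ocat C) \<longleftrightarrow> x \<in> cells C \<and> \<not> (src C 0 x = x \<and> tgt C 0 x = x)"
  using odim_bd_iff[OF C, of x 0] by (auto simp: path_ocat_def)

lemma path_simps:
  "bd (path_ocat C) \<alpha> i = bd C \<alpha> (Suc i)" "cmp (path_ocat C) i = cmp C (Suc i)"
  by (simp_all add: path_ocat_def)

lemma path_composableD: "composable (path_ocat C) i x y \<Longrightarrow> composable C (Suc i) x y"
  by (auto simp: composable_def path_ocat_def)

lemma path_bd_closed:
  assumes C: "omega_category C" and n: "non_contracting C" and x: "x \<in> cells (path_ocat C)"
  shows "bd C \<alpha> (Suc i) x \<in> cells (path_ocat C)"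
proof (rule ccontr)
  have xC: "x \<in> cells C" and "odim C x \<ge> 1" using x by (auto simp: path_ocat_def)
  then have 1: "odim C (src C 1 x) = 1" using n by (simp add: non_contracting_def)
  let ?y = "bd C \<alpha> (Suc i) x"
  have y: "?y \<in> cells C" using xC by (rule omega_categoryD(3)[OF C])
  assume "\<not> ?thesis"
  then have e: "src C 0 ?y = ?y" "tgt C 0 ?y = ?y" using y by (auto simp: path_cells_iff[OF C])
  show False
  proof (cases i)
    case 0
    have "odim C ?y = 1"
      using n xC \<open>odim C x \<ge> 1\<close> 0 by (cases \<alpha>) (simp_all add: non_contracting_def)
    then show False using odim_bd_iff[OF C y, of 0] e by simp
  next
    case (Suc j)
    have "src C 1 ?y = src C 1 (src C 0 ?y)" by (simp only: e)
    also have "\<dots> = src C 0 ?y" using omega_categoryD(4)[OF C y, of Minus 1 Minus 0] by simp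
    finally have "src C 1 ?y = ?y" by (simp only: e)
    moreover have "src C 1 ?y = src C 1 x"
      using omega_categoryD(4)[OF C xC, of Minus 1 \<alpha> "Suc i"] Suc by simp
    ultimately have "odim C ?y = 1" using 1 by simp
    then show False using odim_bd_iff[OF C y, of 0] e by simp
  qed
qed

lemma path_cmp_closed:
  assumes C: "omega_category C" and n: "non_contracting C" and xy: "composable (path_ocat C) i x y"
  shows "cmp C (Suc i) x y \<in> cells (path_ocat C)"
proof (rule ccontr)
  have c: "composable C (Suc i) x y" using xy by (rule path_composableD)
  have x: "x \<in> cells (path_ocat C)" using xy by (simp add: composable_def)
  let ?z = "cmp C (Suc i) x y"
  have z: "?z \<in> cells C" using c by (rule omega_categoryD(2)[OF C])
  assume not: "\<not> ?thesis"
  then have "odim C ?z \<le> Suc i" using z by (simp add: path_ocat_def)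
  then have "src C (Suc i) ?z = ?z" using odim_bd_iff[OF C z] by blast
  then have "src C (Suc i) x = ?z" by (simp add: omega_categoryD(8)[OF C c])
  then show False using path_bd_closed[OF C n x, of Minus i] not by simp
qed

theorem omega_category_path:
  assumes C: "omega_category C" and n: "non_contracting C"
  shows "omega_category (path_ocat C)"
proof -
  let ?P = "path_ocat C"
  have cC: "x \<in> cells C" if "x \<in> cells ?P" for x using that by (simp add: path_ocat_def)
  note c = path_composableD[of C]
  have "globular_set ?P"
    unfolding globular_set_def
  proof (intro conjI ballI allI)
    fix x \<alpha> \<beta> m k assume x: "x \<in> cells ?P"
    show "bd ?P \<alpha> k x \<in> cells ?P" using path_bd_closed[OF C n x] by (simp add: path_simps)
    show "bd ?P \<beta> m (bd ?P \<alpha> k x) = (if m < k then bd ?P \<beta> m x else bd ?P \<alpha> k x)"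
      using omega_categoryD(4)[OF C cC[OF x]] by (simp add: path_simps)
    obtain j where "src C j x = x \<and> tgt C j x = x" using omega_categoryD(5)[OF C cC[OF x]] by blast
    then have "odim C x \<le> Suc j" using odim_bd_iff[OF C cC[OF x], of j] by simp
    then show "\<exists>k. src ?P k x = x \<and> tgt ?P k x = x"
      using odim_bd_iff[OF C cC[OF x], of "Suc j"] by (auto simp: path_simps)
  qed
  then show ?thesis
    unfolding omega_category_def
  proof (intro conjI allI ballI impI)
    fix k x y assume xy: "composable ?P k x y"
    show "cmp ?P k x y \<in> cells ?P" using path_cmp_closed[OF C n xy] by (simp add: path_simps)
    show "src ?P k (cmp ?P k x y) = src ?P k x" "tgt ?P k (cmp ?P k x y) = tgt ?P k y"
      using omega_categoryD(8,9)[OF C c[OF xy]] by (simp_all add: path_simps)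
    fix \<alpha> m assume "m \<noteq> k"
    then show "bd ?P \<alpha> m (cmp ?P k x y) = cmp ?P k (bd ?P \<alpha> m x) (bd ?P \<alpha> m y)"
      using omega_categoryD(10)[OF C c[OF xy]] by (simp add: path_simps)
  next
    fix k x assume "x \<in> cells ?P"
    then show "cmp ?P k (src ?P k x) x = x" "cmp ?P k x (tgt ?P k x) = x"
      using omega_categoryD(6,7)[OF C cC] by (simp_all add: path_simps)
  next
    fix k x y z
    assume "composable ?P k x y" "composable ?P k (cmp ?P k x y) z"
      "composable ?P k y z" "composable ?P k x (cmp ?P k y z)"
    from this[THEN c] show "cmp ?P k (cmp ?P k x y) z = cmp ?P k x (cmp ?P k y z)"
      unfolding path_simps by (rule omega_categoryD(11)[OF C])
  next
    fix m k x y z w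
    assume "m \<noteq> (k::nat)"
    then have "Suc m \<noteq> Suc k" by simp
    note i = omega_categoryD(12)[OF C this]
    assume "composable ?P k x y" "composable ?P k z w"
      "composable ?P m (cmp ?P k x y) (cmp ?P k z w)"
      "composable ?P m x z" "composable ?P m y w"
      "composable ?P k (cmp ?P m x z) (cmp ?P m y w)"
    from this[THEN c]
    show "cmp ?P m (cmp ?P k x y) (cmp ?P k z w) = cmp ?P k (cmp ?P m x z) (cmp ?P m y w)"
      unfolding path_simps by (rule i)
  qed
qed

lemma equiv_neg_rel: "equiv (cells (path_ocat C)) (neg_rel C)"
proof (rule equivI)
  have s: "sym ((neg_gen C \<union> (neg_gen C)\<inverse>)\<^sup>*)" by (intro sym_rtrancl sym_Un_converse)
  show "neg_rel C \<subseteq> cells (path_ocat C) \<times> cells (path_ocat C)" by (auto simp: neg_rel_def)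
  show "refl_on (cells (path_ocat C)) (neg_rel C)" by (auto simp: refl_on_def neg_rel_def)
  show "sym (neg_rel C)" using s by (auto simp: neg_rel_def sym_def)
  show "trans (neg_rel C)" by (auto simp: neg_rel_def trans_def intro: rtrancl_trans)
qed

lemma neg_rel_bd:
  assumes C: "omega_category C" and n: "non_contracting C" and xy: "(x, y) \<in> neg_rel C"
  shows "(bd C \<alpha> (Suc i) x, bd C \<alpha> (Suc i) y) \<in> neg_rel C"
proof -
  have g: "(bd C \<alpha> (Suc i) x, bd C \<alpha> (Suc i) y) \<in> neg_gen C" if xy: "(x, y) \<in> neg_gen C" for x y
  proof -
    obtain z where z: "y = cmp C 0 x z" "composable C 0 x z" "x \<in> cells (path_ocat C)"
      "z \<in> cells (path_ocat C)" "cmp C 0 x z \<in> cells (path_ocat C)"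
      using xy unfolding neg_gen_def by blast
    have "bd C \<alpha> (Suc i) y = cmp C 0 (bd C \<alpha> (Suc i) x) (bd C \<alpha> (Suc i) z)"
      unfolding z(1) using z(2) by (rule omega_categoryD(10)[OF C]) simp
    moreover have "composable C 0 (bd C \<alpha> (Suc i) x) (bd C \<alpha> (Suc i) z)"
      using composable_bd[OF C z(2)] by simp
    moreover have "bd C \<alpha> (Suc i) y \<in> cells (path_ocat C)"
      using path_bd_closed[OF C n z(5)] z(1) by simp
    ultimately show ?thesis
      using path_bd_closed[OF C n z(3)] path_bd_closed[OF C n z(4)] unfolding neg_gen_def by auto
  qed
  have "(x, y) \<in> (neg_gen C \<union> (neg_gen C)\<inverse>)\<^sup>*" using xy by (simp add: neg_rel_def)
  then have "(bd C \<alpha> (Suc i) x, bd C \<alpha> (Suc i) y) \<in> (neg_gen C \<union> (neg_gen C)\<inverse>)\<^sup>*"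
  proof (induction rule: rtrancl_induct)
    case (step y z)
    then have "(bd C \<alpha> (Suc i) y, bd C \<alpha> (Suc i) z) \<in> neg_gen C \<union> (neg_gen C)\<inverse>" using g by blast
    with step.IH show ?case by (rule rtrancl_into_rtrancl)
  qed simp
  moreover have "x \<in> cells (path_ocat C)" "y \<in> cells (path_ocat C)" using xy by (auto simp: neg_rel_def)
  ultimately show ?thesis using path_bd_closed[OF C n] by (simp add: neg_rel_def)
qed

lemma bd_neg_class:
  assumes C: "omega_category C" and n: "non_contracting C" and x: "x \<in> cells (path_ocat C)"
  shows "bd (neg_quot C) \<alpha> i (neg_class C x) = neg_class C (bd (path_ocat C) \<alpha> i x)"
proof -
  note eq = equiv_neg_rel[of C]
  have xx: "(x, x) \<in> neg_rel C" using eq x by (meson equivE refl_onD)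
  have "neg_rel C `` {bd C \<alpha> (Suc i) y} = neg_rel C `` {bd C \<alpha> (Suc i) x}" if "(x, y) \<in> neg_rel C" for y
    using equiv_class_eq[OF eq neg_rel_bd[OF C n that]] by simp
  then have "neg_rel C `` (bd C \<alpha> (Suc i) ` (neg_rel C `` {x})) = neg_rel C `` {bd C \<alpha> (Suc i) x}"
    using xx by blast
  then show ?thesis by (simp add: neg_quot_def neg_class_def path_simps)
qed

theorem globular_set_neg_quot:
  assumes C: "omega_category C" and n: "non_contracting C"
  shows "globular_set (neg_quot C)"
    and "glob_map (neg_class C) (forget (path_ocat C)) (neg_quot C)"
proof -
  note P = omega_category_path[OF C n]
  have cl: "neg_class C x \<in> cells (neg_quot C)" if "x \<in> cells (path_ocat C)" for x
    using that by (simp add: neg_quot_def neg_class_def quotientI)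
  have ex: "\<exists>x\<in>cells (path_ocat C). c = neg_class C x" if "c \<in> cells (neg_quot C)" for c
    using that by (auto simp: neg_quot_def neg_class_def elim: quotientE)
  note b = bd_neg_class[OF C n]
  show "globular_set (neg_quot C)"
    unfolding globular_set_def
  proof (intro conjI ballI allI)
    fix c \<alpha> \<beta> m k assume "c \<in> cells (neg_quot C)"
    then obtain x where x: "x \<in> cells (path_ocat C)" "c = neg_class C x" using ex by blast
    show "bd (neg_quot C) \<alpha> k c \<in> cells (neg_quot C)"
      using x by (simp add: b cl omega_categoryD(3)[OF P])
    show "bd (neg_quot C) \<beta> m (bd (neg_quot C) \<alpha> k c) =
        (if m < k then bd (neg_quot C) \<beta> m c else bd (neg_quot C) \<alpha> k c)"
      using x by (simp add: b omega_categoryD(3,4)[OF P])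
    obtain j where "src (path_ocat C) j x = x" "tgt (path_ocat C) j x = x"
      using omega_categoryD(5)[OF P x(1)] by blast
    then show "\<exists>k. src (neg_quot C) k c = c \<and> tgt (neg_quot C) k c = c"
      using x b[OF x(1)] by metis
  qed
  show "glob_map (neg_class C) (forget (path_ocat C)) (neg_quot C)"
    by (simp add: glob_map_def cl b)
qed

theorem omega_category_neg_path:
  assumes "omega_category C" "non_contracting C"
  shows "omega_category (neg_path_ocat C)"
  unfolding neg_path_ocat_def
  using omega_category_path[OF assms] globular_set_neg_quot[OF assms]
  by (intro omega_category_pushout omega_category_free omega_functor_free_map omega_functor_counit
      globular_set_forget)


section \<open>Cubes and simplices\<close>

inductive_set generated :: "'a ocat \<Rightarrow> 'a set \<Rightarrow> 'a set" for C :: "'a ocat" and S :: "'a set" where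
  base: "x \<in> S \<Longrightarrow> x \<in> generated C S"
| comp: "x \<in> generated C S \<Longrightarrow> y \<in> generated C S \<Longrightarrow> composable C n x y \<Longrightarrow>
    cmp C n x y \<in> generated C S"

text \<open>\<open>face_ocat F sub fdim bdy C\<close> states the properties that characterise the omega-category of a
  complex with faces \<open>F\<close>, where \<open>sub x\<close> is the set \<open>R(x)\<close> of subfaces of \<open>x\<close>, and \<open>bdy Minus x\<close>
  and \<open>bdy Plus x\<close> are the sets \<open>s\<^sub>x\<close> and \<open>t\<^sub>x\<close>. They determine the cells of \<open>C\<close> as well as its
  operations on them.\<close>

definition face_ocat :: "'f set \<Rightarrow> ('f \<Rightarrow> 'f set) \<Rightarrow> ('f \<Rightarrow> nat) \<Rightarrow> (sign \<Rightarrow> 'f \<Rightarrow> 'f set) \<Rightarrow>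
    'f set ocat \<Rightarrow> bool" where
  "face_ocat F sub fdim bdy C \<longleftrightarrow>
     omega_category C \<and>
     cells C \<subseteq> {\<Union> (sub ` X) | X. X \<subseteq> F} \<and>
     cells C = generated C (sub ` F) \<and>
     (\<forall>x\<in>F. fdim x \<ge> 1 \<longrightarrow> (\<forall>\<alpha>. bd C \<alpha> (fdim x - 1) (sub x) = \<Union> (sub ` bdy \<alpha> x))) \<and>
     (\<forall>p. \<forall>X\<in>cells C. \<forall>Y\<in>cells C. tgt C p X = src C p Y \<longrightarrow>
        X \<union> Y \<in> cells C \<and> cmp C p X Y = X \<union> Y)"

datatype letter = Sgn sign | Zero

definition cube_faces :: "nat \<Rightarrow> letter list set" where
  "cube_faces n = {w. length w = n}"

definition cube_sub :: "letter list \<Rightarrow> letter list set" where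
  "cube_sub w = {v. list_all2 (\<lambda>a b. a = b \<or> b = Zero) v w}"

definition cube_dim :: "letter list \<Rightarrow> nat" where
  "cube_dim w = count_list w Zero"

definition sign_power :: "nat \<Rightarrow> sign" where
  "sign_power i = (if odd i then Minus else Plus)"

text \<open>A zero at index \<open>j\<close> is the \<open>i\<close>-th zero of \<open>w\<close> for \<open>i = count_list (take (Suc j) w) Zero\<close>.\<close>

definition cube_bdy :: "sign \<Rightarrow> letter list \<Rightarrow> letter list set" where
  "cube_bdy \<alpha> w =
     {w[j := Sgn (let i = count_list (take (Suc j) w) Zero in
                  case \<alpha> of Minus \<Rightarrow> sign_power i | Plus \<Rightarrow> sign_power (i + 1))] |
      j. j < length w \<and> w ! j = Zero}"

definition is_cube :: "nat \<Rightarrow> letter list set ocat \<Rightarrow> bool" where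
  "is_cube n C \<longleftrightarrow> face_ocat (cube_faces n) cube_sub cube_dim cube_bdy C"

definition simplex_faces :: "nat \<Rightarrow> nat list set" where
  "simplex_faces n = {w. w \<noteq> [] \<and> sorted_wrt (<) w \<and> set w \<subseteq> {0..n}}"

definition simplex_sub :: "nat list \<Rightarrow> nat list set" where
  "simplex_sub w = {v. v \<noteq> [] \<and> subseq v w}"

definition simplex_dim :: "nat list \<Rightarrow> nat" where
  "simplex_dim w = length w - 1"

definition simplex_bdy :: "sign \<Rightarrow> nat list \<Rightarrow> nat list set" where
  "simplex_bdy \<alpha> w =
     {take (i - 1) w @ drop i w | i. i \<in> {1..length w} \<and> (case \<alpha> of Minus \<Rightarrow> odd i | Plus \<Rightarrow> even i)}"

definition is_simplex :: "nat \<Rightarrow> nat list set ocat \<Rightarrow> bool" where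
  "is_simplex n C \<longleftrightarrow> face_ocat (simplex_faces n) simplex_sub simplex_dim simplex_bdy C"

end

theory Submission
  imports Defs
begin

text \<open>
  A path in the cube that starts at a vertex \<open>v\<close> leaves \<open>v\<close> along some of the coordinates in which
  \<open>v\<close> is negative. Therefore the faces of dimension at least one whose initial vertex is \<open>v\<close>
  correspond to the nonempty sets of negative coordinates of \<open>v\<close>: they are the faces of a simplex,
  with all dimensions lowered by one, and the sign rule of the cube becomes the rule of alternating
  deletions of the simplex (\<open>germ_bdy\<close>). The germ of a cell \<open>X\<close> at its initial vertex \<open>v\<close> is the set
  of simplex faces that are cut out by the faces of \<open>X\<close> with initial vertex \<open>v\<close>. Taking germs is a
  functor on the path omega-category (\<open>germ_functor\<close>), and the germ of \<open>X *\<^sub>0 Y\<close> is that of \<open>X\<close>,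
  because the vertices of \<open>Y\<close> lie strictly above \<open>v\<close> (\<open>germ_cmp_0\<close>). Hence the universal property of
  the negative semi-path omega-category (\<open>neg_path_universal\<close>) gives a functor from it to the
  disjoint union of simplices, one for each vertex that is not entirely positive. There are
  \<open>(n + 1) choose p\<close> vertices with \<open>p\<close> negative coordinates, and each contributes a simplex of
  dimension \<open>p - 1\<close>.

  This functor is bijective. As \<open>X *\<^sub>0 Y\<close> and \<open>X\<close> are identified, every cell is a composite of classes
  of faces of the cube (\<open>proj_generated\<close>, \<open>D_generated\<close>). What remains to be seen is that such a
  composite is determined by the set of faces that occur in it (\<open>supp_inj\<close>); then composable germs
  come from composable cells, and so the image contains all composites of simplex faces.

  The theorem \<open>supp_inj\<close> says that an omega-category generated by atoms has no two cells with the
  same support, provided that its atoms carry a total order in which the faces in the source of an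
  atom \<open>e\<close>, of any dimension, precede \<open>e\<close>, and those in its target come after \<open>e\<close>. It is proved by a
  normal form. At level \<open>q\<close> a cell is cut along \<open>*\<^sub>q\<close> into pieces with a single maximal face of
  dimension greater than \<open>q\<close>, namely an atom with cells of dimension at most \<open>q\<close> attached to it, and
  the pieces are sorted. Two adjacent pieces in the wrong order can be exchanged (\<open>piece_swap_Suc\<close>):
  let the piece of \<open>b\<close> be followed by that of \<open>c\<close>, where \<open>c\<close> precedes \<open>b\<close>. The \<open>q\<close>-cell between
  them contains the \<open>q\<close>-target of \<open>b\<close>, whose \<open>q\<close>-faces come after \<open>b\<close>, and the \<open>q\<close>-source of \<open>c\<close>, whose
  \<open>q\<close>-faces precede \<open>c\<close>. In the sorted form of this \<open>q\<close>-cell one level below, a cut at \<open>c\<close> separates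
  the two, and the interchange law does the rest. Once it is sorted, a pasting can be read off from
  its support, one piece after the other.

  For simplices such an order is that of the reflected Gray code. That the sources and targets in
  dimensions below the first are on the correct side is seen by a monotone retraction of a simplex
  onto a face \<open>h\<close>, which is a functor: it moves the source of the simplex to that of \<open>h\<close>, and so it
  suffices to look at faces of codimension one (\<open>simplex_bd_gray\<close>).
\<close>

section \<open>Calculus in an omega-category\<close>

locale ocat =
  fixes D :: "'d ocat"
  assumes D: "omega_category D"
begin

text \<open>Equivalently, the dimension of \<open>x\<close> is at most \<open>n\<close>.\<close>

definition flat :: "nat \<Rightarrow> 'd \<Rightarrow> bool" where
  "flat n x \<longleftrightarrow> x \<in> cells D \<and> (\<forall>\<alpha>. bd D \<alpha> n x = x)"

lemma flat_cell: "flat n x \<Longrightarrow> x \<in> cells D" and flat_eq: "flat n x \<Longrightarrow> bd D \<alpha> n x = x"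
  by (simp_all add: flat_def)

lemmas cmp_cell = omega_categoryD(2)[OF D]
lemmas bd_cell = omega_categoryD(3)[OF D]
lemmas bd_bd = omega_categoryD(4)[OF D]
lemmas src_unit = omega_categoryD(6)[OF D]
lemmas tgt_unit = omega_categoryD(7)[OF D]
lemmas src_cmp = omega_categoryD(8)[OF D]
lemmas tgt_cmp = omega_categoryD(9)[OF D]
lemmas bd_cmp = omega_categoryD(10)[OF D]

lemma composable_cells: "composable D n x y \<Longrightarrow> x \<in> cells D \<and> y \<in> cells D"
  by (simp add: composable_def)

lemma composable_eq: "composable D n x y \<Longrightarrow> tgt D n x = src D n y"
  by (simp add: composable_def)

lemma bd_eq_below:
  assumes "composable D m x y" "k < m"
  shows "bd D \<alpha> k x = bd D \<alpha> k y"
proof -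
  have "bd D \<alpha> k x = bd D \<alpha> k (tgt D m x)" "bd D \<alpha> k y = bd D \<alpha> k (src D m y)"
    using assms(2) composable_cells[OF assms(1)] by (simp_all add: bd_bd)
  then show ?thesis using composable_eq[OF assms(1)] by simp
qed

lemma bd_cmp_below:
  assumes "composable D m x y" "k < m"
  shows "bd D \<alpha> k (cmp D m x y) = bd D \<alpha> k x"
proof -
  have "bd D \<alpha> k (cmp D m x y) = bd D \<alpha> k (src D m (cmp D m x y))"
    using assms by (simp add: bd_bd cmp_cell)
  also have "\<dots> = bd D \<alpha> k x"
    using assms by (simp add: src_cmp bd_bd composable_cells)
  finally show ?thesis .
qed

lemma flat_mono: "flat n x \<Longrightarrow> n \<le> k \<Longrightarrow> flat k x"
  unfolding flat_def by (metis bd_bd not_le)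

lemma flat_bd: "x \<in> cells D \<Longrightarrow> n \<le> k \<Longrightarrow> flat k (bd D \<alpha> n x)"
  by (simp add: flat_def bd_bd bd_cell)

lemma cmp_flat_left: "composable D n x y \<Longrightarrow> flat n x \<Longrightarrow> cmp D n x y = y"
  using src_unit by (metis composable_def flat_def)

lemma cmp_flat_right: "composable D n x y \<Longrightarrow> flat n y \<Longrightarrow> cmp D n x y = x"
  using tgt_unit by (metis composable_def flat_def)

lemma flat_cmp:
  assumes "composable D m x y" "flat n x" "flat n y"
  shows "flat n (cmp D m x y)"
proof (cases "m < n")
  case True
  then show ?thesis using assms by (simp add: flat_def bd_cmp cmp_cell)
next
  case False
  then have "flat m x" using flat_mono[OF assms(2), of m] by simp
  then show ?thesis using cmp_flat_left assms by simp
qed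

lemma assoc:
  assumes "composable D n x y" "composable D n y z"
  shows "composable D n (cmp D n x y) z" "composable D n x (cmp D n y z)"
    "cmp D n (cmp D n x y) z = cmp D n x (cmp D n y z)"
proof -
  show 1: "composable D n (cmp D n x y) z"
    using assms by (simp add: composable_def[of D n "cmp D n x y"] cmp_cell tgt_cmp composable_cells composable_eq)
  show 2: "composable D n x (cmp D n y z)"
    using assms by (simp add: composable_def[of D n x "cmp D n y z"] cmp_cell src_cmp composable_cells composable_eq)
  show "cmp D n (cmp D n x y) z = cmp D n x (cmp D n y z)"
    by (rule omega_categoryD(11)[OF D assms(1) 1 assms(2) 2])
qed

lemma composable_cmpD:
  assumes "composable D n x y"
  shows "composable D n (cmp D n x y) z \<longleftrightarrow> composable D n y z"
    and "composable D n z (cmp D n x y) \<longleftrightarrow> composable D n z x"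
  using assms cmp_cell[OF assms] tgt_cmp[OF assms] src_cmp[OF assms]
  by (auto simp: composable_def)

text \<open>The two factors of a \<open>*\<^sub>q\<close>-composite have the same boundary in each dimension \<open>m < q\<close>, so that
  composability along \<open>m\<close> passes from the first factors to the second ones and to the composites.\<close>

lemma interchange_less:
  assumes "m < q" "composable D q a b" "composable D q c d" "composable D m a c"
  shows "composable D m (cmp D q a b) (cmp D q c d)" "composable D m b d"
    "composable D q (cmp D m a c) (cmp D m b d)"
    "cmp D m (cmp D q a b) (cmp D q c d) = cmp D q (cmp D m a c) (cmp D m b d)"
proof -
  have e: "tgt D m a = src D m c" using assms(4) by (rule composable_eq)
  have b: "tgt D m a = tgt D m b" and d: "src D m c = src D m d"
    using bd_eq_below[OF assms(2,1)] bd_eq_below[OF assms(3,1)] by simp_all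
  show 2: "composable D m b d" using assms e b d by (simp add: composable_def)
  show 1: "composable D m (cmp D q a b) (cmp D q c d)"
    using assms e by (simp add: composable_def[of D m "cmp D q a b"] cmp_cell bd_cmp_below)
  show 3: "composable D q (cmp D m a c) (cmp D m b d)"
    using assms 2
    by (simp add: composable_def[of D q "cmp D m a c"] cmp_cell bd_cmp composable_eq[OF assms(2)]
        composable_eq[OF assms(3)])
  show "cmp D m (cmp D q a b) (cmp D q c d) = cmp D q (cmp D m a c) (cmp D m b d)"
    using assms(1) by (intro omega_categoryD(12)[OF D] assms 1 2 3) simp
qed

text \<open>Two cells that meet in dimension \<open>m\<close> can be passed one after the other in any dimension
  \<open>q > m\<close>: first \<open>a\<close> next to the source of \<open>b\<close>, then \<open>b\<close> next to the target of \<open>a\<close>. Comparison with the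
  opposite order, in \<open>slide'\<close>, is the only way in which the interchange law is used to reorder cells.\<close>

lemma slide:
  assumes "composable D m a b" "m < q"
  shows "composable D m a (src D q b)" "composable D m (tgt D q a) b"
    "composable D q (cmp D m a (src D q b)) (cmp D m (tgt D q a) b)"
    "cmp D m a b = cmp D q (cmp D m a (src D q b)) (cmp D m (tgt D q a) b)"
proof -
  have c: "a \<in> cells D" "b \<in> cells D" using assms(1) by (simp_all add: composable_def)
  have 1: "composable D q a (tgt D q a)" "composable D q (src D q b) b"
    using c by (simp_all add: composable_def bd_cell bd_bd)
  show 2: "composable D m a (src D q b)"
    using assms c by (simp add: composable_def bd_cell bd_bd)
  show "composable D m (tgt D q a) b"
    "composable D q (cmp D m a (src D q b)) (cmp D m (tgt D q a) b)"
    "cmp D m a b = cmp D q (cmp D m a (src D q b)) (cmp D m (tgt D q a) b)"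
    using interchange_less[OF assms(2) 1 2] c by (simp_all add: tgt_unit src_unit)
qed

lemma slide':
  assumes "composable D m a b" "m < q"
  shows "composable D m (src D q a) b" "composable D m a (tgt D q b)"
    "composable D q (cmp D m (src D q a) b) (cmp D m a (tgt D q b))"
    "cmp D m a b = cmp D q (cmp D m (src D q a) b) (cmp D m a (tgt D q b))"
proof -
  have c: "a \<in> cells D" "b \<in> cells D" using assms(1) by (simp_all add: composable_def)
  have 1: "composable D q (src D q a) a" "composable D q b (tgt D q b)"
    using c by (simp_all add: composable_def bd_cell bd_bd)
  show 2: "composable D m (src D q a) b"
    using assms c by (simp add: composable_def bd_cell bd_bd)
  show "composable D m a (tgt D q b)"
    "composable D q (cmp D m (src D q a) b) (cmp D m a (tgt D q b))"
    "cmp D m a b = cmp D q (cmp D m (src D q a) b) (cmp D m a (tgt D q b))"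
    using interchange_less[OF assms(2) 1 2] c by (simp_all add: tgt_unit src_unit)
qed

lemma whisker_right:
  assumes "composable D q x y" "composable D m (cmp D q x y) u" "flat q u" "m < q"
  shows "composable D m x u" "composable D m y u" "composable D q (cmp D m x u) (cmp D m y u)"
    "cmp D m (cmp D q x y) u = cmp D q (cmp D m x u) (cmp D m y u)"
proof -
  have u: "composable D q u u" "cmp D q u u = u"
    using assms(3) src_unit[of u q] by (simp_all add: composable_def flat_def)
  show 1: "composable D m x u"
    using assms bd_cmp_below[OF assms(1,4)] by (simp add: composable_def)
  show "composable D m y u" "composable D q (cmp D m x u) (cmp D m y u)"
    "cmp D m (cmp D q x y) u = cmp D q (cmp D m x u) (cmp D m y u)"
    using interchange_less[OF assms(4,1) u(1) 1] u(2) by simp_all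
qed

lemma whisker_left:
  assumes "composable D q x y" "composable D m u (cmp D q x y)" "flat q u" "m < q"
  shows "composable D m u x" "composable D m u y" "composable D q (cmp D m u x) (cmp D m u y)"
    "cmp D m u (cmp D q x y) = cmp D q (cmp D m u x) (cmp D m u y)"
proof -
  have u: "composable D q u u" "cmp D q u u = u"
    using assms(3) src_unit[of u q] by (simp_all add: composable_def flat_def)
  show 1: "composable D m u x"
    using assms bd_cmp_below[OF assms(1,4)] by (simp add: composable_def)
  show "composable D m u y" "composable D q (cmp D m u x) (cmp D m u y)"
    "cmp D m u (cmp D q x y) = cmp D q (cmp D m u x) (cmp D m u y)"
    using interchange_less[OF assms(4) u(1) assms(1) 1] u(2) by simp_all
qed

end

section \<open>Cells as pastings of ordered pieces\<close>

text \<open>\<open>pasting D P q es c\<close>: the cell \<open>c\<close> is the \<open>*\<^sub>q\<close>-composite of a sequence of pieces, where \<open>P e p\<close>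
  says that \<open>p\<close> is a piece for the face \<open>e\<close>. The empty pasting is not unique: it stands for all cells
  of dimension at most \<open>q\<close>, which are the identities of \<open>*\<^sub>q\<close>.\<close>

inductive pasting :: "'d ocat \<Rightarrow> ('f \<Rightarrow> 'd \<Rightarrow> bool) \<Rightarrow> nat \<Rightarrow> 'f list \<Rightarrow> 'd \<Rightarrow> bool"
  for D P q where
  Nil: "c \<in> cells D \<Longrightarrow> \<forall>\<alpha>. bd D \<alpha> q c = c \<Longrightarrow> pasting D P q [] c"
| Cons: "P e p \<Longrightarrow> pasting D P q es c \<Longrightarrow> composable D q p c \<Longrightarrow> pasting D P q (e # es) (cmp D q p c)"

inductive_cases pasting_NilE: "pasting D P q [] c"
inductive_cases pasting_ConsE: "pasting D P q (e # es) c"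

text \<open>Here \<open>g\<close> sends the faces to the atoms that generate \<open>D\<close>, and \<open>supp c\<close> is the set of all faces of a
  cell. The last three assumptions are about the faces of top dimension \<open>k\<close> in the \<open>k\<close>-source and in
  the \<open>k\<close>-target of an atom; as they are not restricted to codimension one, they also exclude faces
  that lie in both.\<close>

locale rigid = ocat D for D :: "'d ocat" +
  fixes F :: "'f set" and deg :: "'f \<Rightarrow> nat" and rank :: "'f \<Rightarrow> real"
    and g :: "'f \<Rightarrow> 'd" and supp :: "'d \<Rightarrow> 'f set"
  assumes inj_rank: "inj_on rank F"
    and atom_cell: "y \<in> F \<Longrightarrow> g y \<in> cells D"
    and atom_bd: "y \<in> F \<Longrightarrow> bd D \<alpha> (deg y) (g y) = g y"
    and gen: "c \<in> cells D \<Longrightarrow> c \<in> generated D (g ` F)"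
    and supp_cmp: "composable D m a b \<Longrightarrow> supp (cmp D m a b) = supp a \<union> supp b"
    and supp_atom: "y \<in> F \<Longrightarrow> y \<in> supp (g y)"
    and supp_atom_deg: "y \<in> F \<Longrightarrow> f \<in> supp (g y) \<Longrightarrow> f \<noteq> y \<Longrightarrow> deg f < deg y"
    and supp_bd_cong: "a \<in> cells D \<Longrightarrow> b \<in> cells D \<Longrightarrow> supp a = supp b \<Longrightarrow>
      supp (bd D \<alpha> k a) = supp (bd D \<alpha> k b)"
    and supp_bd_deg: "c \<in> cells D \<Longrightarrow> f \<in> supp (bd D \<alpha> k c) \<Longrightarrow> deg f \<le> k"
    and rank_src: "y \<in> F \<Longrightarrow> k < deg y \<Longrightarrow> f \<in> supp (src D k (g y)) \<Longrightarrow> deg f = k \<Longrightarrow> rank f < rank y"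
    and rank_tgt: "y \<in> F \<Longrightarrow> k < deg y \<Longrightarrow> f \<in> supp (tgt D k (g y)) \<Longrightarrow> deg f = k \<Longrightarrow> rank y < rank f"
    and supp_bd_ex: "y \<in> F \<Longrightarrow> k < deg y \<Longrightarrow> \<exists>f\<in>supp (bd D \<alpha> k (g y)). deg f = k"
begin

abbreviation top :: "nat \<Rightarrow> 'd \<Rightarrow> 'f set" where
  "top k c \<equiv> {f \<in> supp c. deg f = k}"

lemma atom_flat: "y \<in> F \<Longrightarrow> flat (deg y) (g y)"
  by (simp add: flat_def atom_cell atom_bd)

lemma flat_iff:
  assumes "c \<in> cells D"
  shows "flat k c \<longleftrightarrow> (\<forall>f\<in>supp c. deg f \<le> k)"
proof
  assume "flat k c"
  then show "\<forall>f\<in>supp c. deg f \<le> k" using supp_bd_deg[OF assms] flat_eq by metis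
next
  have "c \<in> generated D (g ` F)" using gen assms .
  moreover assume "\<forall>f\<in>supp c. deg f \<le> k"
  ultimately show "flat k c"
  proof (induction rule: generated.induct)
    case (base x)
    then obtain y where "y \<in> F" "x = g y" by blast
    then have "deg y \<le> k" using base.prems supp_atom by simp
    then show ?case using \<open>y \<in> F\<close> \<open>x = g y\<close> flat_mono[OF atom_flat] by simp
  next
    case (comp x y n)
    then show ?case using flat_cmp[OF comp.hyps(3)] by (simp add: supp_cmp)
  qed
qed

lemma flat_top:
  assumes "flat 0 c"
  shows "\<exists>v\<in>F. deg v = 0 \<and> c = g v"
proof -
  have "c \<in> generated D (g ` F)" using gen flat_cell[OF assms] by blast
  moreover have "\<forall>f\<in>supp c. deg f \<le> 0" using flat_iff[OF flat_cell[OF assms]] assms by blast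
  ultimately show ?thesis
  proof (induction rule: generated.induct)
    case (base x)
    then show ?case using supp_atom by blast
  next
    case (comp x y n)
    have "flat 0 x" using comp flat_iff[of x 0] composable_cells[OF comp.hyps(3)]
      by (simp add: supp_cmp)
    then have "cmp D n x y = y" using cmp_flat_left[OF comp.hyps(3)] flat_mono[of 0 x n] by blast
    then show ?case using comp by (simp add: supp_cmp)
  qed
qed

text \<open>A piece of level \<open>q\<close> for \<open>e\<close> is a cell whose only maximal face of dimension greater than \<open>q\<close> is \<open>e\<close>,
  given in normal form: as a strictly sorted pasting, one level below, of a piece for \<open>e\<close> with pieces
  for faces of dimension \<open>q\<close>. At level 0 nothing can be attached, since a 0-composite with another
  cell of positive dimension would have a second maximal face of positive dimension.\<close>

primrec piece :: "nat \<Rightarrow> 'f \<Rightarrow> 'd \<Rightarrow> bool" where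
  "piece 0 = (\<lambda>e p. e \<in> F \<and> 0 < deg e \<and> p = g e)"
| "piece (Suc q) = (\<lambda>e p. e \<in> F \<and> Suc q < deg e \<and>
     (\<exists>es1 es2. pasting D (piece q) q (es1 @ e # es2) p \<and> sorted_wrt (<) (map rank (es1 @ e # es2)) \<and>
        (\<forall>f\<in>set (es1 @ es2). deg f = Suc q)))"

abbreviation pasted :: "nat \<Rightarrow> 'f list \<Rightarrow> 'd \<Rightarrow> bool" where
  "pasted q \<equiv> pasting D (piece q) q"

lemma piece_F: "piece q e p \<Longrightarrow> e \<in> F \<and> q < deg e"
  by (cases q) auto

lemma pasted_cell: "pasted q es c \<Longrightarrow> c \<in> cells D"
  by (induction rule: pasting.induct) (auto simp: cmp_cell)

lemma piece_cell: "piece q e p \<Longrightarrow> p \<in> cells D"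
  by (cases q) (auto simp: atom_cell pasted_cell)

lemma pasted_F: "pasted q es c \<Longrightarrow> set es \<subseteq> F \<and> (\<forall>e\<in>set es. q < deg e)"
  by (induction rule: pasting.induct) (auto dest: piece_F)

lemma pasted_Nil: "pasted q [] c \<longleftrightarrow> flat q c"
  by (auto simp: flat_def elim: pasting_NilE intro: pasting.Nil)

lemma pasted_single: "pasted q [e] p \<longleftrightarrow> piece q e p"
proof
  assume "pasted q [e] p"
  then obtain p' c where "p = cmp D q p' c" "piece q e p'" "pasted q [] c" "composable D q p' c"
    by (auto elim: pasting_ConsE)
  then show "piece q e p" using cmp_flat_right pasted_Nil by metis
next
  assume p: "piece q e p"
  have c: "composable D q p (tgt D q p)"
    using piece_cell[OF p] by (simp add: composable_def bd_cell bd_bd)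
  have "pasted q [] (tgt D q p)" using flat_bd[OF piece_cell[OF p]] by (simp add: pasted_Nil)
  from pasting.Cons[of "piece q", OF p this c] show "pasted q [e] p" using tgt_unit[OF piece_cell[OF p]] by simp
qed

lemma pasted_append:
  assumes "pasted q as a" "pasted q bs b" "composable D q a b"
  shows "pasted q (as @ bs) (cmp D q a b)"
  using assms(1,3)
proof (induction rule: pasting.induct)
  case (Nil c)
  then show ?case using assms(2) cmp_flat_left[OF Nil.prems] by (simp add: flat_def)
next
  case (Cons e p es c)
  have c: "composable D q c b" using Cons.prems Cons.hyps(3) by (simp add: composable_cmpD)
  have "pasted q (e # (es @ bs)) (cmp D q p (cmp D q c b))"
    by (rule pasting.Cons[of "piece q", OF Cons.hyps(1) Cons.IH[OF c] assoc(2)[OF Cons.hyps(3) c]])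
  then show ?case using assoc(3)[OF Cons.hyps(3) c] by simp
qed

lemma pasted_split:
  assumes "pasted q (as @ bs) c"
  obtains a b where "pasted q as a" "pasted q bs b" "composable D q a b" "c = cmp D q a b"
  using assms
proof (induction as arbitrary: c thesis)
  case Nil
  have c: "c \<in> cells D" using Nil.prems(2) by (rule pasted_cell)
  have "pasted q [] (src D q c)" using flat_bd[OF c] by (simp add: pasted_Nil)
  moreover have "composable D q (src D q c) c" using c by (simp add: composable_def bd_cell bd_bd)
  ultimately show ?case using Nil.prems src_unit[OF c, of q] by simp
next
  case (Cons e as)
  obtain p d where 1: "c = cmp D q p d" "piece q e p" "pasted q (as @ bs) d" "composable D q p d"
    using Cons.prems(2) by (auto elim: pasting_ConsE)
  obtain a b where 2: "pasted q as a" "pasted q bs b" "composable D q a b" "d = cmp D q a b"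
    using Cons.IH[OF _ 1(3)] by blast
  have 3: "composable D q p a" using 1(4) 2(3,4) by (simp add: composable_cmpD)
  show ?case
  proof (rule Cons.prems(1))
    show "pasted q (e # as) (cmp D q p a)" using 1(2) 2(1) 3 by (rule pasting.Cons)
    show "pasted q bs b" by fact
    show "composable D q (cmp D q p a) b" by (rule assoc(1)[OF 3 2(3)])
    show "c = cmp D q (cmp D q p a) b" unfolding 1(1) 2(4) by (rule assoc(3)[OF 3 2(3), symmetric])
  qed
qed

lemma pasted_split3:
  assumes "pasted q (as @ e # bs) c"
  obtains a p b where "pasted q as a" "piece q e p" "pasted q bs b" "composable D q a (cmp D q p b)"
    "composable D q p b" "c = cmp D q a (cmp D q p b)"
proof -
  obtain a d where 1: "pasted q as a" "pasted q ([e] @ bs) d" "composable D q a d" "c = cmp D q a d"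
    using pasted_split assms by (metis append_Cons append_Nil)
  obtain p b where 2: "pasted q [e] p" "pasted q bs b" "composable D q p b" "d = cmp D q p b"
    using pasted_split[OF 1(2)] by blast
  show ?thesis using that[OF 1(1) _ 2(2)] 1 2 by (simp add: pasted_single)
qed

lemma pasted_join3:
  assumes "pasted q as a" "pasted q ps p" "pasted q bs b" "composable D q p b" "composable D q a (cmp D q p b)"
  shows "pasted q (as @ ps @ bs) (cmp D q a (cmp D q p b))"
  by (intro pasted_append assms)

lemma piece_flat: "piece q e p \<Longrightarrow> flat (deg e) p"
proof (induction q arbitrary: e p)
  case 0
  then show ?case by (simp add: atom_flat)
next
  case (Suc q)
  then obtain es1 es2 where e: "Suc q < deg e" and es: "pasted q (es1 @ e # es2) p"
    "\<forall>f\<in>set (es1 @ es2). deg f = Suc q" by auto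
  have "\<forall>f\<in>set (es1 @ e # es2). deg f \<le> deg e" using e es(2) by auto
  with es(1) show ?case
  proof (induction rule: pasting.induct)
    case (Nil c)
    then show ?case using flat_mono[of q c "deg e"] e by (simp add: flat_def)
  next
    case (Cons e' p es c)
    have "flat (deg e) p" using Suc.IH[OF Cons.hyps(1)] flat_mono[of "deg e'" p "deg e"] Cons.prems by simp
    then show ?case using flat_cmp[OF Cons.hyps(3)] Cons by simp
  qed
qed

lemma pasted_flat: "pasted q es c \<Longrightarrow> \<forall>e\<in>set es. deg e \<le> k \<Longrightarrow> q \<le> k \<Longrightarrow> flat k c"
proof (induction rule: pasting.induct)
  case (Nil c)
  then show ?case using flat_mono[of q c k] by (simp add: flat_def)
next
  case (Cons e p es c)
  then show ?case
    using flat_cmp[OF Cons.hyps(3), of k] flat_mono[OF piece_flat[OF Cons.hyps(1)], of k] by simp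
qed

lemma flat_low: "flat k c \<Longrightarrow> f \<in> supp c \<Longrightarrow> deg f \<le> k"
  using flat_iff flat_cell by blast

text \<open>Cells of dimension at most \<open>k\<close> that are attached to \<open>p\<close> are not changed by the boundary maps of
  dimension \<open>k\<close>, so that these act on \<open>p\<close> alone.\<close>

lemma bd_whisker:
  assumes a: "flat k a" and b: "flat k b" and "q < k" and ab: "composable D q p b" "composable D q a (cmp D q p b)"
  shows "bd D \<alpha> k (cmp D q a (cmp D q p b)) = cmp D q a (cmp D q (bd D \<alpha> k p) b)"
    "composable D q (bd D \<alpha> k p) b" "composable D q a (cmp D q (bd D \<alpha> k p) b)"
proof -
  have p: "p \<in> cells D" using ab(1) by (simp add: composable_def)
  have "tgt D q (bd D \<alpha> k p) = tgt D q p" "src D q (bd D \<alpha> k p) = src D q p"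
    using \<open>q < k\<close> p by (simp_all add: bd_bd)
  then have 1: "composable D q (bd D \<alpha> k p) b" "composable D q a (bd D \<alpha> k p)"
    using ab(1) ab(2)[unfolded composable_cmpD(2)[OF ab(1)]] p by (auto simp: composable_def bd_cell)
  then show "composable D q (bd D \<alpha> k p) b" "composable D q a (cmp D q (bd D \<alpha> k p) b)"
    by (simp_all add: composable_cmpD)
  show "bd D \<alpha> k (cmp D q a (cmp D q p b)) = cmp D q a (cmp D q (bd D \<alpha> k p) b)"
    using ab \<open>q < k\<close> a b by (simp add: bd_cmp flat_eq)
qed

text \<open>The attached cells have too small a dimension to contribute, at any level; so the faces of high
  dimension in the boundary of a piece are those of the boundary of its atom.\<close>

lemma piece_top:
  "piece q e p \<Longrightarrow> q < k \<Longrightarrow> {f \<in> supp (bd D \<alpha> k p). q < deg f} = {f \<in> supp (bd D \<alpha> k (g e)). q < deg f}"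
proof (induction q arbitrary: e p)
  case 0
  then show ?case by simp
next
  case (Suc q)
  then obtain es1 es2 where es: "pasted q (es1 @ e # es2) p" "\<forall>f\<in>set (es1 @ es2). deg f = Suc q" by auto
  obtain a p' b where p: "pasted q es1 a" "piece q e p'" "pasted q es2 b" "composable D q a (cmp D q p' b)"
    "composable D q p' b" "p = cmp D q a (cmp D q p' b)" using pasted_split3[OF es(1)] .
  have f: "flat (Suc q) a" "flat (Suc q) b" using pasted_flat[OF p(1)] pasted_flat[OF p(3)] es(2) by auto
  have fk: "flat k a" "flat k b"
    using flat_mono[OF f(1), of k] flat_mono[OF f(2), of k] Suc.prems(2) by simp_all
  have qk: "q < k" using Suc.prems by simp
  note w = bd_whisker[OF fk qk p(5,4), of \<alpha>]
  have s: "supp (bd D \<alpha> k p) = supp a \<union> supp (bd D \<alpha> k p') \<union> supp b"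
    unfolding p(6) w(1) using w(2,3) by (auto simp: supp_cmp)
  have "deg f \<le> Suc q" if "f \<in> supp a \<union> supp b" for f using that flat_low f by blast
  then have 1: "f \<notin> supp a \<union> supp b" if "Suc q < deg f" for f using that by (meson not_le)
  have 2: "f \<in> supp (bd D \<alpha> k p') \<longleftrightarrow> f \<in> supp (bd D \<alpha> k (g e))" if "Suc q < deg f" for f
    using eqset_imp_iff[OF Suc.IH[OF p(2) qk], of f] that by simp
  show ?case unfolding s using 1 2 by blast
qed

lemma piece_supp:
  assumes "piece q e p"
  shows "{f \<in> supp p. q < deg f} = {f \<in> supp (g e). q < deg f}"
proof -
  have "q < deg e" "e \<in> F" using piece_F assms by blast+
  then show ?thesis using piece_top[OF assms, of "deg e" Plus] flat_eq[OF piece_flat[OF assms]] atom_bd by simp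
qed

lemma pasted_top: "pasted q es c \<Longrightarrow> \<forall>e\<in>set es. deg e = Suc q \<Longrightarrow> top (Suc q) c = set es"
proof (induction rule: pasting.induct)
  case (Nil c)
  then have "flat q c" by (simp add: flat_def)
  then have "deg f \<noteq> Suc q" if "f \<in> supp c" for f using flat_low[of q c f] that by simp
  then show ?case by simp
next
  case (Cons e p es c)
  have e: "e \<in> F" "deg e = Suc q" using piece_F[OF Cons.hyps(1)] Cons.prems by simp_all
  have "f \<in> supp p \<longleftrightarrow> f \<in> supp (g e)" if "deg f = Suc q" for f
    using eqset_imp_iff[OF piece_supp[OF Cons.hyps(1)], of f] that by simp
  then have "top (Suc q) p = top (Suc q) (g e)" by blast
  also have "\<dots> = {e}"
  proof
    show "top (Suc q) (g e) \<subseteq> {e}" using supp_atom_deg[OF e(1)] e(2) by fastforce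
    show "{e} \<subseteq> top (Suc q) (g e)" using supp_atom[OF e(1)] e(2) by simp
  qed
  finally have "top (Suc q) p = {e}" .
  moreover have "top (Suc q) c = set es" using Cons by simp
  ultimately show ?case unfolding supp_cmp[OF Cons.hyps(3)] by auto
qed

lemma piece_atom: "y \<in> F \<Longrightarrow> q < deg y \<Longrightarrow> piece q y (g y)"
proof (induction q)
  case (Suc q)
  then have 1: "pasted q ([] @ y # []) (g y)" by (simp add: pasted_single)
  show ?case unfolding piece.simps
    by (intro conjI exI[of _ "[]"] 1) (use Suc.prems in simp_all)
qed simp

end

section \<open>Rigidity\<close>

context rigid begin

declare piece.simps(2) [simp del]

text \<open>The following properties are proved together by induction on the level \<open>q\<close>.\<close>

definition flat_unique :: "nat \<Rightarrow> bool" where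
  "flat_unique q \<longleftrightarrow> (\<forall>c c'. flat q c \<longrightarrow> flat q c' \<longrightarrow> supp c = supp c' \<longrightarrow> c = c')"

definition piece_unique :: "nat \<Rightarrow> bool" where
  "piece_unique q \<longleftrightarrow> (\<forall>e p p'. piece q e p \<longrightarrow> piece q e p' \<longrightarrow>
     supp (src D q p) = supp (src D q p') \<longrightarrow> p = p')"

definition piece_whisker :: "nat \<Rightarrow> bool" where
  "piece_whisker q \<longleftrightarrow> (\<forall>e p u m. piece q e p \<longrightarrow> flat q u \<longrightarrow> m < q \<longrightarrow>
     (composable D m p u \<longrightarrow> piece q e (cmp D m p u)) \<and> (composable D m u p \<longrightarrow> piece q e (cmp D m u p)))"

definition piece_swap :: "nat \<Rightarrow> bool" where
  "piece_swap q \<longleftrightarrow> (\<forall>b c x y. piece q b x \<longrightarrow> piece q c y \<longrightarrow> composable D q x y \<longrightarrow> rank c < rank b \<longrightarrow>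
     (\<exists>y' x'. piece q c y' \<and> piece q b x' \<and> composable D q y' x' \<and> cmp D q x y = cmp D q y' x'))"

definition pasted_distinct :: "nat \<Rightarrow> bool" where
  "pasted_distinct q \<longleftrightarrow> (\<forall>es c. pasted q es c \<longrightarrow> distinct es)"

definition flat_pasted :: "nat \<Rightarrow> bool" where
  "flat_pasted q \<longleftrightarrow> (\<forall>c. flat (Suc q) c \<longrightarrow> (\<exists>es. pasted q es c \<and> (\<forall>e\<in>set es. deg e = Suc q)))"

text \<open>Insertion sort, where each comparison that fails is a swap of two adjacent pieces.\<close>

lemma pasted_insort:
  assumes sw: "piece_swap q"
  shows "pasted q es c \<Longrightarrow> piece q e p \<Longrightarrow> composable D q p c \<Longrightarrow> pasted q (insort_key rank e es) (cmp D q p c)"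
proof (induction es arbitrary: p c)
  case Nil
  then show ?case using pasting.Cons[of "piece q"] by simp
next
  case (Cons f es)
  show ?case
  proof (cases "rank e \<le> rank f")
    case True
    then show ?thesis using Cons.prems pasting.Cons[of "piece q"] by simp
  next
    case False
    obtain p' d where d: "c = cmp D q p' d" "piece q f p'" "pasted q es d" "composable D q p' d"
      using Cons.prems(1) by (auto elim: pasting_ConsE)
    have "composable D q p p'" using Cons.prems(3) d(1,4) by (simp add: composable_cmpD)
    then obtain y x where x: "piece q f y" "piece q e x" "composable D q y x" "cmp D q p p' = cmp D q y x"
      using sw[unfolded piece_swap_def] Cons.prems(2) d(2) False by (metis not_le)
    have xd: "composable D q x d"
      using assoc(1)[OF \<open>composable D q p p'\<close> d(4)] x(4) by (simp add: composable_cmpD[OF x(3)])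
    have "cmp D q p c = cmp D q y (cmp D q x d)"
      unfolding d(1) using assoc(3)[OF \<open>composable D q p p'\<close> d(4)] x(4) assoc(3)[OF x(3) xd] by simp
    moreover have "pasted q (f # insort_key rank e es) (cmp D q y (cmp D q x d))"
      by (rule pasting.Cons[of "piece q", OF x(1) Cons.IH[OF d(3) x(2) xd] assoc(2)[OF x(3) xd]])
    ultimately show ?thesis using False by simp
  qed
qed

lemma pasted_sort_key:
  assumes sw: "piece_swap q"
  shows "pasted q es c \<Longrightarrow> pasted q (sort_key rank es) c"
proof (induction rule: pasting.induct)
  case (Nil c)
  then show ?case by (simp add: pasted_Nil flat_def)
next
  case (Cons e p es c)
  then show ?case using pasted_insort[OF sw] by simp
qed

lemma pasted_sorted:
  assumes "piece_swap q" "pasted_distinct q" "pasted q es c"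
  obtains L where "pasted q L c" "sorted_wrt (<) (map rank L)" "set L = set es" "distinct L"
proof
  let ?L = "sort_key rank es"
  show 1: "pasted q ?L c" by (rule pasted_sort_key[OF assms(1,3)])
  then show d: "distinct ?L" using assms(2) unfolding pasted_distinct_def by blast
  have "inj_on rank (set ?L)" using pasted_F[OF 1] inj_rank inj_on_subset by blast
  then show "sorted_wrt (<) (map rank ?L)" unfolding strict_sorted_iff using d by (simp add: distinct_map)
  show "set ?L = set es" by simp
qed

lemma strict_sorted_unique:
  assumes "sorted_wrt (<) (map rank L)" "sorted_wrt (<) (map rank L')" "set L = set L'" "set L \<subseteq> F"
  shows "L = L'"
proof -
  have "map rank L = map rank L'"
    using assms by (intro sorted_distinct_set_unique) (simp_all add: strict_sorted_iff)
  then show ?thesis using assms inj_rank by (metis inj_on_subset map_inj_on Un_absorb)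
qed

lemma piece_SucI:
  assumes "piece_swap q" "pasted_distinct q" "pasted q (as @ e # bs) c" "Suc q < deg e"
    "\<forall>f\<in>set (as @ bs). deg f = Suc q"
  shows "piece (Suc q) e c"
proof -
  obtain L where L: "pasted q L c" "sorted_wrt (<) (map rank L)" "set L = set (as @ e # bs)" "distinct L"
    using pasted_sorted[OF assms(1-3)] .
  then obtain A B where AB: "L = A @ e # B" by (metis in_set_conv_decomp)
  have "set (A @ B) = set L - {e}" using L(4) unfolding AB by auto
  then have "\<forall>f\<in>set (A @ B). deg f = Suc q" using assms(5) L(3) by auto
  moreover have "e \<in> F" using pasted_F[OF assms(3)] by simp
  ultimately show ?thesis using L AB assms(4) unfolding piece.simps by blast
qed

lemma piece_SucE:
  assumes "piece (Suc q) e p"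
  obtains as bs where "pasted q (as @ e # bs) p" "Suc q < deg e" "\<forall>f\<in>set (as @ bs). deg f = Suc q"
    "sorted_wrt (<) (map rank (as @ e # bs))"
  using assms unfolding piece.simps by blast

lemma piece_bd:
  assumes nf: "flat_pasted q" and p: "piece q e p"
  obtains hs where "pasted q hs (bd D \<alpha> (Suc q) p)" "\<forall>h\<in>set hs. deg h = Suc q"
    "set hs = top (Suc q) (bd D \<alpha> (Suc q) (g e))"
proof -
  obtain hs where hs: "pasted q hs (bd D \<alpha> (Suc q) p)" "\<forall>h\<in>set hs. deg h = Suc q"
    using nf flat_bd[OF piece_cell[OF p], of "Suc q" "Suc q"] unfolding flat_pasted_def by blast
  have "f \<in> supp (bd D \<alpha> (Suc q) p) \<longleftrightarrow> f \<in> supp (bd D \<alpha> (Suc q) (g e))" if "deg f = Suc q" for f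
    using eqset_imp_iff[OF piece_top[OF p, of "Suc q" \<alpha>], of f] that by simp
  then have "set hs = top (Suc q) (bd D \<alpha> (Suc q) (g e))" using pasted_top[OF hs] by blast
  with hs show ?thesis by (rule that)
qed

text \<open>Only the piece for \<open>e\<close> changes when the boundary is taken; it becomes a pasting of the faces in the
  boundary of the atom \<open>e\<close>, at the same place of the sequence.\<close>

lemma pasted_bd:
  assumes nf: "flat_pasted q" and p: "pasted q (as @ e # bs) p" "\<forall>f\<in>set (as @ bs). deg f = Suc q"
  obtains hs where "pasted q (as @ hs @ bs) (bd D \<alpha> (Suc q) p)" "\<forall>h\<in>set hs. deg h = Suc q"
    "set hs = top (Suc q) (bd D \<alpha> (Suc q) (g e))"
proof -
  obtain a x b where x: "pasted q as a" "piece q e x" "pasted q bs b" "composable D q a (cmp D q x b)"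
    "composable D q x b" "p = cmp D q a (cmp D q x b)" using pasted_split3[OF p(1)] .
  obtain hs where hs: "pasted q hs (bd D \<alpha> (Suc q) x)" "\<forall>h\<in>set hs. deg h = Suc q"
    "set hs = top (Suc q) (bd D \<alpha> (Suc q) (g e))" using piece_bd[OF nf x(2)] .
  have f: "flat (Suc q) a" "flat (Suc q) b" using pasted_flat[OF x(1)] pasted_flat[OF x(3)] p(2) by auto
  note w = bd_whisker[OF f lessI x(5,4), of \<alpha>]
  have "pasted q (as @ hs @ bs) (bd D \<alpha> (Suc q) p)"
    unfolding x(6) w(1) by (rule pasted_join3[OF x(1) hs(1) x(3) w(2,3)])
  then show ?thesis using hs that by blast
qed

text \<open>The source of a composite is the source of its first piece, which determines this piece; its target
  is the source of the second piece, and so on.\<close>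

lemma pasted_unique:
  assumes "flat_unique q" "piece_unique q"
  shows "pasted q es c \<Longrightarrow> pasted q es c' \<Longrightarrow> supp (src D q c) = supp (src D q c') \<Longrightarrow> c = c'"
proof (induction es arbitrary: c c')
  case Nil
  then show ?case using assms(1) flat_eq unfolding flat_unique_def by (metis pasted_Nil)
next
  case (Cons e es)
  obtain p d where d: "c = cmp D q p d" "piece q e p" "pasted q es d" "composable D q p d"
    using Cons.prems(1) by (auto elim: pasting_ConsE)
  obtain p' d' where d': "c' = cmp D q p' d'" "piece q e p'" "pasted q es d'" "composable D q p' d'"
    using Cons.prems(2) by (auto elim: pasting_ConsE)
  have "supp (src D q p) = supp (src D q p')" using Cons.prems(3) d d' by (simp add: src_cmp)
  then have p: "p = p'" using assms(2) d(2) d'(2) by (auto simp: piece_unique_def)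
  then have "src D q d = src D q d'" using d(4) d'(4) by (simp add: composable_def)
  then have "d = d'" using Cons.IH[OF d(3) d'(3)] by simp
  then show ?case using p d(1) d'(1) by simp
qed

lemma pasted_whisker:
  assumes wh: "piece_whisker q" and u: "flat q u" and m: "m < q" and c: "pasted q es c"
  shows "composable D m c u \<Longrightarrow> pasted q es (cmp D m c u)" "composable D m u c \<Longrightarrow> pasted q es (cmp D m u c)"
proof -
  show "composable D m c u \<Longrightarrow> pasted q es (cmp D m c u)"
    using c
  proof (induction rule: pasting.induct)
    case (Nil c)
    then show ?case using flat_cmp[of m c u q] u by (simp add: pasted_Nil flat_def)
  next
    case (Cons e p es c)
    note w = whisker_right[OF Cons.hyps(3) Cons.prems u m]
    show ?case unfolding w(4)
      by (rule pasting.Cons[of "piece q", OF _ Cons.IH[OF w(2)] w(3)])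
        (use wh Cons.hyps(1) u m w(1) in \<open>unfold piece_whisker_def, blast\<close>)
  qed
  show "composable D m u c \<Longrightarrow> pasted q es (cmp D m u c)"
    using c
  proof (induction rule: pasting.induct)
    case (Nil c)
    then show ?case using flat_cmp[of m u c q] u by (simp add: pasted_Nil flat_def)
  next
    case (Cons e p es c)
    note w = whisker_left[OF Cons.hyps(3) Cons.prems u m]
    show ?case unfolding w(4)
      by (rule pasting.Cons[of "piece q", OF _ Cons.IH[OF w(2)] w(3)])
        (use wh Cons.hyps(1) u m w(1) in \<open>unfold piece_whisker_def, blast\<close>)
  qed
qed

text \<open>A composite \<open>a *\<^sub>m b\<close> with \<open>m < q\<close> is first spread out along \<open>*\<^sub>q\<close> by \<open>slide\<close>; after that, the cell
  that is attached to each piece has dimension at most \<open>q\<close>.\<close>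

lemma flat_pastedI:
  assumes wh: "piece_whisker q"
  shows "flat_pasted q"
  unfolding flat_pasted_def
proof (intro allI impI)
  fix c assume c: "flat (Suc q) c"
  have "c \<in> generated D (g ` F)" using gen flat_cell[OF c] by blast
  then show "\<exists>es. pasted q es c \<and> (\<forall>e\<in>set es. deg e = Suc q)" using c
  proof (induction rule: generated.induct)
    case (base x)
    then obtain y where y: "y \<in> F" "x = g y" by blast
    have "deg y \<le> Suc q" using flat_low[OF base.prems] supp_atom[OF y(1)] y(2) by simp
    then consider "deg y = Suc q" | "deg y \<le> q" by linarith
    then show ?case
    proof cases
      case 1
      then have "pasted q [y] x" using y by (simp add: pasted_single piece_atom)
      then show ?thesis using 1 by (intro exI[of _ "[y]"]) simp
    next
      case 2
      then have "pasted q [] x" using flat_mono[OF atom_flat[OF y(1)]] y(2) by (simp add: pasted_Nil)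
      then show ?thesis by (intro exI[of _ "[]"]) simp
    qed
  next
    case (comp a b m)
    have ab: "a \<in> cells D" "b \<in> cells D" using composable_cells comp.hyps(3) by blast+
    have "flat (Suc q) a" "flat (Suc q) b"
      using flat_low[OF comp.prems] by (simp_all add: supp_cmp[OF comp.hyps(3)] flat_iff ab)
    then obtain as bs where as: "pasted q as a" "\<forall>e\<in>set as. deg e = Suc q"
      and bs: "pasted q bs b" "\<forall>e\<in>set bs. deg e = Suc q" using comp.IH by blast
    consider "Suc q \<le> m" | "m = q" | "m < q" by linarith
    then show ?case
    proof cases
      case 1
      then have "cmp D m a b = b"
        using cmp_flat_left[OF comp.hyps(3)] flat_mono[OF \<open>flat (Suc q) a\<close>] by simp
      then show ?thesis using bs by auto
    next
      case 2
      then have "pasted q (as @ bs) (cmp D m a b)" using pasted_append as bs comp.hyps(3) by simp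
      then show ?thesis using as(2) bs(2) by (intro exI[of _ "as @ bs"]) auto
    next
      case 3
      note s = slide[OF comp.hyps(3) 3]
      have "flat q (src D q b)" "flat q (tgt D q a)" using flat_bd ab by simp_all
      then have "pasted q (as @ bs) (cmp D m a b)" unfolding s(4)
        using pasted_whisker[OF wh _ 3] as(1) bs(1) s(1-3) by (intro pasted_append) blast+
      then show ?thesis using as(2) bs(2) by (intro exI[of _ "as @ bs"]) auto
    qed
  qed
qed

lemma piece_whisker_Suc:
  assumes wh: "piece_whisker q" and sw: "piece_swap q" and nd: "pasted_distinct q"
  shows "piece_whisker (Suc q)"
  unfolding piece_whisker_def
proof (intro allI impI)
  fix e p u m
  assume p: "piece (Suc q) e p" and u: "flat (Suc q) u" and "m < Suc q"
  obtain as bs where as: "pasted q (as @ e # bs) p" "Suc q < deg e" "\<forall>f\<in>set (as @ bs). deg f = Suc q"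
    using piece_SucE[OF p] .
  obtain us where us: "pasted q us u" "\<forall>e\<in>set us. deg e = Suc q"
    using flat_pastedI[OF wh] u unfolding flat_pasted_def by blast
  have c: "p \<in> cells D" "u \<in> cells D" using piece_cell[OF p] flat_cell[OF u] .
  have f: "flat q (bd D \<alpha> q p)" "flat q (bd D \<alpha> q u)" for \<alpha> using flat_bd c by simp_all
  have "pasted q ((as @ e # bs) @ us) (cmp D m p u)" if pu: "composable D m p u"
  proof (cases "m = q")
    case True
    then show ?thesis using pasted_append[OF as(1) us(1)] pu by simp
  next
    case False
    then have m: "m < q" using \<open>m < Suc q\<close> by simp
    note s = slide[OF pu m]
    show ?thesis unfolding s(4)
      by (intro pasted_append pasted_whisker(1)[OF wh f(2) m as(1) s(1)] pasted_whisker(2)[OF wh f(1) m us(1) s(2)] s(3))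
  qed
  moreover have "pasted q (us @ as @ e # bs) (cmp D m u p)" if pu: "composable D m u p"
  proof (cases "m = q")
    case True
    then show ?thesis using pasted_append[OF us(1) as(1)] pu by simp
  next
    case False
    then have m: "m < q" using \<open>m < Suc q\<close> by simp
    note s = slide[OF pu m]
    show ?thesis unfolding s(4)
      by (intro pasted_append pasted_whisker(1)[OF wh f(1) m us(1) s(1)] pasted_whisker(2)[OF wh f(2) m as(1) s(2)] s(3))
  qed
  ultimately show "(composable D m p u \<longrightarrow> piece (Suc q) e (cmp D m p u)) \<and>
      (composable D m u p \<longrightarrow> piece (Suc q) e (cmp D m u p))"
    using piece_SucI[OF sw nd, of as e "bs @ us" "cmp D m p u"]
      piece_SucI[OF sw nd, of "us @ as" e bs "cmp D m u p"] as(2,3) us(2) by (simp add: ball_Un)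
qed

text \<open>The support of the source is the disjoint union of the faces other than \<open>e\<close> that are pasted and of
  the source of \<open>e\<close>. The second part depends only on \<open>e\<close>, hence so does the first, and with it the
  sorted sequence.\<close>

lemma piece_unique_Suc:
  assumes wh: "piece_whisker q" and nd: "pasted_distinct q" and u: "flat_unique q" "piece_unique q"
  shows "piece_unique (Suc q)"
  unfolding piece_unique_def
proof (intro allI impI)
  fix e p p'
  assume p: "piece (Suc q) e p" and p': "piece (Suc q) e p'"
    and eq: "supp (src D (Suc q) p) = supp (src D (Suc q) p')"
  define T where "T = top (Suc q) (src D (Suc q) (g e))"
  have key: "set (as @ bs) = top (Suc q) (src D (Suc q) p) - T"
    if as: "pasted q (as @ e # bs) p" "\<forall>f\<in>set (as @ bs). deg f = Suc q" for as bs p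
  proof -
    obtain hs where hs: "pasted q (as @ hs @ bs) (src D (Suc q) p)" "\<forall>h\<in>set hs. deg h = Suc q"
      "set hs = T" using pasted_bd[OF flat_pastedI[OF wh] as, of Minus] unfolding T_def .
    have "distinct (as @ hs @ bs)" using nd hs(1) unfolding pasted_distinct_def by blast
    moreover have "top (Suc q) (src D (Suc q) p) = set (as @ hs @ bs)"
      using hs(2) as(2) by (intro pasted_top[OF hs(1)]) auto
    ultimately show ?thesis using hs(3) by auto
  qed
  obtain as bs where as: "pasted q (as @ e # bs) p" "Suc q < deg e" "\<forall>f\<in>set (as @ bs). deg f = Suc q"
    "sorted_wrt (<) (map rank (as @ e # bs))" using piece_SucE[OF p] .
  obtain as' bs' where as': "pasted q (as' @ e # bs') p'" "Suc q < deg e" "\<forall>f\<in>set (as' @ bs'). deg f = Suc q"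
    "sorted_wrt (<) (map rank (as' @ e # bs'))" using piece_SucE[OF p'] .
  have "set (as @ bs) = set (as' @ bs')" unfolding key[OF as(1,3)] key[OF as'(1,3)] eq ..
  then have "set (as @ e # bs) = set (as' @ e # bs')" by simp
  then have "as @ e # bs = as' @ e # bs'"
    using pasted_F[OF as(1)] by (intro strict_sorted_unique[OF as(4) as'(4)]) blast+
  moreover have "supp (src D q p) = supp (src D q p')"
  proof -
    have c: "p \<in> cells D" "p' \<in> cells D" using piece_cell p p' by blast+
    have "supp (src D q (src D (Suc q) p)) = supp (src D q (src D (Suc q) p'))"
      by (rule supp_bd_cong[OF bd_cell[OF c(1)] bd_cell[OF c(2)] eq])
    then show ?thesis using c by (simp add: bd_bd)
  qed
  ultimately show "p = p'" using pasted_unique[OF u] as(1) as'(1) by simp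
qed

lemma flat_unique_Suc:
  assumes wh: "piece_whisker q" and sw: "piece_swap q" and nd: "pasted_distinct q" and u: "flat_unique q" "piece_unique q"
  shows "flat_unique (Suc q)"
  unfolding flat_unique_def
proof (intro allI impI)
  fix c c' assume c: "flat (Suc q) c" and c': "flat (Suc q) c'" and eq: "supp c = supp c'"
  have key: "\<exists>L. pasted q L c \<and> sorted_wrt (<) (map rank L) \<and> set L = top (Suc q) c" if c: "flat (Suc q) c" for c
  proof -
    obtain es where es: "pasted q es c" "\<forall>e\<in>set es. deg e = Suc q"
      using flat_pastedI[OF wh] c unfolding flat_pasted_def by blast
    obtain L where "pasted q L c" "sorted_wrt (<) (map rank L)" "set L = set es" "distinct L"
      using pasted_sorted[OF sw nd es(1)] .
    then show ?thesis using pasted_top[OF es] by blast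
  qed
  obtain L L' where L: "pasted q L c" "sorted_wrt (<) (map rank L)" "set L = top (Suc q) c"
    and L': "pasted q L' c'" "sorted_wrt (<) (map rank L')" "set L' = top (Suc q) c'"
    using key[OF c] key[OF c'] by blast
  have "set L = set L'" unfolding L(3) L'(3) eq ..
  then have "L = L'" using pasted_F[OF L(1)] by (intro strict_sorted_unique[OF L(2) L'(2)]) blast+
  moreover have "supp (src D q c) = supp (src D q c')"
    by (rule supp_bd_cong[OF flat_cell[OF c] flat_cell[OF c'] eq])
  ultimately show "c = c'" using pasted_unique[OF u] L(1) L'(1) by simp
qed

text \<open>Cut \<open>x = V *\<^sub>q X\<close> and \<open>y = Y *\<^sub>q W\<close> at the rank of \<open>c\<close>, so that \<open>X\<close> contains \<open>b\<close> and \<open>Y\<close> contains \<open>c\<close>.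
  Then \<open>V\<close> followed by the target of \<open>X\<close>, and the source of \<open>Y\<close> followed by \<open>W\<close>, are two pastings of the
  cell between \<open>x\<close> and \<open>y\<close>, and both are cut at the same rank; by uniqueness \<open>V\<close> is the source of \<open>Y\<close>
  and \<open>W\<close> is the target of \<open>X\<close>. Therefore the composite of \<open>x\<close> and \<open>y\<close> is \<open>Y *\<^sub>q X\<close>, which can also be
  passed with \<open>c\<close> first.\<close>

lemma piece_swap_Suc:
  assumes wh: "piece_whisker q" and sw: "piece_swap q" and nd: "pasted_distinct q" and u: "flat_unique q" "piece_unique q"
  shows "piece_swap (Suc q)"
  unfolding piece_swap_def
proof (intro allI impI)
  fix b c x y
  assume x: "piece (Suc q) b x" and y: "piece (Suc q) c y" and xy: "composable D (Suc q) x y"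
    and rank: "rank c < rank b"
  note nf = flat_pastedI[OF wh]
  define M where "M = tgt D (Suc q) x"
  have M: "M = src D (Suc q) y" using composable_eq[OF xy] by (simp add: M_def)
  obtain as bs where as: "pasted q (as @ b # bs) x" "Suc q < deg b" "\<forall>f\<in>set (as @ bs). deg f = Suc q"
    "sorted_wrt (<) (map rank (as @ b # bs))" using piece_SucE[OF x] .
  obtain cs ds where cs: "pasted q (cs @ c # ds) y" "Suc q < deg c" "\<forall>f\<in>set (cs @ ds). deg f = Suc q"
    "sorted_wrt (<) (map rank (cs @ c # ds))" using piece_SucE[OF y] .
  have b: "b \<in> F" and c: "c \<in> F" using piece_F x y by blast+
  \<comment> \<open>\<open>as\<close> is cut at the rank of \<open>c\<close>; \<open>ds\<close> lies above this rank as a whole.\<close>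
  define A where "A = takeWhile (\<lambda>f. rank f \<le> rank c) as"
  define B where "B = dropWhile (\<lambda>f. rank f \<le> rank c) as"
  have A: "\<forall>f\<in>set A. rank f \<le> rank c" unfolding A_def by (meson set_takeWhileD)
  have AB: "as = A @ B" by (simp add: A_def B_def)
  have srt: "sorted_wrt (<) (map rank A)" "sorted_wrt (<) (map rank B)"
    "\<forall>f\<in>set bs. rank b < rank f" "\<forall>f\<in>set cs. rank f < rank c" "\<forall>f\<in>set ds. rank c < rank f"
    "sorted_wrt (<) (map rank ds)"
    using as(4) cs(4) unfolding AB by (auto simp: sorted_wrt_append)
  have B: "rank c < rank f" if "f \<in> set B" for f
  proof -
    have "B \<noteq> []" using that by auto
    then have "\<not> rank (hd B) \<le> rank c"
      using hd_dropWhile[of "\<lambda>f. rank f \<le> rank c" as] unfolding B_def by blast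
    then have "rank c < rank (hd B)" by simp
    moreover have "rank (hd B) \<le> rank f" using srt(2) that \<open>B \<noteq> []\<close>
      by (cases B) (auto simp: less_imp_le)
    ultimately show ?thesis by simp
  qed
  obtain V X where V: "pasted q A V" and X: "pasted q (B @ b # bs) X" and VX: "composable D q V X" "x = cmp D q V X"
    using pasted_split[of q A "B @ b # bs" x] as(1) unfolding AB by auto
  obtain Y W where Y: "pasted q (cs @ [c]) Y" and W: "pasted q ds W" and YW: "composable D q Y W" "y = cmp D q Y W"
    using pasted_split[of q "cs @ [c]" ds y] cs(1) by auto
  have cell: "X \<in> cells D" "Y \<in> cells D" using pasted_cell X Y by blast+
  have VW: "flat (Suc q) V" "flat (Suc q) W"
    using pasted_flat[OF V, of "Suc q"] pasted_flat[OF W, of "Suc q"] as(3) cs(3) unfolding AB by auto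
  have dB: "\<forall>f\<in>set (B @ bs). deg f = Suc q" "\<forall>f\<in>set (cs @ []). deg f = Suc q"
    and dA: "\<forall>f\<in>set A. deg f = Suc q" "\<forall>f\<in>set ds. deg f = Suc q"
    using as(3) cs(3) unfolding AB by auto
  obtain hs where hs: "pasted q (B @ hs @ bs) (tgt D (Suc q) X)" "\<forall>h\<in>set hs. deg h = Suc q"
    "set hs = top (Suc q) (tgt D (Suc q) (g b))" using pasted_bd[OF nf X dB(1)] .
  obtain ks where ks: "pasted q (cs @ ks @ []) (src D (Suc q) Y)" "\<forall>h\<in>set ks. deg h = Suc q"
    "set ks = top (Suc q) (src D (Suc q) (g c))" using pasted_bd[OF nf Y dB(2)] .
  have "rank b < rank f" if "f \<in> set hs" for f
    using rank_tgt[OF b as(2)] that unfolding hs(3) by blast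
  then have "\<forall>f\<in>set hs. rank c < rank f" "\<forall>f\<in>set bs. rank c < rank f"
    using srt(3) rank by (meson less_trans)+
  then have hs': "\<forall>f\<in>set (B @ hs @ bs). rank c < rank f" using B by auto
  have "rank f < rank c" if "f \<in> set ks" for f
    using rank_src[OF c cs(2)] that unfolding ks(3) by blast
  then have ks': "\<forall>f\<in>set (cs @ ks @ []). rank f < rank c" using srt(4) by auto
  obtain L where L: "pasted q L (tgt D (Suc q) X)" "sorted_wrt (<) (map rank L)" "set L = set (B @ hs @ bs)" "distinct L"
    using pasted_sorted[OF sw nd hs(1)] .
  obtain K where K: "pasted q K (src D (Suc q) Y)" "sorted_wrt (<) (map rank K)" "set K = set (cs @ ks @ [])" "distinct K"
    using pasted_sorted[OF sw nd ks(1)] .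
  have M1: "composable D q V (tgt D (Suc q) X)" "M = cmp D q V (tgt D (Suc q) X)"
    using composable_bd[OF D VX(1), of "Suc q" Plus] flat_eq[OF VW(1)]
    unfolding M_def VX(2) by (simp_all add: bd_cmp[OF VX(1)])
  have M2: "composable D q (src D (Suc q) Y) W" "M = cmp D q (src D (Suc q) Y) W"
    using composable_bd[OF D YW(1), of "Suc q" Minus] flat_eq[OF VW(2)]
    unfolding M YW(2) by (simp_all add: bd_cmp[OF YW(1)])
  have s1: "pasted q (A @ L) M" unfolding M1(2) by (rule pasted_append[OF V L(1) M1(1)])
  have s2: "pasted q (K @ ds) M" unfolding M2(2) by (rule pasted_append[OF K(1) W M2(1)])
  have "set (A @ L) = top (Suc q) M"
    using dA(1) dB(1) hs(2) L(3) by (intro pasted_top[OF s1, symmetric]) auto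
  also have "\<dots> = set (K @ ds)"
    using dA(2) dB(2) ks(2) K(3) by (intro pasted_top[OF s2]) auto
  finally have sets: "set (A @ L) = set (K @ ds)" .
  have L': "\<forall>f\<in>set L. rank c < rank f" unfolding L(3) using hs' .
  have K': "\<forall>f\<in>set K. rank f < rank c" unfolding K(3) using ks' .
  have "\<forall>x\<in>set A. \<forall>y\<in>set L. rank x < rank y" "\<forall>x\<in>set K. \<forall>y\<in>set ds. rank x < rank y"
    using A L' K' srt(5) by (meson le_less_trans less_trans)+
  then have "sorted_wrt (<) (map rank (A @ L))" "sorted_wrt (<) (map rank (K @ ds))"
    using srt(1,6) L(2) K(2) by (simp_all add: sorted_wrt_append)
  moreover have "set (A @ L) \<subseteq> F" using pasted_F[OF s1] by blast
  ultimately have eq: "A @ L = K @ ds" using sets by (intro strict_sorted_unique)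
  have "filter (\<lambda>f. rank f \<le> rank c) A = A" "filter (\<lambda>f. rank f \<le> rank c) L = []"
    "filter (\<lambda>f. rank f \<le> rank c) K = K" "filter (\<lambda>f. rank f \<le> rank c) ds = []"
    using A L' K' srt(5) by (simp_all add: filter_id_conv filter_empty_conv less_imp_le not_le)
  then have "filter (\<lambda>f. rank f \<le> rank c) (A @ L) = A" "filter (\<lambda>f. rank f \<le> rank c) (K @ ds) = K"
    by simp_all
  then have AK: "A = K" using eq by simp
  then have Lds: "L = ds" using eq by simp
  have "src D q V = src D q (src D (Suc q) Y)"
    using src_cmp[OF M1(1)] src_cmp[OF M2(1)] M1(2) M2(2) by simp
  then have V': "V = src D (Suc q) Y" by (intro pasted_unique[OF u V]) (use K(1) AK in simp_all)
  then have "src D q (tgt D (Suc q) X) = src D q W"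
    using composable_eq[OF M1(1)] composable_eq[OF M2(1)] by simp
  then have "tgt D (Suc q) X = W" using pasted_unique[OF u _ W] L(1) Lds by simp
  then have W': "W = tgt D (Suc q) X" ..
  have YX: "composable D q Y X"
    using VX(1) cell unfolding V' by (simp add: composable_def bd_bd)
  have xy': "cmp D (Suc q) x y = cmp D q Y X"
    unfolding VX(2) YW(2) V' W' by (rule slide'(4)[OF YX lessI, symmetric])
  note s = slide[OF YX lessI]
  obtain js where js: "pasted q (B @ js @ bs) (src D (Suc q) X)" "\<forall>h\<in>set js. deg h = Suc q"
    "set js = top (Suc q) (src D (Suc q) (g b))" using pasted_bd[OF nf X dB(1)] .
  obtain ls where ls: "pasted q (cs @ ls @ []) (tgt D (Suc q) Y)" "\<forall>h\<in>set ls. deg h = Suc q"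
    "set ls = top (Suc q) (tgt D (Suc q) (g c))" using pasted_bd[OF nf Y dB(2)] .
  have "pasted q (cs @ c # (B @ js @ bs)) (cmp D q Y (src D (Suc q) X))"
    using pasted_append[OF Y js(1) s(1)] by simp
  from piece_SucI[OF sw nd this cs(2)]
  have "piece (Suc q) c (cmp D q Y (src D (Suc q) X))" using dB js(2) by auto
  moreover have "pasted q ((cs @ ls @ B) @ b # bs) (cmp D q (tgt D (Suc q) Y) X)"
    using pasted_append[OF ls(1) X s(2)] by simp
  from piece_SucI[OF sw nd this as(2)]
  have "piece (Suc q) b (cmp D q (tgt D (Suc q) Y) X)" using dB ls(2) by auto
  ultimately show "\<exists>y' x'. piece (Suc q) c y' \<and> piece (Suc q) b x' \<and> composable D (Suc q) y' x' \<and>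
      cmp D (Suc q) x y = cmp D (Suc q) y' x'"
    unfolding xy' using s(3,4) by blast
qed

text \<open>In a sorted sequence equal faces are adjacent.\<close>

lemma pasted_distinctI:
  assumes sw: "piece_swap k" and no: "\<And>e p p'. piece k e p \<Longrightarrow> piece k e p' \<Longrightarrow> \<not> composable D k p p'"
  shows "pasted_distinct k"
  unfolding pasted_distinct_def
proof (intro allI impI, rule ccontr)
  fix es c assume es: "pasted k es c" and nd: "\<not> distinct es"
  define L where "L = sort_key rank es"
  have L: "pasted k L c" unfolding L_def by (rule pasted_sort_key[OF sw es])
  have F: "set L \<subseteq> F" using pasted_F[OF L] by blast
  have "\<not> distinct L" using nd by (simp add: L_def)
  then obtain xs y ys zs where xs: "L = xs @ [y] @ ys @ [y] @ zs" using not_distinct_decomp by blast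
  have "sorted (map rank L)" by (simp add: L_def)
  then have "\<forall>z\<in>set ys. rank z = rank y" unfolding xs by (fastforce simp: sorted_append intro: antisym)
  then have "\<forall>z\<in>set ys. z = y" using inj_rank F unfolding xs inj_on_def by auto
  then obtain ws where "L = xs @ y # y # ws"
    using xs by (cases ys) auto
  then obtain d where "pasted k (y # y # ws) d" using pasted_split L by metis
  then obtain p d' where 1: "piece k y p" "pasted k (y # ws) d'" "composable D k p d'" by (auto elim: pasting_ConsE)
  then obtain p' d'' where 2: "piece k y p'" "composable D k p' d''" "d' = cmp D k p' d''" by (auto elim: pasting_ConsE)
  have "composable D k p p'" using 1(3) unfolding 2(3) by (simp add: composable_cmpD[OF 2(2)])
  then show False using no 1(1) 2(1) by blast
qed

text \<open>If two pieces for \<open>e\<close> were composable, a face in the source of \<open>e\<close> would have to be present in the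
  target of the first piece. It is not in the target of \<open>e\<close>, since it precedes \<open>e\<close>; and it is not among
  the other faces of the first piece, since these together with the source of \<open>e\<close> form a pasting
  without repetitions one level below.\<close>

lemma pasted_distinct_Suc:
  assumes wh: "piece_whisker q" and nd: "pasted_distinct q" and sw: "piece_swap (Suc q)"
  shows "pasted_distinct (Suc q)"
proof (rule pasted_distinctI[OF sw])
  fix e p p' assume p: "piece (Suc q) e p" and p': "piece (Suc q) e p'"
  show "\<not> composable D (Suc q) p p'"
  proof
    assume "composable D (Suc q) p p'"
    then have eq: "tgt D (Suc q) p = src D (Suc q) p'" by (rule composable_eq)
    note nf = flat_pastedI[OF wh]
    obtain as bs where as: "pasted q (as @ e # bs) p" "Suc q < deg e" "\<forall>f\<in>set (as @ bs). deg f = Suc q"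
      "sorted_wrt (<) (map rank (as @ e # bs))" using piece_SucE[OF p] .
    obtain cs ds where cs: "pasted q (cs @ e # ds) p'" "Suc q < deg e" "\<forall>f\<in>set (cs @ ds). deg f = Suc q"
      "sorted_wrt (<) (map rank (cs @ e # ds))" using piece_SucE[OF p'] .
    have e: "e \<in> F" using piece_F p by blast
    obtain f where f: "f \<in> supp (src D (Suc q) (g e))" "deg f = Suc q"
      using supp_bd_ex[OF e as(2)] by blast
    have fe: "rank f < rank e" by (rule rank_src[OF e as(2) f])
    obtain hs where hs: "pasted q (as @ hs @ bs) (src D (Suc q) p)" "\<forall>h\<in>set hs. deg h = Suc q"
      "set hs = top (Suc q) (src D (Suc q) (g e))" using pasted_bd[OF nf as(1,3)] .
    obtain ks where ks: "pasted q (as @ ks @ bs) (tgt D (Suc q) p)" "\<forall>h\<in>set ks. deg h = Suc q"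
      "set ks = top (Suc q) (tgt D (Suc q) (g e))" using pasted_bd[OF nf as(1,3)] .
    obtain ls where ls: "pasted q (cs @ ls @ ds) (src D (Suc q) p')" "\<forall>h\<in>set ls. deg h = Suc q"
      "set ls = top (Suc q) (src D (Suc q) (g e))" using pasted_bd[OF nf cs(1,3)] .
    have "set (cs @ ls @ ds) = top (Suc q) (src D (Suc q) p')"
      using cs(3) ls(2) by (intro pasted_top[OF ls(1), symmetric]) auto
    also have "\<dots> = set (as @ ks @ bs)"
      unfolding eq[symmetric] using as(3) ks(2) by (intro pasted_top[OF ks(1)]) auto
    finally have "f \<in> set (as @ ks @ bs)" using f unfolding ls(3)[symmetric] by (auto simp: ls(3))
    moreover have "f \<notin> set ks" using rank_tgt[OF e as(2)] fe f(2) unfolding ks(3) by fastforce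
    moreover have "f \<in> set hs" using f hs(3) by simp
    moreover have "distinct (as @ hs @ bs)" using nd hs(1) unfolding pasted_distinct_def by blast
    ultimately show False by auto
  qed
qed

text \<open>At level 0 two composable pieces \<open>e\<close> and \<open>e'\<close> meet in a vertex, which comes after \<open>e\<close> and before \<open>e'\<close>.
  So they are never in the wrong order.\<close>

lemma level_0: "piece_whisker 0 \<and> piece_swap 0 \<and> pasted_distinct 0 \<and> flat_unique 0 \<and> piece_unique 0"
proof -
  have no: "rank e < rank e'" if "piece 0 e p" "piece 0 e' p'" "composable D 0 p p'" for e e' p p'
  proof -
    have e: "e \<in> F" "0 < deg e" "e' \<in> F" "0 < deg e'" "p = g e" "p' = g e'" using that by simp_all
    obtain f where f: "f \<in> supp (tgt D 0 (g e))" "deg f = 0" using supp_bd_ex e(1,2) by blast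
    then have "f \<in> supp (src D 0 (g e'))" using composable_eq[OF that(3)] e by simp
    then show ?thesis using rank_src rank_tgt e f by (meson less_trans)
  qed
  have "piece_whisker 0" by (simp add: piece_whisker_def)
  moreover have sw: "piece_swap 0" unfolding piece_swap_def using no by (meson less_asym)
  moreover have "pasted_distinct 0" by (rule pasted_distinctI[OF sw]) (use no in blast)
  moreover have "piece_unique 0" by (simp add: piece_unique_def)
  moreover have "flat_unique 0"
    unfolding flat_unique_def
  proof (intro allI impI)
    fix c c' assume c: "flat 0 c" "flat 0 c'" and eq: "supp c = supp c'"
    obtain v v' where v: "v \<in> F" "deg v = 0" "c = g v" "v' \<in> F" "deg v' = 0" "c' = g v'"
      using flat_top[OF c(1)] flat_top[OF c(2)] by blast
    then show "c = c'" using eq supp_atom[of v] supp_atom_deg[of v' v] by auto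
  qed
  ultimately show ?thesis by blast
qed

lemma level: "piece_whisker q \<and> piece_swap q \<and> pasted_distinct q \<and> flat_unique q \<and> piece_unique q"
proof (induction q)
  case 0
  show ?case by (rule level_0)
next
  case (Suc q)
  then have wh: "piece_whisker q" and sw: "piece_swap q" and nd: "pasted_distinct q"
    and u: "flat_unique q" "piece_unique q" by blast+
  have sw': "piece_swap (Suc q)" by (rule piece_swap_Suc[OF wh sw nd u])
  show ?case
    by (intro conjI piece_whisker_Suc[OF wh sw nd] sw' pasted_distinct_Suc[OF wh nd sw']
        flat_unique_Suc[OF wh sw nd u] piece_unique_Suc[OF wh nd u])
qed

theorem supp_inj: "inj_on supp (cells D)"
proof (rule inj_onI)
  fix a b assume ab: "a \<in> cells D" "b \<in> cells D" "supp a = supp b"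
  obtain k where "src D k a = a \<and> tgt D k a = a" using omega_categoryD(5)[OF D ab(1)] by blast
  then have a: "flat k a" unfolding flat_def using ab(1) by (metis sign.exhaust)
  then have "flat k b" using flat_iff ab by simp
  then show "a = b" using level[of k] a ab(3) unfolding flat_unique_def by blast
qed

end

section \<open>Omega-categories of complexes of faces\<close>

text \<open>The combinatorial properties of cubes and simplices that are needed to work with the
  omega-categories that they characterise.\<close>

locale face_complex =
  fixes F :: "'f set" and sub :: "'f \<Rightarrow> 'f set" and fdim :: "'f \<Rightarrow> nat"
    and bdy :: "sign \<Rightarrow> 'f \<Rightarrow> 'f set" and C :: "'f set ocat"
  assumes C: "face_ocat F sub fdim bdy C"
    and sub_refl: "x \<in> F \<Longrightarrow> x \<in> sub x"
    and sub_F: "x \<in> F \<Longrightarrow> sub x \<subseteq> F"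
    and sub_trans: "x \<in> F \<Longrightarrow> y \<in> sub x \<Longrightarrow> sub y \<subseteq> sub x"
    and sub_dim: "x \<in> F \<Longrightarrow> y \<in> sub x \<Longrightarrow> y \<noteq> x \<Longrightarrow> fdim y < fdim x"
    and bdy_sub: "x \<in> F \<Longrightarrow> y \<in> bdy \<alpha> x \<Longrightarrow> 0 < fdim x \<Longrightarrow> y \<in> sub x \<and> Suc (fdim y) = fdim x"
    and sub_bdy: "x \<in> F \<Longrightarrow> y \<in> sub x \<Longrightarrow> y \<noteq> x \<Longrightarrow> \<exists>\<alpha>. \<exists>z\<in>bdy \<alpha> x. y \<in> sub z"
    and bdy_ne: "x \<in> F \<Longrightarrow> 0 < fdim x \<Longrightarrow> \<exists>z\<in>bdy Plus x. z \<notin> bdy Minus x"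
begin

sublocale ocat C
  using C by unfold_locales (simp add: face_ocat_def)

lemma cells_generated: "cells C = generated C (sub ` F)"
  using C by (simp add: face_ocat_def)

lemma sub_cell: "x \<in> F \<Longrightarrow> sub x \<in> cells C"
  unfolding cells_generated by (auto intro: generated.base)

lemma bd_sub: "x \<in> F \<Longrightarrow> fdim x = Suc k \<Longrightarrow> bd C \<alpha> k (sub x) = \<Union> (sub ` bdy \<alpha> x)"
proof -
  assume x: "x \<in> F" "fdim x = Suc k"
  have "\<forall>x\<in>F. 1 \<le> fdim x \<longrightarrow> (\<forall>\<alpha>. bd C \<alpha> (fdim x - 1) (sub x) = \<Union> (sub ` bdy \<alpha> x))"
    using C unfolding face_ocat_def by (elim conjE)
  then show ?thesis using x by force
qed

lemma cmp_Un: "composable C m X Y \<Longrightarrow> cmp C m X Y = X \<union> Y"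
  using C by (simp add: face_ocat_def composable_def)

lemma cell_F: "X \<in> cells C \<Longrightarrow> X \<subseteq> F"
proof -
  assume "X \<in> cells C"
  moreover have "cells C \<subseteq> {\<Union> (sub ` X) | X. X \<subseteq> F}" using C unfolding face_ocat_def by (elim conjE)
  ultimately obtain Y where "Y \<subseteq> F" "X = \<Union> (sub ` Y)" by blast
  then show ?thesis using sub_F by blast
qed

lemma cell_closed: "X \<in> cells C \<Longrightarrow> x \<in> X \<Longrightarrow> sub x \<subseteq> X"
proof -
  assume X: "X \<in> cells C" "x \<in> X"
  moreover have "cells C \<subseteq> {\<Union> (sub ` X) | X. X \<subseteq> F}" using C unfolding face_ocat_def by (elim conjE)
  ultimately obtain Y where Y: "Y \<subseteq> F" "X = \<Union> (sub ` Y)" by blast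
  then show "sub x \<subseteq> X" using X(2) sub_trans by blast
qed

text \<open>The unit laws, in which composition is union.\<close>

lemma bd_subset: "X \<in> cells C \<Longrightarrow> bd C \<alpha> k X \<subseteq> X"
proof -
  assume X: "X \<in> cells C"
  have "composable C k (src C k X) X" "composable C k X (tgt C k X)"
    using X by (simp_all add: composable_def bd_cell bd_bd)
  then have "src C k X \<union> X = X" "X \<union> tgt C k X = X"
    using src_unit[OF X, of k] tgt_unit[OF X, of k] by (simp_all add: cmp_Un)
  then show ?thesis by (cases \<alpha>) auto
qed

lemma bd_Un:
  assumes "composable C m X Y" "k \<noteq> m"
  shows "bd C \<alpha> k (X \<union> Y) = bd C \<alpha> k X \<union> bd C \<alpha> k Y"
  using bd_cmp[OF assms] cmp_Un[OF assms(1)] cmp_Un[OF composable_bd[OF D assms]] by simp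

lemma src_Un: "composable C m X Y \<Longrightarrow> src C m (X \<union> Y) = src C m X"
  and tgt_Un: "composable C m X Y \<Longrightarrow> tgt C m (X \<union> Y) = tgt C m Y"
  using src_cmp[of m X Y] tgt_cmp[of m X Y] cmp_Un[of m X Y] by simp_all

text \<open>A cell of small dimension is composed of atoms of small dimension, because all atoms in a composite
  are contained in it. Hence a property of the atom \<open>x\<close> may be derived from the same property of all
  cells of smaller dimension, and in particular of the boundary of \<open>x\<close>.\<close>

lemma cell_induct [consumes 1, case_names atom comp]:
  assumes X: "X \<in> cells C"
    and atom: "\<And>x. x \<in> F \<Longrightarrow> (\<And>Y. Y \<in> cells C \<Longrightarrow> (\<And>y. y \<in> Y \<Longrightarrow> fdim y < fdim x) \<Longrightarrow> P Y) \<Longrightarrow> P (sub x)"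
    and comp: "\<And>m A B. composable C m A B \<Longrightarrow> P A \<Longrightarrow> P B \<Longrightarrow> P (A \<union> B)"
  shows "P X"
proof -
  have bounded: "Y \<in> generated C (sub ` F) \<Longrightarrow> \<forall>y\<in>Y. fdim y < d \<Longrightarrow> P Y" for d Y
  proof (induction d arbitrary: Y rule: less_induct)
    case (less d)
    show ?case using less.prems
    proof (induction rule: generated.induct)
      case (base Y)
      then obtain x where x: "x \<in> F" "Y = sub x" by blast
      then have "fdim x < d" using base.prems sub_refl by blast
      show ?case unfolding x(2)
      proof (rule atom[OF x(1)])
        fix Y assume "Y \<in> cells C" "\<And>y. y \<in> Y \<Longrightarrow> fdim y < fdim x"
        then show "P Y" using less.IH[OF \<open>fdim x < d\<close>, of Y] cells_generated by simp
      qed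
    next
      case (comp A B m)
      then show ?case using assms(3) by (simp add: cmp_Un)
    qed
  qed
  have "X \<in> generated C (sub ` F)" using X cells_generated by simp
  then show ?thesis
  proof (induction rule: generated.induct)
    case (base Y)
    then obtain x where x: "x \<in> F" "Y = sub x" by blast
    show ?case unfolding x(2)
    proof (rule atom[OF x(1)])
      fix Y assume "Y \<in> cells C" "\<And>y. y \<in> Y \<Longrightarrow> fdim y < fdim x"
      then show "P Y" using bounded[of Y "fdim x"] cells_generated by simp
    qed
  next
    case (comp A B m)
    then show ?case using assms(3) by (simp add: cmp_Un)
  qed
qed

text \<open>The characterisation fixes the boundary of \<open>R(x)\<close> in codimension one only. If the source or target
  \<open>Y\<close> of \<open>R(x)\<close> in dimension \<open>fdim x\<close> were different from \<open>R(x)\<close>, it would not contain \<open>x\<close> and so it would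
  be composed of faces of smaller dimension. It would then be equal to its own source and target in
  dimension \<open>fdim x - 1\<close>, which would make \<open>R(s\<^sub>x)\<close> and \<open>R(t\<^sub>x)\<close> equal.\<close>

lemma flat_sub: "x \<in> F \<Longrightarrow> flat (fdim x) (sub x)"
proof (induction "fdim x" arbitrary: x rule: less_induct)
  case less
  have low: "flat k Y" if "Y \<in> generated C (sub ` F)" "\<forall>y\<in>Y. fdim y \<le> k" "k < fdim x" for Y k
    using that
  proof (induction rule: generated.induct)
    case (base Y)
    then obtain y where y: "y \<in> F" "Y = sub y" by blast
    then have "fdim y \<le> k" using base.prems sub_refl by blast
    then show ?case using flat_mono[OF less.hyps[OF _ y(1)]] y(2) base.prems by simp
  next
    case (comp A B m)
    then show ?case using flat_cmp[OF comp.hyps(3)] by (simp add: cmp_Un)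
  qed
  have "bd C \<alpha> (fdim x) (sub x) = sub x" for \<alpha>
  proof (rule ccontr)
    let ?Y = "bd C \<alpha> (fdim x) (sub x)"
    assume "?Y \<noteq> sub x"
    have Y: "?Y \<in> cells C" using sub_cell[OF less.prems] by (rule bd_cell)
    have Ysub: "?Y \<subseteq> sub x" by (rule bd_subset[OF sub_cell[OF less.prems]])
    have x: "x \<notin> ?Y" using cell_closed[OF Y, of x] Ysub \<open>?Y \<noteq> sub x\<close> by blast
    have dims: "fdim y < fdim x" if "y \<in> ?Y" for y
      using that sub_dim[OF less.prems] Ysub x by blast
    have gY: "?Y \<in> generated C (sub ` F)" using Y cells_generated by simp
    have ne: "Z \<noteq> {}" if "Z \<in> generated C (sub ` F)" for Z
      using that by (induction rule: generated.induct) (use sub_refl in \<open>auto simp: cmp_Un\<close>)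
    then obtain y where y: "y \<in> ?Y" using gY by blast
    obtain k where k: "fdim x = Suc k" using dims[OF y] by (cases "fdim x") auto
    have "flat k ?Y" using low[OF gY, of k] dims k by fastforce
    then have "src C k ?Y = tgt C k ?Y" by (simp add: flat_eq)
    then have "src C k (sub x) = tgt C k (sub x)"
      using bd_bd[OF sub_cell[OF less.prems]] k by simp
    then have e: "\<Union> (sub ` bdy Minus x) = \<Union> (sub ` bdy Plus x)"
      using bd_sub[OF less.prems k] by simp
    obtain z where z: "z \<in> bdy Plus x" "z \<notin> bdy Minus x" using bdy_ne[OF less.prems] k by auto
    have zF: "z \<in> F" "Suc (fdim z) = fdim x" using bdy_sub[OF less.prems z(1)] sub_F[OF less.prems] k by auto
    then obtain w where w: "w \<in> bdy Minus x" "z \<in> sub w" using e z(1) sub_refl[OF zF(1)] by blast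
    have "w \<in> F" "Suc (fdim w) = fdim x" using bdy_sub[OF less.prems w(1)] sub_F[OF less.prems] k by auto
    then have "z = w" using sub_dim[of w z] w(2) zF(2) by fastforce
    then show False using z(2) w(1) by simp
  qed
  then show ?case using sub_cell[OF less.prems] by (simp add: flat_def)
qed

lemma flatI: "X \<in> cells C \<Longrightarrow> \<forall>x\<in>X. fdim x \<le> k \<Longrightarrow> flat k X"
proof (induction rule: cell_induct)
  case (atom x)
  then have "fdim x \<le> k" using sub_refl[OF atom.hyps] by blast
  then show ?case by (rule flat_mono[OF flat_sub[OF atom.hyps]])
next
  case (comp m A B)
  then have "flat k A" "flat k B" by simp_all
  then show ?case using flat_cmp[OF comp.hyps] cmp_Un[OF comp.hyps] by simp
qed

text \<open>Lower boundaries of an atom are boundaries of a cell of smaller dimension; this is how \<open>cell_induct\<close>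
  is applied.\<close>

lemma bd_atom_low:
  assumes "x \<in> F" "k < l" "fdim x = Suc l"
  shows "bd C \<alpha> k (sub x) = bd C \<alpha> k (bd C \<beta> l (sub x))" "bd C \<beta> l (sub x) \<in> cells C"
    "y \<in> bd C \<beta> l (sub x) \<Longrightarrow> fdim y < fdim x"
proof -
  show "bd C \<alpha> k (sub x) = bd C \<alpha> k (bd C \<beta> l (sub x))" "bd C \<beta> l (sub x) \<in> cells C"
    using bd_bd bd_cell sub_cell assms by simp_all
  assume "y \<in> bd C \<beta> l (sub x)"
  then obtain z where z: "z \<in> bdy \<beta> x" "y \<in> sub z" unfolding bd_sub[OF assms(1,3)] by blast
  have "z \<in> F" "Suc (fdim z) = fdim x" using bdy_sub[OF assms(1) z(1)] sub_F[OF assms(1)] assms(3) by auto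
  then show "fdim y < fdim x" using sub_dim[of z y] z(2) by fastforce
qed

lemma bd_dim: "X \<in> cells C \<Longrightarrow> y \<in> bd C \<alpha> k X \<Longrightarrow> fdim y \<le> k"
proof (induction arbitrary: y rule: cell_induct)
  case (atom x)
  consider "fdim x \<le> k" | "fdim x = Suc k" | l where "k < l" "fdim x = Suc l"
    by (cases "fdim x") (simp, metis le_less_linear less_Suc_eq_le nat_less_le not_less_eq_eq)
  then show ?case
  proof cases
    case 1
    then have "bd C \<alpha> k (sub x) = sub x" using flat_eq[OF flat_mono[OF flat_sub[OF atom.hyps]]] by simp
    then have "y \<in> sub x" using atom.prems by simp
    then show ?thesis using 1 sub_dim[OF atom.hyps, of y] by (cases "y = x") auto
  next
    case 2
    then obtain z where z: "z \<in> bdy \<alpha> x" "y \<in> sub z" using atom.prems bd_sub[OF atom.hyps] by auto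
    have "z \<in> F" "Suc (fdim z) = fdim x" using bdy_sub[OF atom.hyps z(1)] sub_F[OF atom.hyps] 2 by auto
    then show ?thesis using sub_dim[of z y] z(2) 2 by (cases "y = z") auto
  next
    case 3
    note l = bd_atom_low[OF atom.hyps 3, where \<beta> = Plus]
    have "y \<in> bd C \<alpha> k (bd C Plus l (sub x))" using atom.prems l(1) by metis
    then show ?thesis using atom.IH[OF l(2) l(3)] by blast
  qed
next
  case (comp m A B)
  show ?case
  proof (cases "k = m")
    case True
    then show ?thesis using comp.IH comp.prems src_Un[OF comp.hyps] tgt_Un[OF comp.hyps]
      by (cases \<alpha>) simp_all
  next
    case False
    then have "y \<in> bd C \<alpha> k A \<union> bd C \<alpha> k B" using comp.prems bd_Un[OF comp.hyps] by simp
    then show ?thesis using comp.IH by blast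
  qed
qed

lemma flat_dim: "flat k X \<Longrightarrow> x \<in> X \<Longrightarrow> fdim x \<le> k"
  using bd_dim[OF flat_cell, of k X x Plus k] by (simp add: flat_eq)

end

section \<open>Simplices\<close>

lemma sorted_wrt_subseq: "subseq v w \<Longrightarrow> sorted_wrt P w \<Longrightarrow> sorted_wrt P v \<and> set v \<subseteq> set w"
  by (induction rule: list_emb.induct) auto

lemma simplex_sub_iff:
  assumes "sorted_wrt (<) w"
  shows "v \<in> simplex_sub w \<longleftrightarrow> v \<noteq> [] \<and> sorted_wrt (<) v \<and> set v \<subseteq> set w"
proof
  assume "v \<in> simplex_sub w"
  then have v: "v \<noteq> []" "subseq v w" by (auto simp: simplex_sub_def)
  then show "v \<noteq> [] \<and> sorted_wrt (<) v \<and> set v \<subseteq> set w"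
    using assms sorted_wrt_subseq by blast
next
  assume "v \<noteq> [] \<and> sorted_wrt (<) v \<and> set v \<subseteq> set w"
  then show "v \<in> simplex_sub w"
    using sorted_subset_imp_subseq[of v w] strict_sorted_imp_sorted[OF assms] by (simp add: simplex_sub_def)
qed

lemma face_list: "x \<in> simplex_faces n \<longleftrightarrow> x \<noteq> [] \<and> sorted_wrt (<) x \<and> set x \<subseteq> {0..n}"
  by (auto simp: simplex_faces_def)

lemma simplex_bdy_iff:
  "z \<in> simplex_bdy \<alpha> x \<longleftrightarrow> (\<exists>j<length x. z = take j x @ drop (Suc j) x \<and>
     (case \<alpha> of Minus \<Rightarrow> even j | Plus \<Rightarrow> odd j))"
proof
  assume "z \<in> simplex_bdy \<alpha> x"
  then obtain i where "i \<in> {1..length x}" "z = take (i - 1) x @ drop i x"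
    "case \<alpha> of Minus \<Rightarrow> odd i | Plus \<Rightarrow> even i" by (auto simp: simplex_bdy_def)
  then show "\<exists>j<length x. z = take j x @ drop (Suc j) x \<and> (case \<alpha> of Minus \<Rightarrow> even j | Plus \<Rightarrow> odd j)"
    by (intro exI[of _ "i - 1"]) (auto split: sign.splits)
next
  assume "\<exists>j<length x. z = take j x @ drop (Suc j) x \<and> (case \<alpha> of Minus \<Rightarrow> even j | Plus \<Rightarrow> odd j)"
  then obtain j where "j < length x" "z = take j x @ drop (Suc j) x"
    "case \<alpha> of Minus \<Rightarrow> even j | Plus \<Rightarrow> odd j" by blast
  then show "z \<in> simplex_bdy \<alpha> x"
    unfolding simplex_bdy_def mem_Collect_eq
    by (intro exI[of _ "Suc j"]) (auto split: sign.splits)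
qed

lemma delete_nth:
  fixes x :: "nat list"
  assumes "sorted_wrt (<) x" "j < length x"
  shows "sorted_wrt (<) (take j x @ drop (Suc j) x)"
    "set (take j x @ drop (Suc j) x) = set x - {x ! j}"
    "Suc (length (take j x @ drop (Suc j) x)) = length x"
proof -
  have x: "x = take j x @ x ! j # drop (Suc j) x" using assms(2) by (rule id_take_nth_drop)
  have "sorted_wrt (<) (take j x @ x ! j # drop (Suc j) x)" using assms(1) x by simp
  then have s: "sorted_wrt (<) (take j x @ drop (Suc j) x)" "x ! j \<notin> set (take j x @ drop (Suc j) x)"
    by (auto simp: sorted_wrt_append)
  have "set x = insert (x ! j) (set (take j x @ drop (Suc j) x))" by (subst x) auto
  then show "set (take j x @ drop (Suc j) x) = set x - {x ! j}" using s(2) by blast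
  show "sorted_wrt (<) (take j x @ drop (Suc j) x)" by (rule s(1))
  show "Suc (length (take j x @ drop (Suc j) x)) = length x" using assms(2) by simp
qed

lemma strict_sorted_eqI:
  fixes x :: "nat list"
  shows "sorted_wrt (<) x \<Longrightarrow> sorted_wrt (<) y \<Longrightarrow> set x = set y \<Longrightarrow> x = y"
  by (simp add: strict_sorted_iff sorted_distinct_set_unique)

lemma simplex_face_complex:
  assumes "is_simplex n \<Delta>"
  shows "face_complex (simplex_faces n) simplex_sub simplex_dim simplex_bdy \<Delta>"
proof
  show "face_ocat (simplex_faces n) simplex_sub simplex_dim simplex_bdy \<Delta>"
    using assms by (simp add: is_simplex_def)
  fix x assume x: "x \<in> simplex_faces n"
  then have sx: "sorted_wrt (<) x" "x \<noteq> []" by (simp_all add: face_list)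
  note sub = simplex_sub_iff[OF sx(1)]
  show "x \<in> simplex_sub x" using sx by (simp add: sub)
  show "simplex_sub x \<subseteq> simplex_faces n" using x by (simp add: subset_iff sub face_list)
  show "simplex_sub y \<subseteq> simplex_sub x" if "y \<in> simplex_sub x" for y
  proof
    fix z assume z: "z \<in> simplex_sub y"
    have y: "sorted_wrt (<) y" "set y \<subseteq> set x" using that by (simp_all add: sub)
    show "z \<in> simplex_sub x" using z y(2) unfolding sub simplex_sub_iff[OF y(1)] by blast
  qed
  show "simplex_dim y < simplex_dim x" if "y \<in> simplex_sub x" "y \<noteq> x" for y
  proof -
    have y: "sorted_wrt (<) y" "set y \<subseteq> set x" "y \<noteq> []" using that by (simp_all add: sub)
    then have "set y \<subset> set x" using strict_sorted_eqI[OF y(1) sx(1)] that(2) by blast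
    then have "card (set y) < card (set x)" by (intro psubset_card_mono) simp_all
    moreover have "card (set y) = length y" "card (set x) = length x"
      using y(1) sx(1) by (simp_all add: distinct_card strict_sorted_iff)
    moreover have "0 < length y" using y(3) by simp
    ultimately show ?thesis unfolding simplex_dim_def by linarith
  qed
  show "y \<in> simplex_sub x \<and> Suc (simplex_dim y) = simplex_dim x" if "y \<in> simplex_bdy \<alpha> x" "0 < simplex_dim x" for y \<alpha>
  proof -
    have "\<exists>j<length x. y = take j x @ drop (Suc j) x" using that(1) unfolding simplex_bdy_iff by blast
    then obtain j where j: "j < length x" "y = take j x @ drop (Suc j) x" by blast
    have d: "sorted_wrt (<) y" "set y \<subseteq> set x" "Suc (length y) = length x"
      using delete_nth[OF sx(1) j(1)] unfolding j(2) by blast+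
    have l: "1 < length x" using that(2) by (simp add: simplex_dim_def)
    have "y \<noteq> []" using d(3) l by fastforce
    then have "y \<in> simplex_sub x" unfolding sub using d(1,2) by blast
    moreover have "Suc (simplex_dim y) = simplex_dim x" using d(3) l by (simp add: simplex_dim_def)
    ultimately show ?thesis ..
  qed
  show "\<exists>\<alpha>. \<exists>z\<in>simplex_bdy \<alpha> x. y \<in> simplex_sub z" if "y \<in> simplex_sub x" "y \<noteq> x" for y
  proof -
    have y: "sorted_wrt (<) y" "set y \<subseteq> set x" "y \<noteq> []" using that by (simp_all add: sub)
    have "set y \<noteq> set x" using strict_sorted_eqI[OF y(1) sx(1)] that(2) by blast
    then obtain v where v: "v \<in> set x" "v \<notin> set y" using y(2) by blast
    then obtain j where j: "j < length x" "x ! j = v" by (meson in_set_conv_nth)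
    note d = delete_nth[OF sx(1) j(1)]
    have "y \<in> simplex_sub (take j x @ drop (Suc j) x)"
      unfolding simplex_sub_iff[OF d(1)] d(2) using y v j(2) by blast
    moreover have "take j x @ drop (Suc j) x \<in> simplex_bdy (if even j then Minus else Plus) x"
      unfolding simplex_bdy_iff using j(1) by (intro exI[of _ j]) simp
    ultimately show ?thesis by blast
  qed
  show "\<exists>z\<in>simplex_bdy Plus x. z \<notin> simplex_bdy Minus x" if "0 < simplex_dim x"
  proof -
    have l: "1 < length x" using that by (simp add: simplex_dim_def)
    let ?z = "take 1 x @ drop (Suc 1) x"
    have "?z \<notin> simplex_bdy Minus x"
    proof
      assume "?z \<in> simplex_bdy Minus x"
      then obtain j where j: "j < length x" "?z = take j x @ drop (Suc j) x" "even j"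
        unfolding simplex_bdy_iff sign.case by blast
      have "set x - {x ! 1} = set x - {x ! j}"
        using arg_cong[OF j(2), of set] delete_nth(2)[OF sx(1) l] delete_nth(2)[OF sx(1) j(1)] by argo
      then have "x ! 1 = x ! j" using l j(1) by (metis Diff_iff insertI1 nth_mem singletonD)
      then have "j = 1" using l j(1) sx(1) by (simp add: nth_eq_iff_index_eq strict_sorted_iff)
      then show False using j(3) by simp
    qed
    moreover have "?z \<in> simplex_bdy Plus x"
      unfolding simplex_bdy_iff using l by (intro exI[of _ 1]) simp
    ultimately show ?thesis by blast
  qed
qed

section \<open>The Gray order and monotone retractions of simplices\<close>

text \<open>On the faces of a simplex this is the order of the reflected Gray code: faces are compared at the
  smallest vertex that belongs to only one of them, and the face that contains it is the larger one
  iff the number of smaller vertices is even. Hence the deletion of an entry in odd position makes a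
  face smaller and that of an entry in even position makes it larger. With base 3 instead of 2 the
  weight of a vertex is strictly larger than that of all later vertices together.\<close>

primrec gray :: "nat list \<Rightarrow> real" where
  "gray [] = 0"
| "gray (v # x) = (1/3) ^ v - gray x"

lemma gray_bounds:
  "sorted_wrt (<) x \<Longrightarrow> \<forall>u\<in>set x. v \<le> u \<Longrightarrow> 0 \<le> gray x \<and> gray x \<le> (1/3) ^ v"
proof (induction x arbitrary: v)
  case (Cons y x)
  have "0 \<le> gray x \<and> gray x \<le> (1/3) ^ Suc y" using Cons.prems by (intro Cons.IH) auto
  moreover have "(1/3::real) ^ y \<le> (1/3) ^ v" using Cons.prems(2) by (intro power_decreasing) auto
  moreover have "(0::real) \<le> (1/3) ^ y" "(1/3::real) ^ Suc y = (1/3) ^ y / 3" by simp_all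
  ultimately show ?case unfolding gray.simps by linarith
qed simp

lemma gray_Cons_lower: "sorted_wrt (<) (v # x) \<Longrightarrow> 2 / 3 * (1/3) ^ v \<le> gray (v # x)"
  using gray_bounds[of x "Suc v"] by (simp add: Suc_le_eq)

lemma gray_less:
  assumes "sorted_wrt (<) (v # x)" "sorted_wrt (<) y" "\<forall>u\<in>set y. v < u"
  shows "gray y < gray (v # x)"
proof -
  have "gray y \<le> (1/3) ^ Suc v" using gray_bounds[of y "Suc v"] assms(2,3) by (simp add: Suc_le_eq)
  also have "\<dots> < 2 / 3 * (1/3) ^ v" by simp
  finally show ?thesis using gray_Cons_lower[OF assms(1)] by linarith
qed

lemma gray_inj: "sorted_wrt (<) x \<Longrightarrow> sorted_wrt (<) y \<Longrightarrow> gray x = gray y \<Longrightarrow> x = y"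
proof (induction x arbitrary: y)
  case Nil
  show ?case
  proof (cases y)
    case (Cons w z)
    then show ?thesis using gray_less[of w z "[]"] Nil by simp
  qed simp
next
  case (Cons v x)
  show ?case
  proof (cases y)
    case Nil
    then show ?thesis using gray_less[of v x "[]"] Cons.prems by simp
  next
    case c: (Cons w z)
    consider "v < w" | "v = w" | "w < v" by linarith
    then show ?thesis
    proof cases
      case 1
      then have "gray y < gray (v # x)" using Cons.prems c by (intro gray_less) auto
      then show ?thesis using Cons.prems by simp
    next
      case 2
      then have "x = z" using Cons.prems c by (intro Cons.IH) auto
      then show ?thesis using c 2 by simp
    next
      case 3
      then have "gray (v # x) < gray (w # z)" using Cons.prems c by (intro gray_less) auto
      then show ?thesis using Cons.prems c by simp
    qed
  qed
qed

lemma gray_append: "gray (p @ x) - gray (p @ y) = (-1) ^ length p * (gray x - gray y)"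
  by (induction p) (simp_all add: algebra_simps)

definition retract :: "(nat \<Rightarrow> nat) \<Rightarrow> nat list \<Rightarrow> nat list" where
  "retract \<rho> x = sorted_list_of_set (\<rho> ` set x)"

lemma retract: "sorted_wrt (<) (retract \<rho> x)" "set (retract \<rho> x) = \<rho> ` set x" "retract \<rho> x = [] \<longleftrightarrow> x = []"
  by (simp_all add: retract_def)

lemma retract_eqI: "sorted_wrt (<) y \<Longrightarrow> \<rho> ` set x = set y \<Longrightarrow> retract \<rho> x = y"
  by (rule strict_sorted_eqI[OF retract(1)]) (simp_all add: retract(2))

lemma length_strict: "sorted_wrt (<) (x :: nat list) \<Longrightarrow> length x = card (set x)"
  by (simp add: distinct_card strict_sorted_iff)

lemma length_retract: "length (retract \<rho> x) \<le> length x"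
proof -
  have "length (retract \<rho> x) = card (\<rho> ` set x)" using length_strict[OF retract(1)] by (simp add: retract(2))
  also have "\<dots> \<le> length x" by (meson card_image_le card_length finite_set le_trans)
  finally show ?thesis .
qed

lemma retract_face:
  assumes "\<rho> ` {0..n} \<subseteq> {0..n}" "x \<in> simplex_faces n"
  shows "retract \<rho> x \<in> simplex_faces n"
proof -
  have "x \<noteq> []" "set x \<subseteq> {0..n}" using assms(2) by (simp_all add: face_list)
  then have "\<rho> ` set x \<subseteq> {0..n}" using assms(1) by (meson image_mono order_trans)
  then show ?thesis using \<open>x \<noteq> []\<close> retract by (simp add: face_list)
qed

lemma retract_sub:
  assumes x: "sorted_wrt (<) x"
  shows "retract \<rho> ` simplex_sub x = simplex_sub (retract \<rho> x)"
proof
  show "retract \<rho> ` simplex_sub x \<subseteq> simplex_sub (retract \<rho> x)"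
  proof (rule image_subsetI)
    fix v assume "v \<in> simplex_sub x"
    then have "v \<noteq> []" "set v \<subseteq> set x" by (simp_all add: simplex_sub_iff[OF x])
    then show "retract \<rho> v \<in> simplex_sub (retract \<rho> x)"
      unfolding simplex_sub_iff[OF retract(1)] retract using retract(1) by blast
  qed
  show "simplex_sub (retract \<rho> x) \<subseteq> retract \<rho> ` simplex_sub x"
  proof
    fix w assume "w \<in> simplex_sub (retract \<rho> x)"
    then have w: "w \<noteq> []" "sorted_wrt (<) w" "set w \<subseteq> \<rho> ` set x"
      by (simp_all add: simplex_sub_iff[OF retract(1)] retract(2))
    define v where "v = sorted_list_of_set {u \<in> set x. \<rho> u \<in> set w}"
    have v: "sorted_wrt (<) v" "set v = {u \<in> set x. \<rho> u \<in> set w}" by (simp_all add: v_def)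
    have img: "\<rho> ` set v = set w" unfolding v(2) using w(3) by blast
    then have "retract \<rho> v = w" by (rule retract_eqI[OF w(2)])
    moreover have "v \<noteq> []" using img w(1) by auto
    then have "v \<in> simplex_sub x" unfolding simplex_sub_iff[OF x] using v by blast
    ultimately show "w \<in> retract \<rho> ` simplex_sub x" by blast
  qed
qed

lemma merged_neighbours:
  assumes x: "sorted_wrt (<) (x :: nat list)" and mono: "mono \<rho>" and "\<not> inj_on \<rho> (set x)"
  obtains j where "Suc j < length x" "\<rho> (x ! j) = (\<rho> (x ! Suc j) :: nat)"
proof -
  have "\<exists>j. Suc j < length x \<and> \<rho> (x ! j) = \<rho> (x ! Suc j)"
  proof (rule ccontr)
    assume no: "\<not> ?thesis"
    have "map \<rho> x ! j < map \<rho> x ! Suc j" if "Suc j < length (map \<rho> x)" for j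
    proof -
      have "x ! j \<le> x ! Suc j" using x that by (simp add: sorted_wrt_iff_nth_less less_imp_le)
      then have "\<rho> (x ! j) \<le> \<rho> (x ! Suc j)" using mono by (rule monoD[rotated])
      then show ?thesis using no that by (simp add: order.order_iff_strict)
    qed
    then have "sorted_wrt (<) (map \<rho> x)" by (simp add: sorted_wrt_iff_nth_Suc_transp)
    then show False using assms(3) by (simp add: strict_sorted_iff distinct_map)
  qed
  then show ?thesis using that by blast
qed

lemma simplex_bdy_image:
  "simplex_bdy \<alpha> x = (\<lambda>j. take j x @ drop (Suc j) x) `
     {j. j < length x \<and> (case \<alpha> of Minus \<Rightarrow> even j | Plus \<Rightarrow> odd j)}"
  unfolding set_eq_iff simplex_bdy_iff image_iff by blast

text \<open>If \<open>\<rho>\<close> is injective on the vertices of \<open>x\<close>, deletions commute with \<open>\<rho>\<close>. Otherwise it identifies two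
  neighbouring vertices, one in odd and one in even position. So both the source and the target of \<open>x\<close>
  contain a face with the same image as \<open>x\<close>, as they must because this image is degenerate.\<close>

lemma retract_bdy:
  assumes S: "is_simplex n \<Delta>" and mono: "mono \<rho>" and im: "\<rho> ` {0..n} \<subseteq> {0..n}"
    and x: "x \<in> simplex_faces n" "simplex_dim x = Suc k"
  shows "retract \<rho> ` bd \<Delta> \<alpha> k (simplex_sub x) = bd \<Delta> \<alpha> k (simplex_sub (retract \<rho> x))"
proof -
  interpret face_complex "simplex_faces n" simplex_sub simplex_dim simplex_bdy \<Delta>
    by (rule simplex_face_complex[OF S])
  have sx: "sorted_wrt (<) x" using x(1) by (simp add: face_list)
  have len: "length x = Suc (Suc k)" using x(2) unfolding simplex_dim_def by linarith
  have rx: "retract \<rho> x \<in> simplex_faces n" by (rule retract_face[OF im x(1)])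
  have z: "sorted_wrt (<) z" "set z \<subseteq> set x" if "z \<in> simplex_bdy \<alpha> x" for z
  proof -
    have "z \<in> simplex_sub x" using bdy_sub[OF x(1) that] x(2) by simp
    then show "sorted_wrt (<) z" "set z \<subseteq> set x" by (simp_all add: simplex_sub_iff[OF sx(1)])
  qed
  have "retract \<rho> ` bd \<Delta> \<alpha> k (simplex_sub x) = (\<Union>z\<in>simplex_bdy \<alpha> x. retract \<rho> ` simplex_sub z)"
    unfolding bd_sub[OF x] by blast
  also have "\<dots> = (\<Union>z\<in>simplex_bdy \<alpha> x. simplex_sub (retract \<rho> z))"
    using retract_sub z(1) by simp
  also have "\<dots> = bd \<Delta> \<alpha> k (simplex_sub (retract \<rho> x))"
  proof (cases "inj_on \<rho> (set x)")
    case True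
    have r: "retract \<rho> y = map \<rho> y" if "sorted_wrt (<) y" "set y \<subseteq> set x" for y
    proof (rule retract_eqI)
      have "sorted (map \<rho> y)" using that(1) mono
        unfolding sorted_map by (intro sorted_wrt_mono_rel[OF _ that(1)]) (simp add: monoD)
      moreover have "distinct (map \<rho> y)" using that(1) inj_on_subset[OF True that(2)]
        by (simp add: distinct_map strict_sorted_iff)
      ultimately show "sorted_wrt (<) (map \<rho> y)" by (simp add: strict_sorted_iff)
    qed simp
    have rr: "retract \<rho> x = map \<rho> x" using r[OF sx(1)] by simp
    have "simplex_bdy \<alpha> (map \<rho> x) = map \<rho> ` simplex_bdy \<alpha> x"
      by (simp add: simplex_bdy_image image_image take_map drop_map)
    also have "\<dots> = retract \<rho> ` simplex_bdy \<alpha> x" by (rule image_cong[OF refl]) (simp add: r z)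
    finally have "simplex_bdy \<alpha> (retract \<rho> x) = retract \<rho> ` simplex_bdy \<alpha> x" using rr by simp
    moreover have "simplex_dim (retract \<rho> x) = Suc k" using rr len by (simp add: simplex_dim_def)
    ultimately show ?thesis by (simp add: bd_sub[OF rx] image_image)
  next
    case False
    obtain j where j: "Suc j < length x" "\<rho> (x ! j) = \<rho> (x ! Suc j)"
      using merged_neighbours[OF sx(1) mono False] .
    have "length (retract \<rho> x) = card (\<rho> ` set x)" using length_strict[OF retract(1)] by (simp add: retract(2))
    also have "\<dots> < card (set x)"
      using False card_image_le[of "set x" \<rho>] eq_card_imp_inj_on[of "set x" \<rho>] by (simp add: order.order_iff_strict) blast
    also have "\<dots> = Suc (Suc k)" using length_strict[OF sx(1)] len by simp
    finally have "simplex_dim (retract \<rho> x) \<le> k" by (simp add: simplex_dim_def)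
    then have flat: "bd \<Delta> \<alpha> k (simplex_sub (retract \<rho> x)) = simplex_sub (retract \<rho> x)"
      by (intro flat_eq flat_mono[OF flat_sub[OF rx]])
    \<comment> \<open>\<open>i\<close> is the one of the two indices with the parity that belongs to \<open>\<alpha>\<close>\<close>
    define i i' where "i = (if (case \<alpha> of Minus \<Rightarrow> even j | Plus \<Rightarrow> odd j) then j else Suc j)"
      and "i' = (if (case \<alpha> of Minus \<Rightarrow> even j | Plus \<Rightarrow> odd j) then Suc j else j)"
    have i: "i < length x" "i' < length x" "i \<noteq> i'" "\<rho> (x ! i) = \<rho> (x ! i')"
      "case \<alpha> of Minus \<Rightarrow> even i | Plus \<Rightarrow> odd i"
      using j by (cases \<alpha>; cases "even j"; simp add: i_def i'_def)+
    let ?z = "take i x @ drop (Suc i) x"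
    have zb: "?z \<in> simplex_bdy \<alpha> x" unfolding simplex_bdy_iff using i by blast
    have "x ! i \<noteq> x ! i'" using i sx(1) by (simp add: nth_eq_iff_index_eq strict_sorted_iff)
    then have "x ! i' \<in> set ?z" unfolding delete_nth(2)[OF sx(1) i(1)] using i(2) by simp
    then have "\<rho> (x ! i) \<in> \<rho> ` set ?z" unfolding i(4) by blast
    then have "insert (\<rho> (x ! i)) (\<rho> ` set ?z) = \<rho> ` set ?z" by blast
    moreover have "insert (x ! i) (set ?z) = set x"
      unfolding delete_nth(2)[OF sx(1) i(1)] using i(1) by auto
    ultimately have "\<rho> ` set ?z = \<rho> ` set x" by (metis image_insert)
    then have "retract \<rho> ?z = retract \<rho> x" by (simp add: retract_def)
    then have "simplex_sub (retract \<rho> x) \<subseteq> (\<Union>z\<in>simplex_bdy \<alpha> x. simplex_sub (retract \<rho> z))"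
      using zb by auto
    moreover have "simplex_sub (retract \<rho> z) \<subseteq> simplex_sub (retract \<rho> x)" if "z \<in> simplex_bdy \<alpha> x" for z
      using z(2)[OF that] unfolding subset_iff simplex_sub_iff[OF retract(1)] retract(2) by blast
    ultimately show ?thesis unfolding flat by blast
  qed
  finally show ?thesis .
qed

lemma retract_functor:
  assumes S: "is_simplex n \<Delta>" and mono: "mono \<rho>" and im: "\<rho> ` {0..n} \<subseteq> {0..n}" and X: "X \<in> cells \<Delta>"
  shows "retract \<rho> ` X \<in> cells \<Delta> \<and> (\<forall>\<alpha> k. retract \<rho> ` bd \<Delta> \<alpha> k X = bd \<Delta> \<alpha> k (retract \<rho> ` X))"
proof -
  interpret face_complex "simplex_faces n" simplex_sub simplex_dim simplex_bdy \<Delta>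
    by (rule simplex_face_complex[OF S])
  show ?thesis using X
  proof (induction rule: cell_induct)
    case (atom x)
    have sx: "sorted_wrt (<) x" using atom by (simp add: face_list)
    have rx: "retract \<rho> x \<in> simplex_faces n" by (rule retract_face[OF im atom.hyps])
    note rs = retract_sub[OF sx]
    have "retract \<rho> ` bd \<Delta> \<alpha> k (simplex_sub x) = bd \<Delta> \<alpha> k (simplex_sub (retract \<rho> x))" for \<alpha> k
    proof -
      consider "simplex_dim x \<le> k" | "simplex_dim x = Suc k" | l where "k < l" "simplex_dim x = Suc l"
        by (cases "simplex_dim x") (simp, metis le_less_linear less_Suc_eq_le nat_less_le not_less_eq_eq)
      then show ?thesis
      proof cases
        case 1
        moreover have "simplex_dim (retract \<rho> x) \<le> simplex_dim x"
          using length_retract[of \<rho> x] by (simp add: simplex_dim_def)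
        ultimately show ?thesis
          using flat_eq[OF flat_mono[OF flat_sub[OF atom.hyps]]] flat_eq[OF flat_mono[OF flat_sub[OF rx]]] rs by simp
      next
        case 2
        show ?thesis by (rule retract_bdy[OF S mono im atom.hyps 2])
      next
        case 3
        note l = bd_atom_low[OF atom.hyps 3, where \<beta> = Plus]
        have "retract \<rho> ` bd \<Delta> \<alpha> k (bd \<Delta> Plus l (simplex_sub x)) = bd \<Delta> \<alpha> k (retract \<rho> ` bd \<Delta> Plus l (simplex_sub x))"
          using atom.IH[OF l(2) l(3)] by blast
        also have "\<dots> = bd \<Delta> \<alpha> k (bd \<Delta> Plus l (simplex_sub (retract \<rho> x)))"
          using retract_bdy[OF S mono im atom.hyps 3(2)] by simp
        also have "\<dots> = bd \<Delta> \<alpha> k (simplex_sub (retract \<rho> x))" using bd_bd[OF sub_cell[OF rx]] 3(1) by simp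
        finally show ?thesis using bd_bd[OF sub_cell[OF atom.hyps]] 3(1) by simp
      qed
    qed
    then show ?case using rs sub_cell[OF rx] by simp
  next
    case (comp m A B)
    let ?r = "\<lambda>X. retract \<rho> ` X"
    have AB: "?r A \<in> cells \<Delta>" "?r B \<in> cells \<Delta>" and A: "\<And>\<alpha> k. ?r (bd \<Delta> \<alpha> k A) = bd \<Delta> \<alpha> k (?r A)"
      and B: "\<And>\<alpha> k. ?r (bd \<Delta> \<alpha> k B) = bd \<Delta> \<alpha> k (?r B)"
      using comp.IH by blast+
    have c: "composable \<Delta> m (?r A) (?r B)"
      using AB A[of Plus m] B[of Minus m] composable_eq[OF comp.hyps] by (simp add: composable_def)
    have "?r (bd \<Delta> \<alpha> k (A \<union> B)) = bd \<Delta> \<alpha> k (?r A \<union> ?r B)" for \<alpha> k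
    proof (cases "k = m")
      case True
      then show ?thesis
        using src_Un[OF c] tgt_Un[OF c] src_Un[OF comp.hyps] tgt_Un[OF comp.hyps] A B by (cases \<alpha>) simp_all
    next
      case False
      show ?thesis using bd_Un[OF comp.hyps False] bd_Un[OF c False] A B by (simp add: image_Un)
    qed
    then show ?case using cmp_cell[OF c] cmp_Un[OF c] by (simp add: image_Un)
  qed
qed

text \<open>Send a number to the nearest element of \<open>H\<close> from below, if there is one, and to the least element
  of \<open>H\<close> otherwise.\<close>

lemma monotone_retraction:
  assumes "finite H" "H \<noteq> {}" "H \<subseteq> {0..n :: nat}"
  obtains \<rho> where "mono \<rho>" "\<rho> ` {0..n} \<subseteq> {0..n}" "\<And>a. a \<in> H \<Longrightarrow> \<rho> a = a" "range \<rho> \<subseteq> H"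
proof
  define \<rho> where "\<rho> u = (if \<exists>a\<in>H. a \<le> u then Max {a \<in> H. a \<le> u} else Min H)" for u
  have fin: "finite {a \<in> H. a \<le> u}" for u using assms(1) by simp
  have H: "\<rho> u \<in> H" for u
  proof (cases "\<exists>a\<in>H. a \<le> u")
    case True
    then have "Max {a \<in> H. a \<le> u} \<in> {a \<in> H. a \<le> u}" by (intro Max_in fin) blast
    then show ?thesis using True by (simp add: \<rho>_def)
  next
    case False
    then show ?thesis unfolding \<rho>_def using Min_in[OF assms(1,2)] by simp
  qed
  then show "range \<rho> \<subseteq> H" by blast
  then show "\<rho> ` {0..n} \<subseteq> {0..n}" using assms(3) by blast
  show "\<rho> a = a" if "a \<in> H" for a
  proof -
    have "Max {b \<in> H. b \<le> a} = a" using that by (intro Max_eqI fin) auto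
    then show ?thesis using that by (auto simp: \<rho>_def)
  qed
  show "mono \<rho>"
  proof
    fix u w :: nat assume "u \<le> w"
    show "\<rho> u \<le> \<rho> w"
    proof (cases "\<exists>a\<in>H. a \<le> u")
      case True
      then have "Max {a \<in> H. a \<le> u} \<le> Max {a \<in> H. a \<le> w}"
        using \<open>u \<le> w\<close> by (intro Max_mono fin) auto
      moreover have "\<exists>a\<in>H. a \<le> w" using True \<open>u \<le> w\<close> by (meson order_trans)
      ultimately show ?thesis using True by (simp add: \<rho>_def)
    next
      case False
      then have "\<rho> u = Min H" by (simp add: \<rho>_def)
      then show ?thesis using Min_le[OF assms(1) H[of w]] by simp
    qed
  qed
qed

text \<open>The boundary of \<open>y\<close> in dimension \<open>k\<close> can be tested on any of its faces \<open>h\<close> of dimension \<open>k + 1\<close>, where it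
  is the known boundary of codimension one.\<close>

lemma bd_retract:
  assumes S: "is_simplex n \<Delta>" and y: "y \<in> simplex_faces n" and h: "h \<in> simplex_faces n" "set h \<subseteq> set y"
    and k: "simplex_dim h = Suc k"
  obtains \<rho> where "\<forall>a\<in>set h. \<rho> a = a"
    "retract \<rho> ` bd \<Delta> \<alpha> k (simplex_sub y) = \<Union> (simplex_sub ` simplex_bdy \<alpha> h)"
proof -
  interpret face_complex "simplex_faces n" simplex_sub simplex_dim simplex_bdy \<Delta>
    by (rule simplex_face_complex[OF S])
  have hs: "h \<noteq> []" "sorted_wrt (<) h" "set h \<subseteq> {0..n}" using h(1) by (simp_all add: face_list)
  have sy: "sorted_wrt (<) y" using y by (simp add: face_list)
  have "set h \<noteq> {}" using hs(1) by simp
  then obtain \<rho> where \<rho>: "mono \<rho>" "\<rho> ` {0..n} \<subseteq> {0..n}" "\<And>a. a \<in> set h \<Longrightarrow> \<rho> a = a" "range \<rho> \<subseteq> set h"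
    using monotone_retraction[OF finite_set _ hs(3)] by blast
  have "\<rho> ` set y \<subseteq> set h" using \<rho>(4) by blast
  moreover have "set h \<subseteq> \<rho> ` set y"
  proof
    fix a assume "a \<in> set h"
    then show "a \<in> \<rho> ` set y" using \<rho>(3)[of a] h(2) by (intro image_eqI[of _ _ a]) auto
  qed
  ultimately have "retract \<rho> y = h" by (intro retract_eqI[OF hs(2)]) blast
  then have "retract \<rho> ` bd \<Delta> \<alpha> k (simplex_sub y) = bd \<Delta> \<alpha> k (simplex_sub h)"
    using retract_functor[OF S \<rho>(1,2) sub_cell[OF y]] retract_sub[OF sy] by simp
  then show ?thesis using that[of \<rho>] \<rho>(3) bd_sub[OF h(1) k] by simp
qed

lemma simplex_bd_ex:
  assumes S: "is_simplex n \<Delta>" and y: "y \<in> simplex_faces n" and k: "k < simplex_dim y"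
  shows "\<exists>f\<in>bd \<Delta> \<alpha> k (simplex_sub y). simplex_dim f = k"
proof -
  interpret face_complex "simplex_faces n" simplex_sub simplex_dim simplex_bdy \<Delta>
    by (rule simplex_face_complex[OF S])
  define h where "h = take (Suc (Suc k)) y"
  have len: "length h = Suc (Suc k)" using k unfolding h_def simplex_dim_def by simp
  have sub: "set h \<subseteq> set y" unfolding h_def by (rule set_take_subset)
  have hs: "sorted_wrt (<) h" using y unfolding h_def by (simp add: face_list sorted_wrt_take)
  have "h \<noteq> []" using len by auto
  moreover have "set h \<subseteq> {0..n}" using y sub unfolding face_list by (meson order_trans)
  ultimately have h: "h \<in> simplex_faces n" using hs by (simp add: face_list)
  have dim: "simplex_dim h = Suc k" using len by (simp add: simplex_dim_def)
  obtain \<rho> where \<rho>: "retract \<rho> ` bd \<Delta> \<alpha> k (simplex_sub y) = \<Union> (simplex_sub ` simplex_bdy \<alpha> h)"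
    using bd_retract[OF S y h sub dim] by metis
  \<comment> \<open>index 0 is an odd position and index 1 is an even one\<close>
  define j :: nat where "j = (if \<alpha> = Minus then 0 else 1)"
  define z where "z = take j h @ drop (Suc j) h"
  have z: "z \<in> simplex_bdy \<alpha> h"
    unfolding simplex_bdy_iff z_def using len by (intro exI[of _ j]) (cases \<alpha>; simp add: j_def)
  have zk: "simplex_dim z = k" "z \<in> simplex_faces n"
    using bdy_sub[OF h z] dim sub_F[OF h] by auto
  then obtain f where f: "f \<in> bd \<Delta> \<alpha> k (simplex_sub y)" "z = retract \<rho> f"
    using \<rho> z sub_refl[OF zk(2)] by (metis UN_I imageE)
  have "k \<le> simplex_dim f" using zk(1) length_retract[of \<rho> f] unfolding f(2) simplex_dim_def by linarith
  moreover have "simplex_dim f \<le> k" by (rule bd_dim[OF sub_cell[OF y] f(1)])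
  ultimately show ?thesis using f(1) by (intro bexI[of _ f]) simp
qed

text \<open>Let \<open>v\<close> be the smallest vertex of \<open>y\<close> that is missing in \<open>f\<close>, and retract \<open>y\<close> onto \<open>h = f \<union> {v}\<close>. Then \<open>f\<close>
  is obtained from \<open>h\<close> by the deletion of \<open>v\<close>, with the parity that belongs to \<open>\<alpha>\<close>; and \<open>v\<close> is also the
  place at which the Gray order compares \<open>f\<close> and \<open>y\<close>.\<close>

lemma simplex_bd_gray:
  assumes S: "is_simplex n \<Delta>" and y: "y \<in> simplex_faces n" and k: "k < simplex_dim y"
    and f: "f \<in> bd \<Delta> \<alpha> k (simplex_sub y)" "simplex_dim f = k"
  shows "case \<alpha> of Minus \<Rightarrow> gray f < gray y | Plus \<Rightarrow> gray y < gray f"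
proof -
  interpret face_complex "simplex_faces n" simplex_sub simplex_dim simplex_bdy \<Delta>
    by (rule simplex_face_complex[OF S])
  have sy: "sorted_wrt (<) y" "set y \<subseteq> {0..n}" using y by (simp_all add: face_list)
  have "f \<in> simplex_sub y" using bd_subset[OF sub_cell[OF y]] f(1) by blast
  then have sf: "f \<noteq> []" "sorted_wrt (<) f" "set f \<subseteq> set y" by (simp_all add: simplex_sub_iff[OF sy(1)])
  have "f \<noteq> y" using f(2) k by blast
  then have "set y - set f \<noteq> {}" using strict_sorted_eqI[OF sf(2) sy(1)] sf(3) by blast
  \<comment> \<open>the place of the first difference\<close>
  define v where "v = Min (set y - set f)"
  have "v \<in> set y - set f" unfolding v_def by (rule Min_in[OF _ \<open>set y - set f \<noteq> {}\<close>]) simp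
  moreover have "u \<in> set f" if "u \<in> set y" "u < v" for u
  proof (rule ccontr)
    assume "u \<notin> set f"
    then have "v \<le> u" unfolding v_def using that(1) by (intro Min_le) auto
    then show False using that(2) by simp
  qed
  ultimately have v: "v \<in> set y" "v \<notin> set f" "\<And>u. u \<in> set y \<Longrightarrow> u < v \<Longrightarrow> u \<in> set f" by blast+
  define h where "h = sorted_list_of_set (insert v (set f))"
  have hs: "sorted_wrt (<) h" "set h = insert v (set f)"
    unfolding h_def by (rule strict_sorted_list_of_set) (rule set_sorted_list_of_set, simp)
  have sub: "set h \<subseteq> set y" using hs(2) v(1) sf(3) by simp
  have "set h \<subseteq> {0..n}" using sub sy(2) by (rule order_trans)
  moreover have "h \<noteq> []" using hs(2) by auto
  ultimately have h: "h \<in> simplex_faces n" using hs(1) by (simp add: face_list)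
  have "length h = Suc (length f)" using v(2) by (simp add: length_strict[OF hs(1)] length_strict[OF sf(2)] hs(2))
  moreover have "0 < length f" using sf(1) by simp
  ultimately have dim: "simplex_dim h = Suc k" using f(2) unfolding simplex_dim_def by linarith
  obtain \<rho> where \<rho>: "\<forall>a\<in>set h. \<rho> a = a"
    "retract \<rho> ` bd \<Delta> \<alpha> k (simplex_sub y) = \<Union> (simplex_sub ` simplex_bdy \<alpha> h)"
    using bd_retract[OF S y h sub dim, where \<alpha> = \<alpha>] .
  have "\<rho> ` set f = set f" using \<rho>(1) hs(2) by auto
  then have "retract \<rho> f = f" by (rule retract_eqI[OF sf(2)])
  then have "f \<in> \<Union> (simplex_sub ` simplex_bdy \<alpha> h)" using f(1) \<rho>(2) by (metis imageI)
  then obtain z where z: "z \<in> simplex_bdy \<alpha> h" "f \<in> simplex_sub z" by blast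
  have "z \<in> simplex_faces n" "Suc (simplex_dim z) = Suc k" using bdy_sub[OF h z(1)] sub_F[OF h] dim by auto
  then have "f = z" using sub_dim[of z f] z(2) f(2) by fastforce
  then obtain j where j: "j < length h" "f = take j h @ drop (Suc j) h" "case \<alpha> of Minus \<Rightarrow> even j | Plus \<Rightarrow> odd j"
    using z(1) unfolding simplex_bdy_iff by blast
  have "v \<notin> set h - {h ! j}" using v(2) unfolding delete_nth(2)[OF hs(1) j(1), symmetric] j(2)[symmetric] .
  then have hv: "h ! j = v" using hs(2) by auto
  have hh: "h = take j h @ v # drop (Suc j) h" using id_take_nth_drop[OF j(1)] hv by simp
  then have "sorted_wrt (<) (take j h @ v # drop (Suc j) h)" using hs(1) by simp
  then have srt: "sorted_wrt (<) (take j h)" "\<forall>u\<in>set (take j h). u < v"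
    "sorted_wrt (<) (drop (Suc j) h)" "\<forall>u\<in>set (drop (Suc j) h). v < u"
    by (auto simp: sorted_wrt_append)
  define t where "t = filter (\<lambda>u. v < u) y"
  have t: "sorted_wrt (<) (v # t)" using sy(1) unfolding t_def by (simp add: sorted_wrt_filter)
  have "y = take j h @ v # t"
  proof (rule strict_sorted_eqI[OF sy(1)])
    show "sorted_wrt (<) (take j h @ v # t)"
      using srt(1,2) t by (auto simp: sorted_wrt_append) (meson less_trans)
    have fset: "set f = set (take j h) \<union> set (drop (Suc j) h)" using j(2) by simp
    have "u \<in> set y \<longleftrightarrow> u \<in> set (take j h @ v # t)" for u
    proof
      assume u: "u \<in> set y"
      consider "u < v" | "u = v" | "v < u" by linarith
      then show "u \<in> set (take j h @ v # t)"
      proof cases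
        case 1
        then have "u \<in> set (take j h) \<union> set (drop (Suc j) h)" using v(3)[OF u] fset by blast
        moreover have "u \<notin> set (drop (Suc j) h)" using srt(4) 1 by (meson less_asym)
        ultimately show ?thesis by simp
      next
        case 2
        then show ?thesis by simp
      next
        case 3
        then show ?thesis using u by (simp add: t_def)
      qed
    next
      assume "u \<in> set (take j h @ v # t)"
      then have "u \<in> set f \<or> u = v \<or> u \<in> set t" using fset by auto
      then show "u \<in> set y" using sf(3) v(1) by (auto simp: t_def)
    qed
    then show "set y = set (take j h @ v # t)" by blast
  qed
  then have "gray f - gray y = (-1) ^ j * (gray (drop (Suc j) h) - gray (v # t))"
    using gray_append[of "take j h" "drop (Suc j) h" "v # t"] j by simp
  moreover have "gray (drop (Suc j) h) < gray (v # t)" by (rule gray_less[OF t srt(3,4)])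
  ultimately show ?thesis using j(3) by (cases \<alpha>) simp_all
qed

section \<open>Cubes\<close>

definition init :: "letter list \<Rightarrow> letter list" where
  "init w = map (\<lambda>a. if a = Zero then Sgn Minus else a) w"

definition final :: "letter list \<Rightarrow> letter list" where
  "final w = map (\<lambda>a. if a = Zero then Sgn Plus else a) w"

definition vertex_le :: "letter list \<Rightarrow> letter list \<Rightarrow> bool" where
  "vertex_le = list_all2 (\<lambda>a b. a = b \<or> a = Sgn Minus \<and> b = Sgn Plus)"

lemma vertex_le_trans: "vertex_le u v \<Longrightarrow> vertex_le v w \<Longrightarrow> vertex_le u w"
  unfolding vertex_le_def by (rule list_all2_trans[rotated], assumption, assumption, auto)

lemma vertex_le_antisym: "vertex_le u v \<Longrightarrow> vertex_le v u \<Longrightarrow> u = v"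
  unfolding vertex_le_def by (rule list_all2_antisym[of _ _ u v]) auto

lemma cube_sub_nth: "u \<in> cube_sub w \<longleftrightarrow> length u = length w \<and> (\<forall>j<length w. u ! j = w ! j \<or> w ! j = Zero)"
  by (auto simp: cube_sub_def list_all2_conv_all_nth)

lemma cube_dim_0: "cube_dim w = 0 \<longleftrightarrow> Zero \<notin> set w"
  by (simp add: cube_dim_def count_list_0_iff)

lemma init_vertex: "cube_dim w = 0 \<Longrightarrow> init w = w" and final_vertex: "cube_dim w = 0 \<Longrightarrow> final w = w"
  unfolding cube_dim_0 init_def final_def by (auto intro!: map_idI)

lemma init_final: "vertex_le (init w) (final w)" "0 < cube_dim w \<Longrightarrow> init w \<noteq> final w"
proof -
  show "vertex_le (init w) (final w)" by (auto simp: vertex_le_def init_def final_def list_all2_conv_all_nth)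
  assume "0 < cube_dim w"
  then have "Zero \<in> set w" using cube_dim_0[of w] by (metis less_irrefl)
  then show "init w \<noteq> final w" by (induction w) (auto simp: init_def final_def)
qed

lemma sub_init_final:
  assumes "u \<in> cube_sub w"
  shows "vertex_le (init w) (init u)" "vertex_le (final u) (final w)"
proof -
  have "a = b \<or> b = Zero \<Longrightarrow> (if b = Zero then Sgn Minus else b) = (if a = Zero then Sgn Minus else a) \<or>
      (if b = Zero then Sgn Minus else b) = Sgn Minus \<and> (if a = Zero then Sgn Minus else a) = Sgn Plus" for a b
    by (cases a; cases b) (auto split: letter.splits, (metis sign.exhaust)+)
  then show "vertex_le (init w) (init u)"
    using assms by (simp add: cube_sub_nth vertex_le_def init_def list_all2_conv_all_nth)
  have "a = b \<or> b = Zero \<Longrightarrow> (if a = Zero then Sgn Plus else a) = (if b = Zero then Sgn Plus else b) \<or>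
      (if a = Zero then Sgn Plus else a) = Sgn Minus \<and> (if b = Zero then Sgn Plus else b) = Sgn Plus" for a b
    by (cases a; cases b) (auto split: letter.splits, (metis sign.exhaust)+)
  then show "vertex_le (final u) (final w)"
    using assms by (simp add: cube_sub_nth vertex_le_def final_def list_all2_conv_all_nth)
qed

text \<open>The sign that replaces the zero at index \<open>j\<close>, in terms of the number of zeros before \<open>j\<close>.\<close>

definition face_sign :: "sign \<Rightarrow> letter list \<Rightarrow> nat \<Rightarrow> sign" where
  "face_sign \<alpha> w j = (case \<alpha> of Minus \<Rightarrow> sign_power (Suc (count_list (take j w) Zero))
     | Plus \<Rightarrow> sign_power (count_list (take j w) Zero))"

lemma cube_bdy_iff:
  "z \<in> cube_bdy \<alpha> w \<longleftrightarrow> (\<exists>j<length w. w ! j = Zero \<and> z = w[j := Sgn (face_sign \<alpha> w j)])"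
proof -
  have "(let i = count_list (take (Suc j) w) Zero in
      case \<alpha> of Minus \<Rightarrow> sign_power i | Plus \<Rightarrow> sign_power (i + 1)) = face_sign \<alpha> w j"
    if "j < length w" "w ! j = Zero" for j
    using that by (simp add: face_sign_def take_Suc_conv_app_nth sign_power_def split: sign.split)
  then have eq: "(w ! j = Zero \<and> z = w[j := Sgn (let i = count_list (take (Suc j) w) Zero in
      case \<alpha> of Minus \<Rightarrow> sign_power i | Plus \<Rightarrow> sign_power (i + 1))]) \<longleftrightarrow>
      (w ! j = Zero \<and> z = w[j := Sgn (face_sign \<alpha> w j)])" if "j < length w" for j
    using that by (metis (no_types, lifting))
  show ?thesis unfolding cube_bdy_def mem_Collect_eq using eq by blast
qed

lemma cube_dim_update:
  assumes "j < length w" "w ! j = Zero"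
  shows "Suc (cube_dim (w[j := Sgn s])) = cube_dim w"
proof -
  have w: "w = take j w @ Zero # drop (Suc j) w" using id_take_nth_drop[OF assms(1)] assms(2) by simp
  have "cube_dim w = cube_dim (take j w @ Zero # drop (Suc j) w)" by (rule arg_cong[OF w])
  then have "cube_dim w = Suc (count_list (take j w) Zero + count_list (drop (Suc j) w) Zero)"
    by (simp add: cube_dim_def)
  then show ?thesis using assms(1) by (simp add: cube_dim_def upd_conv_take_nth_drop)
qed

lemma cube_dim_sub:
  "u \<in> cube_sub w \<Longrightarrow> cube_dim u \<le> cube_dim w \<and> (cube_dim u = cube_dim w \<longrightarrow> u = w)"
  unfolding cube_sub_def cube_dim_def mem_Collect_eq by (induction rule: list_all2_induct) auto

lemma cube_face_complex:
  assumes "is_cube n I"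
  shows "face_complex (cube_faces n) cube_sub cube_dim cube_bdy I"
proof
  show "face_ocat (cube_faces n) cube_sub cube_dim cube_bdy I"
    using assms by (simp add: is_cube_def)
  fix w assume w: "w \<in> cube_faces n"
  show "w \<in> cube_sub w" by (simp add: cube_sub_nth)
  show "cube_sub w \<subseteq> cube_faces n" using w by (auto simp: cube_faces_def cube_sub_nth)
  show "cube_sub y \<subseteq> cube_sub w" if "y \<in> cube_sub w" for y
    using that unfolding subset_iff cube_sub_nth by metis
  show "cube_dim y < cube_dim w" if "y \<in> cube_sub w" "y \<noteq> w" for y
    using cube_dim_sub[OF that(1)] that(2) by linarith
  show "y \<in> cube_sub w \<and> Suc (cube_dim y) = cube_dim w" if "y \<in> cube_bdy \<alpha> w" for y \<alpha>
  proof -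
    have "\<exists>j<length w. w ! j = Zero \<and> y = w[j := Sgn (face_sign \<alpha> w j)]" using that by (simp only: cube_bdy_iff)
    then obtain j where j: "j < length w" "w ! j = Zero" "y = w[j := Sgn (face_sign \<alpha> w j)]" by blast
    have "y \<in> cube_sub w" unfolding j(3) cube_sub_nth using j(2) by (metis length_list_update nth_list_update_neq)
    then show ?thesis using cube_dim_update[OF j(1,2)] j(3) by simp
  qed
  show "\<exists>\<alpha>. \<exists>z\<in>cube_bdy \<alpha> w. y \<in> cube_sub z" if "y \<in> cube_sub w" "y \<noteq> w" for y
  proof -
    have y: "length y = length w" "\<And>j. j < length w \<Longrightarrow> y ! j = w ! j \<or> w ! j = Zero"
      using that(1) by (simp_all add: cube_sub_nth)
    have "\<exists>j<length w. y ! j \<noteq> w ! j" using that(2) y(1) by (metis nth_equalityI)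
    then obtain j where j: "j < length w" "y ! j \<noteq> w ! j" by blast
    then have jz: "w ! j = Zero" using y(2) by blast
    then obtain s where s: "y ! j = Sgn s" using j(2) by (cases "y ! j") auto
    define \<alpha> where "\<alpha> = (if face_sign Minus w j = s then Minus else Plus)"
    have "face_sign \<alpha> w j = s"
      by (cases s) (auto simp: \<alpha>_def face_sign_def sign_power_def split: if_splits)
    then have "w[j := Sgn s] \<in> cube_bdy \<alpha> w" unfolding cube_bdy_iff using j(1) jz by blast
    moreover have "y \<in> cube_sub (w[j := Sgn s])"
      unfolding cube_sub_nth using y s by (metis length_list_update nth_list_update_eq nth_list_update_neq)
    ultimately show ?thesis by blast
  qed
  show "\<exists>z\<in>cube_bdy Plus w. z \<notin> cube_bdy Minus w" if "0 < cube_dim w"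
  proof -
    have "Zero \<in> set w" using that cube_dim_0[of w] by (metis less_irrefl)
    then obtain j where j: "j < length w" "w ! j = Zero" by (meson in_set_conv_nth)
    let ?z = "w[j := Sgn (face_sign Plus w j)]"
    have "?z \<notin> cube_bdy Minus w"
    proof
      assume "?z \<in> cube_bdy Minus w"
      then obtain i where i: "i < length w" "w ! i = Zero" "?z = w[i := Sgn (face_sign Minus w i)]"
        unfolding cube_bdy_iff by blast
      have "?z ! i = Sgn (face_sign Minus w i)" unfolding i(3) using i(1) by simp
      then have ij: "i = j" using i(2) by (metis letter.distinct(1) nth_list_update_neq)
      then have "face_sign Plus w j = face_sign Minus w j" using \<open>?z ! i = _\<close> j(1) by simp
      then show False by (auto simp: face_sign_def sign_power_def split: if_splits)
    qed
    moreover have "?z \<in> cube_bdy Plus w" unfolding cube_bdy_iff using j by (intro exI[of _ j]) simp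
    ultimately show ?thesis by (intro bexI[of _ ?z])
  qed
qed

lemma first_zero:
  assumes "0 < cube_dim w"
  obtains j where "j < length w" "w ! j = Zero" "count_list (take j w) Zero = 0"
proof -
  have "Zero \<in> set w" using assms cube_dim_0[of w] by (metis less_irrefl)
  then obtain p s where p: "w = p @ Zero # s" "Zero \<notin> set p" by (meson split_list_first)
  show ?thesis by (rule that[of "length p"]) (use p in \<open>simp_all add: count_list_0_iff\<close>)
qed

lemma init_bdy:
  assumes "0 < cube_dim w"
  shows "\<exists>z\<in>cube_bdy Minus w. init w \<in> cube_sub z" "\<exists>z\<in>cube_bdy Plus w. final w \<in> cube_sub z"
proof -
  obtain j where j: "j < length w" "w ! j = Zero" "count_list (take j w) Zero = 0"
    using first_zero[OF assms] .
  have "face_sign Minus w j = Minus" "face_sign Plus w j = Plus"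
    using j(3) by (simp_all add: face_sign_def sign_power_def)
  then have "w[j := Sgn Minus] \<in> cube_bdy Minus w" "w[j := Sgn Plus] \<in> cube_bdy Plus w"
    unfolding cube_bdy_iff using j by metis+
  moreover have "init w \<in> cube_sub (w[j := Sgn Minus])" "final w \<in> cube_sub (w[j := Sgn Plus])"
    using j unfolding cube_sub_nth by (simp_all add: init_def final_def nth_list_update)
  ultimately show "\<exists>z\<in>cube_bdy Minus w. init w \<in> cube_sub z" "\<exists>z\<in>cube_bdy Plus w. final w \<in> cube_sub z"
    by blast+
qed

lemma init_dim: "cube_dim (init w) = 0" and final_dim: "cube_dim (final w) = 0"
  by (auto simp: cube_dim_0 init_def final_def)

locale cube =
  fixes N :: nat and I :: "letter list set ocat"
  assumes cube: "is_cube N I"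
begin

sublocale face_complex "cube_faces N" cube_sub cube_dim cube_bdy I
  by (rule cube_face_complex[OF cube])

text \<open>For an atom of positive dimension, the initial vertex lies in the source of codimension one and is
  least among all vertices, and so it is the 0-source; similarly for the final vertex.\<close>

lemma endpoints:
  "X \<in> cells I \<Longrightarrow> \<exists>a b. src I 0 X = {a} \<and> tgt I 0 X = {b} \<and> (\<forall>w\<in>X. vertex_le a (init w) \<and> vertex_le (final w) b)"
proof (induction rule: cell_induct)
  case (atom w)
  have X: "cube_sub w \<in> cells I" by (rule sub_cell[OF atom.hyps])
  have "src I 0 (cube_sub w) = {init w} \<and> tgt I 0 (cube_sub w) = {final w}"
  proof (cases "cube_dim w")
    case 0
    then have "flat 0 (cube_sub w)" using flat_sub[OF atom.hyps] by simp
    moreover have "cube_sub w = {w}" using sub_dim[OF atom.hyps] sub_refl[OF atom.hyps] 0 by auto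
    ultimately show ?thesis using 0 by (simp add: flat_eq init_vertex final_vertex)
  next
    case (Suc l)
    have pos: "0 < cube_dim w" using Suc by simp
    have Y: "bd I \<alpha> l (cube_sub w) \<in> cells I" "bd I \<alpha> l (cube_sub w) \<subseteq> cube_sub w"
      "bd I \<alpha> 0 (bd I \<alpha> l (cube_sub w)) = bd I \<alpha> 0 (cube_sub w)" for \<alpha>
      using bd_cell[OF X] bd_subset[OF X] bd_bd[OF X] by auto
    have dims: "cube_dim y < cube_dim w" if "y \<in> bd I \<alpha> l (cube_sub w)" for \<alpha> y
      using bd_dim[OF X that] Suc by simp
    have IH: "\<exists>a b. src I 0 (bd I \<alpha> l (cube_sub w)) = {a} \<and> tgt I 0 (bd I \<alpha> l (cube_sub w)) = {b} \<and>
        (\<forall>u\<in>bd I \<alpha> l (cube_sub w). vertex_le a (init u) \<and> vertex_le (final u) b)" for \<alpha>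
      by (rule atom.IH[OF Y(1) dims])
    obtain a where a: "src I 0 (cube_sub w) = {a}" "\<forall>u\<in>bd I Minus l (cube_sub w). vertex_le a (init u)"
      using IH[of Minus] Y(3)[of Minus] by metis
    obtain b where b: "tgt I 0 (cube_sub w) = {b}" "\<forall>u\<in>bd I Plus l (cube_sub w). vertex_le (final u) b"
      using IH[of Plus] Y(3)[of Plus] by metis
    have "init w \<in> bd I Minus l (cube_sub w)" "final w \<in> bd I Plus l (cube_sub w)"
      unfolding bd_sub[OF atom.hyps Suc] using init_bdy[OF pos] by blast+
    then have "vertex_le a (init w)" "vertex_le (final w) b"
      using a(2) b(2) init_vertex[OF init_dim] final_vertex[OF final_dim] by metis+
    moreover have "a \<in> cube_sub w" "cube_dim a \<le> 0" "b \<in> cube_sub w" "cube_dim b \<le> 0"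
      using bd_subset[OF X, of Minus 0] bd_dim[OF X, of a Minus 0] bd_subset[OF X, of Plus 0]
        bd_dim[OF X, of b Plus 0] a(1) b(1) by auto
    then have "vertex_le (init w) a" "vertex_le b (final w)"
      using sub_init_final init_vertex[of a] final_vertex[of b] by fastforce+
    ultimately show ?thesis using a(1) b(1) vertex_le_antisym by blast
  qed
  then show ?case using sub_init_final[of _ w] by auto
next
  case (comp m A B)
  obtain a b where A: "src I 0 A = {a}" "tgt I 0 A = {b}" "\<forall>w\<in>A. vertex_le a (init w) \<and> vertex_le (final w) b"
    using comp.IH(1) by blast
  obtain c d where B: "src I 0 B = {c}" "tgt I 0 B = {d}" "\<forall>w\<in>B. vertex_le c (init w) \<and> vertex_le (final w) d"
    using comp.IH(2) by blast
  have cells: "A \<in> cells I" "B \<in> cells I" using composable_cells comp.hyps by blast+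
  show ?case
  proof (cases "m = 0")
    case True
    have bc: "b = c" using composable_eq[OF comp.hyps] A(2) B(1) True by simp
    have "b \<in> A" "cube_dim b \<le> 0" "c \<in> B" 
      using bd_subset[OF cells(1), of Plus 0] bd_dim[OF cells(1), of b Plus 0]
        bd_subset[OF cells(2), of Minus 0] A(2) B(1) by auto
    then have "vertex_le a b" "vertex_le b d"
      using A(3) B(3) bc init_vertex[of b] final_vertex[of b] by fastforce+
    then have "\<forall>w\<in>A \<union> B. vertex_le a (init w) \<and> vertex_le (final w) d"
      using A(3) B(3) bc vertex_le_trans by blast
    then show ?thesis using src_Un[OF comp.hyps] tgt_Un[OF comp.hyps] A(1) B(2) True by auto
  next
    case False
    then have "src I 0 A = src I 0 B" "tgt I 0 A = tgt I 0 B"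
      using bd_eq_below[OF comp.hyps] by simp_all
    then have "a = c" "b = d" using A B by simp_all
    then show ?thesis using bd_Un[OF comp.hyps, of 0] False A B by auto
  qed
qed

end

section \<open>Germs of cubical cells at a vertex\<close>

text \<open>The letters of \<open>w\<close> other than \<open>+\<close> are numbered from \<open>k\<close> on, and the numbers of the zeros are listed. These
  letters are the negative coordinates of the initial vertex of \<open>w\<close>; so for \<open>k = 0\<close> the list is the face
  that \<open>w\<close> cuts out of the simplex on them.\<close>

primrec zeros :: "nat \<Rightarrow> letter list \<Rightarrow> nat list" where
  "zeros k [] = []"
| "zeros k (a # w) = (case a of Zero \<Rightarrow> k # zeros (Suc k) w
     | Sgn s \<Rightarrow> (if s = Plus then zeros k w else zeros (Suc k) w))"

lemma zeros_append: "zeros k (p @ w) = zeros k p @ zeros (k + length (filter (\<lambda>a. a \<noteq> Sgn Plus) p)) w"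
  by (induction p arbitrary: k) (auto split: letter.split)

lemma length_zeros: "length (zeros k w) = cube_dim w"
  by (induction w arbitrary: k) (auto simp: cube_dim_def split: letter.split)

lemma zeros_sorted: "sorted_wrt (<) (zeros k w) \<and> set (zeros k w) \<subseteq> {k..<k + length (filter (\<lambda>a. a \<noteq> Sgn Plus) w)}"
proof (induction w arbitrary: k)
  case (Cons a w)
  show ?case using Cons.IH[of k] Cons.IH[of "Suc k"]
    by (cases a) (auto split: if_splits simp: subset_iff Suc_le_eq less_imp_le)
qed simp

lemma count_minus_init: "count_list (init w) (Sgn Minus) = length (filter (\<lambda>a. a \<noteq> Sgn Plus) w)"
proof (induction w)
  case (Cons a w)
  have "a = Sgn Minus \<or> a = Sgn Plus \<or> a = Zero" by (metis letter.exhaust sign.exhaust)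
  then show ?case using Cons by (elim disjE) (simp_all add: init_def)
qed (simp add: init_def)

text \<open>The subfaces with the same initial vertex arise by replacing zeros by \<open>-\<close>, which deletes their
  numbers from the list and leaves the other numbers as they are.\<close>

lemma zeros_sub:
  "zeros k ` {u \<in> cube_sub w. init u = init w} = {y. subseq y (zeros k w)}"
proof (induction w arbitrary: k)
  case Nil
  show ?case by (auto simp: cube_sub_def)
next
  case (Cons a w)
  let ?U = "{u \<in> cube_sub w. init u = init w}"
  let ?B = "{b. (b = a \<or> a = Zero) \<and> (if b = Zero then Sgn Minus else b) = (if a = Zero then Sgn Minus else a)}"
  have sub: "{u \<in> cube_sub (a # w). init u = init (a # w)} = (\<Union>b\<in>?B. (#) b ` ?U)"
    by (auto simp: cube_sub_def list_all2_Cons2 init_def image_iff split: if_splits)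
  show ?case
  proof (cases a)
    case (Sgn s)
    then have B: "?B = {a}" by auto
    have "zeros k ` {u \<in> cube_sub (a # w). init u = init (a # w)} = (\<lambda>u. zeros k (a # u)) ` ?U"
      unfolding sub B by (simp only: UN_insert UN_empty Un_empty_right image_image)
    also have "\<dots> = zeros (if s = Plus then k else Suc k) ` ?U" unfolding Sgn by simp
    finally show ?thesis unfolding Cons.IH using Sgn by simp
  next
    case Zero
    then have B: "?B = {Zero, Sgn Minus}" by auto
    have "zeros k ` {u \<in> cube_sub (a # w). init u = init (a # w)} =
        (\<lambda>u. zeros k (Zero # u)) ` ?U \<union> (\<lambda>u. zeros k (Sgn Minus # u)) ` ?U"
      unfolding sub B by (simp only: UN_insert UN_empty Un_empty_right image_image image_Un)
    also have "\<dots> = (\<lambda>u. k # zeros (Suc k) u) ` ?U \<union> zeros (Suc k) ` ?U" by simp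
    also have "\<dots> = (#) k ` (zeros (Suc k) ` ?U) \<union> zeros (Suc k) ` ?U" by blast
    also have "\<dots> = (#) k ` {y. subseq y (zeros (Suc k) w)} \<union> {y. subseq y (zeros (Suc k) w)}"
      unfolding Cons.IH ..
    also have "\<dots> = {y. subseq y (k # zeros (Suc k) w)}"
    proof (rule set_eqI)
      fix y :: "nat list"
      show "y \<in> (#) k ` {y. subseq y (zeros (Suc k) w)} \<union> {y. subseq y (zeros (Suc k) w)} \<longleftrightarrow>
          y \<in> {y. subseq y (k # zeros (Suc k) w)}"
        by (cases y) (auto intro: subseq_Cons' split: if_splits)
    qed
    finally show ?thesis using Zero by simp
  qed
qed

lemma zeros_inj: "init u = init w \<Longrightarrow> zeros k u = zeros k w \<Longrightarrow> u = w"
proof (induction u arbitrary: w k)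
  case Nil
  then show ?case by (simp add: init_def)
next
  case (Cons a u)
  then obtain b w' where w: "w = b # w'" by (cases w) (auto simp: init_def)
  have i: "init u = init w'" "(if a = Zero then Sgn Minus else a) = (if b = Zero then Sgn Minus else b)"
    using Cons.prems(1) w by (simp_all add: init_def)
  have no: "zeros (Suc k) x \<noteq> k # y" for x y
    using zeros_sorted[of "Suc k" x] by auto
  have ab: "a = Sgn Minus \<or> a = Sgn Plus \<or> a = Zero" "b = Sgn Minus \<or> b = Sgn Plus \<or> b = Zero"
    by (metis letter.exhaust sign.exhaust)+
  have "a = b \<and> zeros (if a = Sgn Plus then k else Suc k) u = zeros (if a = Sgn Plus then k else Suc k) w'"
    using ab Cons.prems(2) i(2) no no[symmetric] unfolding w by (elim disjE) simp_all
  then show ?case using Cons.IH[OF i(1)] w by blast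
qed

definition germ :: "letter list \<Rightarrow> letter list set \<Rightarrow> nat list set" where
  "germ v X = zeros 0 ` {w \<in> X. init w = v \<and> 0 < cube_dim w}"

lemma germ_Un: "germ v (X \<union> Y) = germ v X \<union> germ v Y"
  by (auto simp: germ_def)

lemma germ_UN: "germ v (\<Union> (f ` X)) = (\<Union>x\<in>X. germ v (f x))"
  by (auto simp: germ_def)

lemma germ_sub: "germ (init w) (cube_sub w) = simplex_sub (zeros 0 w)"
proof -
  have "germ (init w) (cube_sub w) = zeros 0 ` {u \<in> cube_sub w. init u = init w} - {[]}"
    unfolding germ_def length_zeros[where k = 0, symmetric] by auto
  then show ?thesis unfolding zeros_sub simplex_sub_def by auto
qed

lemma germ_face:
  assumes j: "j < length w" "w ! j = Zero"
  shows "germ (init w) (cube_sub (w[j := Sgn s])) = (if s = Minus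
    then simplex_sub (take (count_list (take j w) Zero) (zeros 0 w) @ drop (Suc (count_list (take j w) Zero)) (zeros 0 w))
    else {})"
proof (cases s)
  case Minus
  let ?p = "take j w" and ?q = "drop (Suc j) w"
  have w: "w = ?p @ Zero # ?q" using id_take_nth_drop[OF j(1)] j(2) by simp
  have w': "w[j := Sgn s] = ?p @ Sgn Minus # ?q" using j(1) Minus by (simp add: upd_conv_take_nth_drop)
  have i: "init (w[j := Sgn s]) = init w"
    using j Minus by (intro nth_equalityI) (auto simp: init_def nth_list_update)
  define l where "l = length (filter (\<lambda>a. a \<noteq> Sgn Plus) ?p)"
  have "zeros 0 w = zeros 0 (?p @ Zero # ?q)" using w by (rule arg_cong)
  then have z: "zeros 0 w = zeros 0 ?p @ l # zeros (Suc l) ?q" by (simp add: zeros_append l_def)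
  have z': "zeros 0 (w[j := Sgn s]) = zeros 0 ?p @ zeros (Suc l) ?q" unfolding w' by (simp add: zeros_append l_def)
  have c: "count_list ?p Zero = length (zeros 0 ?p)" by (simp add: length_zeros cube_dim_def)
  have "zeros 0 (w[j := Sgn s]) = take (count_list ?p Zero) (zeros 0 w) @ drop (Suc (count_list ?p Zero)) (zeros 0 w)"
    unfolding z z' c by simp
  then show ?thesis using germ_sub[of "w[j := Sgn s]"] i Minus by simp
next
  case Plus
  have "init u \<noteq> init w" if "u \<in> cube_sub (w[j := Sgn s])" for u
  proof -
    have u: "length u = length w" "u ! j = Sgn Plus" using that j Plus by (auto simp: cube_sub_nth)
    then have "init u ! j \<noteq> init w ! j" using j by (simp add: init_def)
    then show ?thesis by metis
  qed
  then show ?thesis using Plus by (auto simp: germ_def)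
qed

lemma nth_zero: "i < count_list w a \<Longrightarrow> \<exists>j<length w. w ! j = a \<and> count_list (take j w) a = i"
proof (induction w arbitrary: i)
  case (Cons b w)
  show ?case
  proof (cases "b = a \<and> i = 0")
    case True
    then show ?thesis by (intro exI[of _ 0]) simp
  next
    case False
    define i' where "i' = (if b = a then i - 1 else i)"
    have "i' < count_list w a" using Cons.prems False by (auto simp: i'_def split: if_splits)
    then obtain j where "j < length w" "w ! j = a" "count_list (take j w) a = i'" using Cons.IH by blast
    then show ?thesis using False by (intro exI[of _ "Suc j"]) (auto simp: i'_def)
  qed
qed simp

text \<open>A facet of \<open>w\<close> in which a zero is replaced by \<open>+\<close> does not contain the initial vertex of \<open>w\<close>. In the
  source the zeros that are replaced by \<open>-\<close> are those in odd position, in the target those in even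
  position; and these are the deletions in the source and in the target of a simplex.\<close>

lemma germ_bdy: "germ (init w) (\<Union> (cube_sub ` cube_bdy \<alpha> w)) = \<Union> (simplex_sub ` simplex_bdy \<alpha> (zeros 0 w))"
proof -
  let ?del = "\<lambda>i. take i (zeros 0 w) @ drop (Suc i) (zeros 0 w)"
  let ?odd = "\<lambda>i. case \<alpha> of Minus \<Rightarrow> even i | Plus \<Rightarrow> odd (i::nat)"
  have fs: "face_sign \<alpha> w j = Minus \<longleftrightarrow> ?odd (count_list (take j w) Zero)" for j
    by (cases \<alpha>) (auto simp: face_sign_def sign_power_def)
  have "germ (init w) (\<Union> (cube_sub ` cube_bdy \<alpha> w)) =
      (\<Union>j\<in>{j. j < length w \<and> w ! j = Zero}. germ (init w) (cube_sub (w[j := Sgn (face_sign \<alpha> w j)])))"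
  proof -
    have "cube_bdy \<alpha> w = (\<lambda>j. w[j := Sgn (face_sign \<alpha> w j)]) ` {j. j < length w \<and> w ! j = Zero}"
      unfolding set_eq_iff cube_bdy_iff image_iff by blast
    then show ?thesis unfolding germ_UN by simp
  qed
  also have "\<dots> = (\<Union>j\<in>{j. j < length w \<and> w ! j = Zero}. if ?odd (count_list (take j w) Zero)
      then simplex_sub (?del (count_list (take j w) Zero)) else {})"
    by (rule SUP_cong[OF refl]) (simp add: germ_face fs)
  also have "\<dots> = (\<Union>i\<in>(\<lambda>j. count_list (take j w) Zero) ` {j. j < length w \<and> w ! j = Zero}.
      if ?odd i then simplex_sub (?del i) else {})" by (simp only: image_image)
  also have "(\<lambda>j. count_list (take j w) Zero) ` {j. j < length w \<and> w ! j = Zero} = {i. i < length (zeros 0 w)}"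
  proof (intro equalityI subsetI)
    fix i assume "i \<in> {i. i < length (zeros 0 w)}"
    then have "i < count_list w Zero" by (simp add: length_zeros cube_dim_def)
    from nth_zero[OF this] obtain j where "j < length w" "w ! j = Zero" "count_list (take j w) Zero = i"
      by (elim exE conjE)
    then show "i \<in> (\<lambda>j. count_list (take j w) Zero) ` {j. j < length w \<and> w ! j = Zero}"
      by (intro image_eqI[of _ _ j]) simp_all
  next
    fix i assume "i \<in> (\<lambda>j. count_list (take j w) Zero) ` {j. j < length w \<and> w ! j = Zero}"
    then obtain j where j: "j < length w" "w ! j = Zero" "i = count_list (take j w) Zero" by blast
    have w: "w = take j w @ Zero # drop (Suc j) w" using id_take_nth_drop[OF j(1)] j(2) by simp
    have "count_list w Zero = count_list (take j w @ Zero # drop (Suc j) w) Zero" by (rule arg_cong[OF w])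
    then show "i \<in> {i. i < length (zeros 0 w)}" using j(3) by (simp add: length_zeros cube_dim_def)
  qed
  also have "(\<Union>i\<in>{i. i < length (zeros 0 w)}. if ?odd i then simplex_sub (?del i) else {}) =
      \<Union> (simplex_sub ` simplex_bdy \<alpha> (zeros 0 w))"
    unfolding simplex_bdy_image by (auto split: if_splits)
  finally show ?thesis .
qed

context cube begin

text \<open>A face of positive dimension has distinct initial and final vertices, and both lie between the
  endpoints of \<open>X\<close>.\<close>

lemma flat_0_iff:
  assumes "X \<in> cells I"
  shows "flat 0 X \<longleftrightarrow> src I 0 X = tgt I 0 X"
proof
  assume "flat 0 X"
  then show "src I 0 X = tgt I 0 X" by (simp add: flat_eq)
next
  assume e: "src I 0 X = tgt I 0 X"
  obtain a b where ab: "src I 0 X = {a}" "tgt I 0 X = {b}" "\<forall>w\<in>X. vertex_le a (init w) \<and> vertex_le (final w) b"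
    using endpoints[OF assms] by blast
  have "cube_dim w \<le> 0" if "w \<in> X" for w
  proof (rule ccontr)
    assume "\<not> cube_dim w \<le> 0"
    then have "init w \<noteq> final w" using init_final(2) by simp
    moreover have "vertex_le a (init w)" "vertex_le (final w) a" using ab e that by auto
    then have "vertex_le (final w) (init w)" using vertex_le_trans by blast
    ultimately show False using init_final(1) vertex_le_antisym by blast
  qed
  then show "flat 0 X" using flatI[OF assms] by blast
qed

lemma src_flat:
  assumes X: "X \<in> cells I" and "\<not> flat 0 X" and "0 < k"
  shows "\<not> flat 0 (bd I \<alpha> k X)" "bd I \<beta> 0 (bd I \<alpha> k X) = bd I \<beta> 0 X"
proof -
  show "bd I \<beta> 0 (bd I \<alpha> k X) = bd I \<beta> 0 X" for \<beta> using assms by (simp add: bd_bd)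
  then show "\<not> flat 0 (bd I \<alpha> k X)" using assms flat_0_iff[OF X] flat_0_iff[OF bd_cell[OF X]] by simp
qed

lemma path_cell_iff: "X \<in> cells (path_ocat I) \<longleftrightarrow> X \<in> cells I \<and> \<not> flat 0 X"
proof -
  have "(\<forall>\<alpha>. bd I \<alpha> 0 X = X) \<longleftrightarrow> src I 0 X = X \<and> tgt I 0 X = X" by (metis sign.exhaust)
  then show ?thesis unfolding path_cells_iff[OF D] flat_def by blast
qed

lemma non_contracting: "non_contracting I"
  unfolding non_contracting_def
proof (intro ballI impI)
  fix X assume X: "X \<in> cells I" "odim I X \<ge> 1"
  then have nf: "\<not> flat 0 X" using path_cell_iff[of X] by (simp add: path_ocat_def)
  have "odim I (bd I \<alpha> 1 X) = 1" for \<alpha>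
  proof -
    have Y: "bd I \<alpha> 1 X \<in> cells I" using X(1) by (rule bd_cell)
    have "odim I (bd I \<alpha> 1 X) \<le> 1" using odim_bd_iff[OF D Y, of 1] bd_bd[OF X(1)] by simp
    moreover have "bd I \<alpha> 1 X \<in> cells (path_ocat I)"
      using path_cell_iff Y src_flat(1)[OF X(1) nf, of 1] by simp
    ultimately show ?thesis by (simp add: path_ocat_def)
  qed
  then show "odim I (src I 1 X) = 1 \<and> odim I (tgt I 1 X) = 1" by blast
qed

lemma atom_ends: 
  assumes "w \<in> cube_faces N"
  shows "src I 0 (cube_sub w) = {init w}"
proof -
  have X: "cube_sub w \<in> cells I" by (rule sub_cell[OF assms])
  obtain a where a: "src I 0 (cube_sub w) = {a}" "\<forall>u\<in>cube_sub w. vertex_le a (init u)"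
    using endpoints[OF X] by blast
  have "a \<in> cube_sub w" using bd_subset[OF X, of Minus 0] a(1) by simp
  moreover have "cube_dim a = 0" using bd_dim[OF X, of a Minus 0] a(1) by simp
  ultimately have "vertex_le (init w) a" using sub_init_final(1)[of a w] init_vertex by simp
  moreover have "vertex_le a (init w)" using a(2) sub_refl[OF assms] by blast
  ultimately show ?thesis using a(1) vertex_le_antisym by simp
qed

text \<open>The vertices of \<open>B\<close> lie above its initial vertex, which is the final vertex of \<open>A\<close> and differs from \<open>v\<close>.\<close>

lemma germ_cmp_0:
  assumes "composable I 0 A B" "\<not> flat 0 A" "src I 0 A = {v}" "Y \<subseteq> B"
  shows "germ v Y = {}"
proof -
  have AB: "A \<in> cells I" "B \<in> cells I" using composable_cells assms(1) by blast+
  obtain c where c: "src I 0 B = {c}" "\<forall>w\<in>B. vertex_le c (init w)" using endpoints[OF AB(2)] by blast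
  have t: "tgt I 0 A = {c}" using composable_eq[OF assms(1)] c(1) by simp
  have "c \<noteq> v" using flat_0_iff[OF AB(1)] assms(2,3) t by auto
  have "c \<in> A" "cube_dim c = 0"
    using bd_subset[OF AB(1), of Plus 0] bd_dim[OF AB(1), of c Plus 0] t by auto
  then have "vertex_le v c" using endpoints[OF AB(1)] assms(3) init_vertex[of c] by force
  then have "init w \<noteq> v" if "w \<in> B" for w using c(2) that vertex_le_antisym \<open>c \<noteq> v\<close> by blast
  then show ?thesis using assms(4) unfolding germ_def by auto
qed

end

lemma zeros_face:
  assumes "0 < cube_dim w"
  shows "zeros 0 w \<in> simplex_faces (count_list (init w) (Sgn Minus) - 1)"
proof -
  have "zeros 0 w \<noteq> []" using assms length_zeros[of 0 w] by auto
  moreover have "set (zeros 0 w) \<subseteq> {0..<count_list (init w) (Sgn Minus)}"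
    using zeros_sorted[of 0 w] unfolding count_minus_init by simp
  then have "set (zeros 0 w) \<subseteq> {0..count_list (init w) (Sgn Minus) - 1}" by (auto simp: subset_iff)
  ultimately show ?thesis using zeros_sorted[of 0 w] by (simp add: face_list)
qed

text \<open>Composition of paths in dimension \<open>k\<close> is composition in dimension \<open>k + 1\<close> in the cube, where the two cells
  have the same initial vertex, so that germs are united. The remaining composition \<open>*\<^sub>0\<close> is needed in
  the induction because it is used to generate the cells of the cube.\<close>

lemma germ_functor:
  assumes I: "is_cube N I" and Delta: "is_simplex (count_list v (Sgn Minus) - 1) \<Delta>"
    and X: "X \<in> cells I"
  shows "X \<in> cells (path_ocat I) \<Longrightarrow> src I 0 X = {v} \<Longrightarrow>
    germ v X \<in> cells \<Delta> \<and> (\<forall>\<alpha> k. germ v (bd I \<alpha> (Suc k) X) = bd \<Delta> \<alpha> k (germ v X))"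
proof -
  let ?n = "count_list v (Sgn Minus) - 1"
  interpret I: cube N I by unfold_locales (rule I)
  interpret S: face_complex "simplex_faces ?n" simplex_sub simplex_dim simplex_bdy \<Delta>
    by (rule simplex_face_complex[OF Delta])
  show "X \<in> cells (path_ocat I) \<Longrightarrow> src I 0 X = {v} \<Longrightarrow>
    germ v X \<in> cells \<Delta> \<and> (\<forall>\<alpha> k. germ v (bd I \<alpha> (Suc k) X) = bd \<Delta> \<alpha> k (germ v X))"
    using X
  proof (induction rule: I.cell_induct)
    case (atom w)
    have W: "cube_sub w \<in> cells I" by (rule I.sub_cell[OF atom.hyps])
    have nf: "\<not> I.flat 0 (cube_sub w)" using atom.prems(1) I.path_cell_iff by blast
    have v: "v = init w" using I.atom_ends[OF atom.hyps] atom.prems(2) by simp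
    let ?x = "zeros 0 w"
    have pos: "0 < cube_dim w" using nf I.flat_sub[OF atom.hyps] by (cases "cube_dim w") auto
    have dim: "Suc (simplex_dim ?x) = cube_dim w" using pos length_zeros[of 0 w] by (simp add: simplex_dim_def)
    have x: "?x \<in> simplex_faces ?n" unfolding v by (rule zeros_face[OF pos])
    have g: "germ v (cube_sub w) = simplex_sub ?x" unfolding v by (rule germ_sub)
    have top: "germ v (bd I \<alpha> (Suc k) (cube_sub w)) = bd \<Delta> \<alpha> k (simplex_sub ?x)"
      if "cube_dim w = Suc (Suc k)" for \<alpha> k
    proof -
      have "simplex_dim ?x = Suc k" using dim that by simp
      then show ?thesis using I.bd_sub[OF atom.hyps that] S.bd_sub[OF x] germ_bdy unfolding v by simp
    qed
    have "germ v (bd I \<alpha> (Suc k) (cube_sub w)) = bd \<Delta> \<alpha> k (simplex_sub ?x)" for \<alpha> k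
    proof -
      consider "cube_dim w \<le> Suc k" | "cube_dim w = Suc (Suc k)" | l where "k < l" "cube_dim w = Suc (Suc l)"
        using dim by (metis Suc_leI Suc_le_mono le_neq_implies_less less_Suc_eq_le not_less_eq_eq Suc_lessE)
      then show ?thesis
      proof cases
        case 1
        then have "bd I \<alpha> (Suc k) (cube_sub w) = cube_sub w"
          using I.flat_eq[OF I.flat_mono[OF I.flat_sub[OF atom.hyps]]] by simp
        moreover have "bd \<Delta> \<alpha> k (simplex_sub ?x) = simplex_sub ?x"
          using 1 dim S.flat_eq[OF S.flat_mono[OF S.flat_sub[OF x]]] by simp
        ultimately show ?thesis using g by simp
      next
        case 2
        then show ?thesis by (rule top)
      next
        case 3
        let ?Y = "bd I Plus (Suc l) (cube_sub w)"
        have Y: "?Y \<in> cells I" using W by (rule I.bd_cell)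
        have "cube_dim y < cube_dim w" if "y \<in> ?Y" for y using I.bd_dim[OF W that] 3(2) by simp
        moreover have "?Y \<in> cells (path_ocat I)" "src I 0 ?Y = {v}"
          using I.path_cell_iff Y I.src_flat[OF W nf, of "Suc l"] atom.prems(2) by simp_all
        ultimately have "germ v (bd I \<alpha> (Suc k) ?Y) = bd \<Delta> \<alpha> k (germ v ?Y)"
          using atom.IH[OF Y] by blast
        also have "bd I \<alpha> (Suc k) ?Y = bd I \<alpha> (Suc k) (cube_sub w)" using I.bd_bd[OF W] 3(1) by simp
        also have "germ v ?Y = bd \<Delta> Plus l (simplex_sub ?x)" by (rule top[OF 3(2)])
        also have "bd \<Delta> \<alpha> k (bd \<Delta> Plus l (simplex_sub ?x)) = bd \<Delta> \<alpha> k (simplex_sub ?x)"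
          using S.bd_bd[OF S.sub_cell[OF x]] 3(1) by simp
        finally show ?thesis .
      qed
    qed
    then show ?case using g S.sub_cell[OF x] by simp
  next
    case (comp m A B)
    have AB: "A \<in> cells I" "B \<in> cells I" using I.composable_cells comp.hyps by blast+
    have C: "A \<union> B \<in> cells I" "\<not> I.flat 0 (A \<union> B)" using comp.prems(1) I.path_cell_iff by blast+
    note cU = I.cmp_Un[OF comp.hyps]
    show ?case
    proof (cases m)
      case 0
      show ?thesis
      proof (cases "I.flat 0 A")
        case True
        then have "A \<union> B = B" using I.cmp_flat_left[OF comp.hyps] 0 cU by simp
        then show ?thesis using comp by simp
      next
        case False
        have A: "A \<in> cells (path_ocat I)" "src I 0 A = {v}"
          using I.path_cell_iff AB False I.src_Un[OF comp.hyps] comp.prems(2) 0 by simp_all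
        have n: "germ v Y = {}" if "Y \<subseteq> B" for Y
          using I.germ_cmp_0[OF _ False A(2) that] comp.hyps 0 by simp
        have "germ v (A \<union> B) = germ v A" using n[of B] by (simp add: germ_Un)
        moreover have "germ v (bd I \<alpha> (Suc k) (A \<union> B)) = germ v (bd I \<alpha> (Suc k) A)" for \<alpha> k
          using I.bd_Un[OF comp.hyps, of "Suc k"] 0 n[OF I.bd_subset[OF AB(2)]] by (simp add: germ_Un)
        ultimately show ?thesis using comp.IH(1)[OF A] by simp
      qed
    next
      case (Suc m')
      have e: "bd I \<alpha> 0 A = bd I \<alpha> 0 B" "bd I \<alpha> 0 (A \<union> B) = bd I \<alpha> 0 A" for \<alpha>
        using I.bd_eq_below[OF comp.hyps, of 0] I.bd_Un[OF comp.hyps, of 0] Suc by simp_all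
      have "A \<in> cells (path_ocat I)" "B \<in> cells (path_ocat I)"
        using C I.flat_0_iff AB e by (simp_all add: I.path_cell_iff)
      moreover have "src I 0 A = {v}" "src I 0 B = {v}" using e comp.prems(2) by simp_all
      ultimately have A: "germ v A \<in> cells \<Delta>" "germ v (bd I \<alpha> (Suc k) A) = bd \<Delta> \<alpha> k (germ v A)"
        and B: "germ v B \<in> cells \<Delta>" "germ v (bd I \<alpha> (Suc k) B) = bd \<Delta> \<alpha> k (germ v B)" for \<alpha> k
        using comp.IH by blast+
      have c: "composable \<Delta> m' (germ v A) (germ v B)"
        using A B I.composable_eq[OF comp.hyps] Suc unfolding composable_def by metis
      have "germ v (bd I \<alpha> (Suc k) (A \<union> B)) = bd \<Delta> \<alpha> k (germ v A \<union> germ v B)" for \<alpha> k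
      proof (cases "k = m'")
        case True
        then show ?thesis
          using S.src_Un[OF c] S.tgt_Un[OF c] I.src_Un[OF comp.hyps] I.tgt_Un[OF comp.hyps] A B Suc
          by (cases \<alpha>) simp_all
      next
        case False
        then show ?thesis
          using I.bd_Un[OF comp.hyps, of "Suc k"] S.bd_Un[OF c False] A B Suc by (simp add: germ_Un)
      qed
      then show ?thesis using S.cmp_cell[OF c] S.cmp_Un[OF c] by (simp add: germ_Un)
    qed
  qed
qed

section \<open>The universal property of the negative semi-path omega-category\<close>

lemma functor_cell: "omega_functor h C D \<Longrightarrow> x \<in> cells C \<Longrightarrow> h x \<in> cells D"
  and functor_bd: "omega_functor h C D \<Longrightarrow> x \<in> cells C \<Longrightarrow> h (bd C \<alpha> n x) = bd D \<alpha> n (h x)"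
  and functor_cmp: "omega_functor h C D \<Longrightarrow> composable C n x y \<Longrightarrow> h (cmp C n x y) = cmp D n (h x) (h y)"
  by (simp_all add: omega_functor_def glob_map_def)

lemma functor_composable:
  assumes h: "omega_functor h C D" and xy: "composable C n x y"
  shows "composable D n (h x) (h y)"
proof -
  have c: "x \<in> cells C" "y \<in> cells C" "tgt C n x = src C n y" using xy by (simp_all add: composable_def)
  then show ?thesis unfolding composable_def functor_bd[OF h c(1), symmetric] functor_bd[OF h c(2), symmetric]
    by (simp add: functor_cell[OF h])
qed

lemma functor_comp:
  assumes h: "omega_functor h C D" and k: "omega_functor k D E"
  shows "omega_functor (\<lambda>x. k (h x)) C E"
  unfolding omega_functor_def glob_map_def
proof (intro conjI ballI allI impI)
  fix x \<alpha> n assume x: "x \<in> cells C"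
  show "k (h x) \<in> cells E" using functor_cell[OF k functor_cell[OF h x]] .
  show "k (h (bd C \<alpha> n x)) = bd E \<alpha> n (k (h x))"
    by (simp add: functor_bd[OF h x] functor_bd[OF k functor_cell[OF h x]])
next
  fix n x y assume xy: "composable C n x y"
  show "k (h (cmp C n x y)) = cmp E n (k (h x)) (k (h y))"
    by (simp add: functor_cmp[OF h xy] functor_cmp[OF k functor_composable[OF h xy]])
qed

lemma bij_functor_iso:
  assumes C: "omega_category C" and h: "omega_functor h C D" and bij: "bij_betw h (cells C) (cells D)"
  shows "ocat_iso C D"
proof -
  define k where "k = inv_into (cells C) h"
  have hk: "h (k y) = y" "k y \<in> cells C" if "y \<in> cells D" for y
    using that bij unfolding k_def by (simp_all add: bij_betw_inv_into_right bij_betw_def inv_into_into)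
  have kh: "k (h x) = x" if "x \<in> cells C" for x
    using that bij unfolding k_def by (simp add: bij_betw_inv_into_left)
  have kb: "k (bd D \<alpha> n y) = bd C \<alpha> n (k y)" if "y \<in> cells D" for \<alpha> n y
  proof -
    have "h (bd C \<alpha> n (k y)) = bd D \<alpha> n y" using functor_bd[OF h hk(2)[OF that]] hk(1)[OF that] by simp
    then show ?thesis using kh omega_categoryD(3)[OF C hk(2)[OF that]] by metis
  qed
  have "omega_functor k D C"
    unfolding omega_functor_def glob_map_def
  proof (intro conjI ballI allI impI)
    fix n x y assume xy: "composable D n x y"
    then have xy': "x \<in> cells D" "y \<in> cells D" "tgt D n x = src D n y" by (simp_all add: composable_def)
    then have c: "composable C n (k x) (k y)"
      unfolding composable_def using kb[OF xy'(1), of Plus n] kb[OF xy'(2), of Minus n] hk by simp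
    have "h (cmp C n (k x) (k y)) = cmp D n x y" using functor_cmp[OF h c] hk xy' by simp
    then show "k (cmp D n x y) = cmp C n (k x) (k y)" using kh omega_categoryD(2)[OF C c] by metis
  qed (simp_all add: hk kb)
  then show ?thesis unfolding ocat_iso_def using h kh hk by blast
qed

text \<open>In contrast to \<open>generated\<close>, closed under the boundary maps as well.\<close>

inductive_set spanned :: "'a ocat \<Rightarrow> 'a set \<Rightarrow> 'a set" for C :: "'a ocat" and S :: "'a set" where
  base: "x \<in> S \<Longrightarrow> x \<in> spanned C S"
| bd: "x \<in> spanned C S \<Longrightarrow> bd C \<alpha> n x \<in> spanned C S"
| cmp: "x \<in> spanned C S \<Longrightarrow> y \<in> spanned C S \<Longrightarrow> composable C n x y \<Longrightarrow> cmp C n x y \<in> spanned C S"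

lemma spanned_cells: "omega_category C \<Longrightarrow> S \<subseteq> cells C \<Longrightarrow> x \<in> spanned C S \<Longrightarrow> x \<in> cells C"
  by (rotate_tac 2, induction rule: spanned.induct) (auto simp: omega_categoryD(2,3))

lemma spanned_trans: "x \<in> spanned C S \<Longrightarrow> S \<subseteq> spanned C T \<Longrightarrow> x \<in> spanned C T"
  by (induction rule: spanned.induct) (auto intro: spanned.bd spanned.cmp)

lemma functor_spanned:
  assumes C: "omega_category C" and S: "S \<subseteq> cells C" and h: "omega_functor h C D"
  shows "x \<in> spanned C S \<Longrightarrow> h x \<in> spanned D (h ` S)"
proof (induction rule: spanned.induct)
  case (base x)
  then show ?case by (blast intro: spanned.base)
next
  case (bd x \<alpha> n)
  then show ?case using spanned_cells[OF C S bd.hyps] by (simp add: functor_bd[OF h] spanned.bd)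
next
  case (cmp x y n)
  then show ?case
    by (simp add: functor_cmp[OF h] spanned.cmp functor_composable[OF h])
qed

lemma (in well_formed_presentation) presented_spanned:
  assumes "c \<in> cells (presented X R)"
  shows "c \<in> spanned (presented X R) ((\<lambda>x. cls (Gen x)) ` X)"
proof -
  obtain t where t: "t \<approx> t" "c = cls t" using assms by (rule cellsE)
  have "t \<approx> t \<Longrightarrow> cls t \<in> spanned (presented X R) ((\<lambda>x. cls (Gen x)) ` X)" for t
  proof (induction t)
    case (Gen x)
    then have "x \<in> X" using well_formed[OF Gen] by simp
    then show ?case by (blast intro: spanned.base)
  next
    case (Bd \<alpha> n t)
    then have "t \<approx> t" using well_formed[OF Bd.prems] by simp
    then show ?case using spanned.bd[OF Bd.IH] by (simp add: bd_cls)
  next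
    case (Cmp n t u)
    note w = CmpD[OF Cmp.prems]
    have "cmp (presented X R) n (cls t) (cls u) \<in> spanned (presented X R) ((\<lambda>x. cls (Gen x)) ` X)"
      using w by (intro spanned.cmp Cmp.IH) (simp_all add: composable_cls)
    then show ?case by (simp add: cmp_cls w)
  qed
  then show ?thesis using t by simp
qed

lemma free_spanned:
  assumes "globular_set G" "c \<in> cells (free_ocat G)"
  shows "c \<in> spanned (free_ocat G) (free_unit G ` cells G)"
  using well_formed_presentation.presented_spanned[OF well_formed_presentation_free[OF assms(1)]] assms(2)
  unfolding free_ocat_def free_unit_def by blast

lemma pushout_spanned:
  assumes B: "omega_category B" and C: "omega_category C"
    and f: "omega_functor f A B" and g: "omega_functor g A C" and c: "c \<in> cells (pushout A f B g C)"
  shows "c \<in> spanned (pushout A f B g C) (pushout_in A f B g C ` (Inl ` cells B \<union> Inr ` cells C))"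
proof -
  have "well_formed_presentation (Inl ` cells B \<union> Inr ` cells C) (pushout_rels A f B g C)"
    by (rule well_formed_presentation_pushout[OF B C functor_cell[OF f] functor_cell[OF g]])
  from well_formed_presentation.presented_spanned[OF this] c
  show ?thesis unfolding pushout_def pushout_in_def by blast
qed

locale neg_path =
  fixes C :: "'a ocat"
  assumes C: "omega_category C" and nc: "non_contracting C"
begin

text \<open>Each path has a class in the negative semi-path omega-category; the other leg of the pushout is
  determined by these classes (\<open>proj_class\<close>).\<close>

definition proj :: "'a \<Rightarrow> ('a set cterm set + 'a) cterm set" where
  "proj x = pushout_in (free_ocat (forget (path_ocat C)))
       (free_map (neg_quot C) (neg_class C)) (free_ocat (neg_quot C))
       (counit (path_ocat C)) (path_ocat C) (Inr x)"

lemmas P = omega_category_path[OF C nc]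
lemmas quot = globular_set_neg_quot[OF C nc]
lemmas forgetP = globular_set_forget[OF P]
lemmas free_phi = omega_functor_free_map[OF forgetP quot]
lemmas eta = omega_functor_counit[OF P]
lemmas freeQ = omega_category_free[OF quot(1)]

lemma free_unit_cell: "x \<in> cells (path_ocat C) \<Longrightarrow> free_unit (forget (path_ocat C)) x \<in> cells (free_ocat (forget (path_ocat C)))"
  using glob_map_free_unit[OF forgetP] by (simp add: glob_map_def)

lemma proj_functor: "omega_functor proj (path_ocat C) (neg_path_ocat C)"
  unfolding proj_def neg_path_ocat_def by (rule pushout_square(2)[OF freeQ P free_phi(1) eta(1)])

text \<open>Commutativity of the pushout square on the generators of the free omega-category.\<close>

lemma proj_class:
  assumes "x \<in> cells (path_ocat C)"
  shows "pushout_in (free_ocat (forget (path_ocat C)))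
       (free_map (neg_quot C) (neg_class C)) (free_ocat (neg_quot C))
       (counit (path_ocat C)) (path_ocat C) (Inl (free_unit (neg_quot C) (neg_class C x))) = proj x"
  using pushout_square(3)[OF freeQ P free_phi(1) eta(1) free_unit_cell[OF assms]]
    free_phi(2)[of x] eta(2)[OF assms] assms by (simp add: proj_def)

lemma neg_gen_class:
  assumes "(x, y) \<in> neg_gen C"
  shows "neg_class C x = neg_class C y"
proof -
  have "(x, y) \<in> neg_rel C" using assms unfolding neg_rel_def neg_gen_def by blast
  then show ?thesis unfolding neg_class_def by (rule equiv_class_eq[OF equiv_neg_rel])
qed

lemma proj_neg_gen: "(x, y) \<in> neg_gen C \<Longrightarrow> proj x = proj y"
  using proj_class[of x] proj_class[of y] neg_gen_class[of x y] by (auto simp: neg_gen_def)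

lemma quot_cell: "c \<in> cells (neg_quot C) \<Longrightarrow> \<exists>x\<in>cells (path_ocat C). c = neg_class C x"
  by (auto simp: neg_quot_def neg_class_def elim: quotientE)

lemma neg_path_spanned:
  assumes "c \<in> cells (neg_path_ocat C)"
  shows "c \<in> spanned (neg_path_ocat C) (proj ` cells (path_ocat C))"
proof -
  let ?in = "pushout_in (free_ocat (forget (path_ocat C)))
       (free_map (neg_quot C) (neg_class C)) (free_ocat (neg_quot C)) (counit (path_ocat C)) (path_ocat C)"
  let ?D = "neg_path_ocat C" and ?S = "proj ` cells (path_ocat C)"
  have l: "omega_functor (\<lambda>x. ?in (Inl x)) (free_ocat (neg_quot C)) ?D"
    unfolding neg_path_ocat_def by (rule pushout_square(1)[OF freeQ P free_phi(1) eta(1)])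
  have fu: "free_unit (neg_quot C) ` cells (neg_quot C) \<subseteq> cells (free_ocat (neg_quot C))"
    using glob_map_free_unit[OF quot(1)] by (auto simp: glob_map_def)
  have "?in (Inl d) \<in> spanned ?D ?S" if d: "d \<in> cells (free_ocat (neg_quot C))" for d
  proof (rule spanned_trans)
    show "?in (Inl d) \<in> spanned ?D ((\<lambda>x. ?in (Inl x)) ` free_unit (neg_quot C) ` cells (neg_quot C))"
      by (rule functor_spanned[OF freeQ fu l free_spanned[OF quot(1) d]])
    show "(\<lambda>x. ?in (Inl x)) ` free_unit (neg_quot C) ` cells (neg_quot C) \<subseteq> spanned ?D ?S"
    proof safe
      fix c assume "c \<in> cells (neg_quot C)"
      then obtain x where "x \<in> cells (path_ocat C)" "c = neg_class C x" using quot_cell by blast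
      then show "?in (Inl (free_unit (neg_quot C) c)) \<in> spanned ?D ?S"
        using proj_class by (auto intro: spanned.base)
    qed
  qed
  moreover have "?in (Inr x) \<in> spanned ?D ?S" if "x \<in> cells (path_ocat C)" for x
    using that by (auto simp: proj_def intro: spanned.base)
  ultimately have "?in ` (Inl ` cells (free_ocat (neg_quot C)) \<union> Inr ` cells (path_ocat C)) \<subseteq> spanned ?D ?S"
    by blast
  with pushout_spanned[OF freeQ P free_phi(1) eta(1)] assms show ?thesis
    unfolding neg_path_ocat_def by (blast intro: spanned_trans)
qed

text \<open>On the free omega-category of the quotient take the functor induced by \<open>T\<close>. The two functors on the
  free omega-category of all paths agree, since they do on its generators.\<close>

lemma neg_path_universal:
  assumes E: "omega_category E" and T: "omega_functor T (path_ocat C) E"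
    and const: "\<And>x y. (x, y) \<in> neg_gen C \<Longrightarrow> T x = T y"
  obtains T' where "omega_functor T' (neg_path_ocat C) E" "\<And>x. x \<in> cells (path_ocat C) \<Longrightarrow> T' (proj x) = T x"
proof -
  have rel: "T x = T y" if "(x, y) \<in> neg_rel C" for x y
  proof -
    have "(x, y) \<in> (neg_gen C \<union> (neg_gen C)\<inverse>)\<^sup>*" using that by (simp add: neg_rel_def)
    then show ?thesis
    proof (induction rule: rtrancl_induct)
      case (step y z)
      then have "T y = T z" using const[of y z] const[of z y] by auto
      then show ?case using step.IH by simp
    qed simp
  qed
  define U where "U c = the_elem (T ` c)" for c
  have U: "U (neg_class C x) = T x" if x: "x \<in> cells (path_ocat C)" for x
  proof -
    have "(x, x) \<in> neg_rel C" using x by (simp add: neg_rel_def)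
    then have "x \<in> neg_class C x" by (simp add: neg_class_def)
    moreover have "T y = T x" if "y \<in> neg_class C x" for y
      using rel[of x y] that by (simp add: neg_class_def)
    ultimately show ?thesis unfolding U_def by (intro the_elem_image_unique) blast+
  qed
  have Ug: "glob_map U (neg_quot C) (forget E)"
    unfolding glob_map_def
  proof (intro ballI conjI allI)
    fix c \<alpha> n assume "c \<in> cells (neg_quot C)"
    then obtain x where x: "x \<in> cells (path_ocat C)" "c = neg_class C x" using quot_cell by blast
    show "U c \<in> cells (forget E)" using x U functor_cell[OF T] by simp
    have "bd (path_ocat C) \<alpha> n x \<in> cells (path_ocat C)" using x(1) by (rule omega_categoryD(3)[OF P])
    then show "U (bd (neg_quot C) \<alpha> n c) = bd (forget E) \<alpha> n (U c)"
      using x U functor_bd[OF T x(1)] bd_neg_class[OF C nc x(1)] by simp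
  qed
  note u = free_universal[OF quot(1) E Ug]
  have Tg: "glob_map T (forget (path_ocat C)) (forget E)"
    using T by (simp add: omega_functor_def glob_map_def)
  note t = free_universal(3)[OF forgetP E Tg]
  have hk: "lift E U (free_map (neg_quot C) (neg_class C) a) = T (counit (path_ocat C) a)"
    if a: "a \<in> cells (free_ocat (forget (path_ocat C)))" for a
  proof -
    have "lift E U (free_map (neg_quot C) (neg_class C) a) = lift E T a"
    proof (rule t[OF functor_comp[OF free_phi(1) u(1)] _ a])
      fix x assume x: "x \<in> cells (forget (path_ocat C))"
      then have "neg_class C x \<in> cells (neg_quot C)" using quot(2) by (simp add: glob_map_def)
      then show "lift E U (free_map (neg_quot C) (neg_class C) (free_unit (forget (path_ocat C)) x)) = T x"
        using free_phi(2)[OF x] u(2) U x by simp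
    qed
    moreover have "T (counit (path_ocat C) a) = lift E T a"
    proof (rule t[OF functor_comp[OF eta(1) T] _ a])
      fix x assume x: "x \<in> cells (forget (path_ocat C))"
      then show "T (counit (path_ocat C) (free_unit (forget (path_ocat C)) x)) = T x" using eta(2) by simp
    qed
    ultimately show ?thesis by simp
  qed
  note p = pushout_universal[OF freeQ P free_phi(1) eta(1) E u(1) T hk]
  show ?thesis
  proof (rule that)
    show "omega_functor (lift E (case_sum (lift E U) T)) (neg_path_ocat C) E"
      unfolding neg_path_ocat_def by (rule p(1))
    show "lift E (case_sum (lift E U) T) (proj x) = T x" if "x \<in> cells (path_ocat C)" for x
      unfolding proj_def by (rule p(3)[OF _ that])
  qed
qed

end

section \<open>The functor from semi-paths to simplices\<close>

lemma (in face_complex) cell_nonempty: "X \<in> cells C \<Longrightarrow> X \<noteq> {}"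
  by (induction rule: cell_induct) (use sub_refl in auto)

lemma gray_simplex_face: "x \<in> simplex_faces n \<Longrightarrow> 0 \<le> gray x \<and> gray x \<le> 1"
  using gray_bounds[of x 0] by (simp add: face_list)

definition vertices :: "nat \<Rightarrow> nat \<Rightarrow> letter list set" where
  "vertices N p = {v. length v = N \<and> cube_dim v = 0 \<and> count_list v (Sgn Minus) = p}"

lemma vertices_card: "finite (vertices N p) \<and> card (vertices N p) = N choose p"
proof (induction N arbitrary: p)
  case 0
  have "vertices 0 p = (if p = 0 then {[]} else {})" by (auto simp: vertices_def cube_dim_def)
  then show ?case by (cases p) auto
next
  case (Suc N)
  have split: "vertices (Suc N) p = (#) (Sgn Plus) ` vertices N p \<union>
      (if p = 0 then {} else (#) (Sgn Minus) ` vertices N (p - 1))" (is "_ = ?A \<union> ?B")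
  proof (rule set_eqI)
    fix v
    show "v \<in> vertices (Suc N) p \<longleftrightarrow> v \<in> ?A \<union> ?B"
    proof (cases v)
      case Nil
      then show ?thesis by (auto simp: vertices_def)
    next
      case (Cons a u)
      have "a = Sgn Minus \<or> a = Sgn Plus \<or> a = Zero" by (metis letter.exhaust sign.exhaust)
      then show ?thesis using Cons by (elim disjE) (auto simp: vertices_def cube_dim_def image_iff)
    qed
  qed
  have fin: "finite ?A" "finite ?B" using Suc.IH by auto
  have "card ?A = N choose p" using Suc.IH by (simp add: card_image)
  moreover have "card ?B = (if p = 0 then 0 else N choose (p - 1))" using Suc.IH by (simp add: card_image)
  moreover have "?A \<inter> ?B = {}" by auto
  ultimately have "card (?A \<union> ?B) = (N choose p) + (if p = 0 then 0 else N choose (p - 1))"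
    using card_Un_disjoint[OF fin] by simp
  also have "\<dots> = Suc N choose p" by (cases p) auto
  finally show ?case unfolding split using fin by blast
qed

lemma vertices_enum: "\<exists>e. \<forall>p. bij_betw (e p) (vertices N p) {..<N choose p}"
proof -
  have "\<exists>h. bij_betw h (vertices N p) {..<N choose p}" for p
    using vertices_card[of N p] ex_bij_betw_finite_nat[of "vertices N p"] by (simp add: atLeast0LessThan)
  then show ?thesis by metis
qed

lemma init_in_vertices: "w \<in> cube_faces N \<Longrightarrow> init w \<in> vertices N (count_list (init w) (Sgn Minus))"
  by (simp add: vertices_def cube_faces_def init_dim) (simp add: init_def)

lemma dim_zeros: "0 < cube_dim w \<Longrightarrow> simplex_dim (zeros 0 w) = cube_dim w - 1"
  by (simp add: simplex_dim_def length_zeros)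

text \<open>The largest face with initial vertex \<open>v\<close> has a zero at each negative coordinate of \<open>v\<close>; its germ is the
  whole simplex.\<close>

lemma face_of_vertex:
  assumes v: "v \<in> vertices N p" and y: "y \<in> simplex_faces (p - 1)" and p: "0 < p"
  obtains w where "w \<in> cube_faces N" "0 < cube_dim w" "init w = v" "zeros 0 w = y"
proof -
  define w where "w = map (\<lambda>a. if a = Sgn Minus then Zero else a) v"
  have nz: "Zero \<notin> set v" using v by (simp add: vertices_def cube_dim_0)
  have i: "init w = v" using nz by (auto simp: w_def init_def intro!: map_idI)
  have "zeros k w = [k..<k + count_list v (Sgn Minus)]" for k
    unfolding w_def using nz
  proof (induction v arbitrary: k)
    case (Cons a v)
    have "a = Sgn Minus \<or> a = Sgn Plus" using Cons.prems by (metis letter.exhaust sign.exhaust list.set_intros(1))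
    moreover have "k # [Suc k..<Suc k + c] = [k..<k + Suc c]" for c
      by (simp add: upt_conv_Cons del: upt_Suc)
    ultimately show ?case using Cons by (elim disjE) (simp_all del: upt_Suc)
  qed simp
  then have z: "zeros 0 w = [0..<p]" using v by (simp add: vertices_def)
  have "y \<in> simplex_sub [0..<p]"
  proof -
    have "set y \<subseteq> {0..<p}" using y p by (auto simp: face_list subset_iff)
    then show ?thesis using y by (simp add: simplex_sub_iff face_list)
  qed
  then have "y \<in> germ v (cube_sub w)" using germ_sub[of w] i z by simp
  then obtain u where u: "u \<in> cube_sub w" "init u = v" "0 < cube_dim u" "zeros 0 u = y" by (auto simp: germ_def)
  moreover have "length u = N" using u(1) v by (simp add: cube_sub_nth w_def vertices_def)
  ultimately show ?thesis using that by (simp add: cube_faces_def)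
qed

text \<open>\<open>e p\<close> numbers the vertices with \<open>p\<close> negative coordinates.\<close>

locale corner =
  fixes N :: nat and I :: "letter list set ocat" and \<Delta> :: "nat \<Rightarrow> nat list set ocat" and e :: "nat \<Rightarrow> letter list \<Rightarrow> nat"
  assumes cube: "is_cube N I" and simplex: "is_simplex k (\<Delta> k)"
    and enum: "bij_betw (e p) (vertices N p) {..<N choose p}"
begin

sublocale I: cube N I
  by unfold_locales (rule cube)

sublocale P: neg_path I
  using I.D I.non_contracting by unfold_locales

lemma S: "face_complex (simplex_faces k) simplex_sub simplex_dim simplex_bdy (\<Delta> k)"
  by (rule simplex_face_complex[OF simplex])

definition E where
  "E = coprod {1..N} (\<lambda>p. coprod {..<N choose p} (\<lambda>_. \<Delta> (p - 1)))"

text \<open>The set \<open>Y\<close> of simplex faces, placed in the summand of the coproduct that belongs to \<open>v\<close>.\<close>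

definition corner_cell :: "letter list \<Rightarrow> nat list set \<Rightarrow> nat \<times> nat \<times> nat list set" where
  "corner_cell v Y = (let p = count_list v (Sgn Minus) in (p, e p v, Y))"

definition initial_germ :: "letter list set \<Rightarrow> nat \<times> nat \<times> nat list set" where
  "initial_germ X = (let v = the_elem (src I 0 X) in corner_cell v (germ v X))"

lemma Delta: "omega_category (\<Delta> k)"
  using S[of k] by (simp add: face_complex.C[THEN face_ocat_def[THEN iffD1], THEN conjunct1])

lemma omega_category_E: "omega_category E"
  unfolding E_def by (intro omega_category_coprod Delta)

lemma corner_cell_cell:
  assumes "v \<in> vertices N p" "0 < p" "Y \<in> cells (\<Delta> (p - 1))"
  shows "corner_cell v Y \<in> cells E"
proof -
  have "p \<le> N" using assms(1) count_le_length[of v "Sgn Minus"] by (auto simp: vertices_def)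
  moreover have "e p v < N choose p" using enum[of p] assms(1) by (auto simp: bij_betw_def)
  ultimately show ?thesis using assms by (simp add: E_def corner_cell_def vertices_def)
qed

lemma corner_cell_bd: "bd E \<alpha> k (corner_cell v Y) = corner_cell v (bd (\<Delta> (count_list v (Sgn Minus) - 1)) \<alpha> k Y)"
  by (simp add: E_def corner_cell_def Let_def)

lemma corner_cell_cmp: "cmp E k (corner_cell v Y) (corner_cell v Z) = corner_cell v (cmp (\<Delta> (count_list v (Sgn Minus) - 1)) k Y Z)"
  by (simp add: E_def corner_cell_def Let_def)

lemma corner_cell_cases:
  assumes "c \<in> cells E"
  obtains p v Y where "v \<in> vertices N p" "0 < p" "Y \<in> cells (\<Delta> (p - 1))" "c = corner_cell v Y"
proof -
  obtain p j Y where c: "c = (p, j, Y)" by (metis surj_pair)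
  have pj: "p \<in> {1..N}" "j < N choose p" "Y \<in> cells (\<Delta> (p - 1))" using assms by (simp_all add: E_def c)
  have "j \<in> e p ` vertices N p" using enum[of p] pj(2) by (simp add: bij_betw_def)
  then obtain v where v: "v \<in> vertices N p" "e p v = j" by blast
  then have "c = corner_cell v Y" by (simp add: c corner_cell_def vertices_def)
  then show ?thesis using that v pj by simp
qed

lemma corner_cell_inj:
  assumes "v \<in> vertices N p" "u \<in> vertices N p'" "corner_cell v Y = corner_cell u Z"
  shows "v = u \<and> Y = Z"
proof -
  have c: "count_list v (Sgn Minus) = p" "count_list u (Sgn Minus) = p'" using assms by (simp_all add: vertices_def)
  have "(p, e p v, Y) = (p', e p' u, Z)" using assms(3) unfolding corner_cell_def Let_def c .
  then have "p = p'" "e p v = e p u" "Y = Z" by auto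
  then show ?thesis using enum[of p] assms(1,2) by (auto simp: bij_betw_def inj_on_def)
qed

lemma path_cell:
  assumes X: "X \<in> cells (path_ocat I)"
  obtains v p where "src I 0 X = {v}" "v \<in> vertices N p" "0 < p" "initial_germ X = corner_cell v (germ v X)"
    "germ v X \<in> cells (\<Delta> (p - 1))" "\<And>\<alpha> k. germ v (bd I \<alpha> (Suc k) X) = bd (\<Delta> (p - 1)) \<alpha> k (germ v X)"
proof -
  have XI: "X \<in> cells I" "\<not> I.flat 0 X" using X I.path_cell_iff by blast+
  obtain v b where v: "src I 0 X = {v}" "tgt I 0 X = {b}" "\<forall>w\<in>X. vertex_le v (init w) \<and> vertex_le (final w) b"
    using I.endpoints[OF XI(1)] by blast
  have vb: "v \<in> X" "cube_dim v = 0" "b \<in> X" "cube_dim b = 0"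
    using I.bd_subset[OF XI(1), of Minus 0] I.bd_dim[OF XI(1), of v Minus 0]
      I.bd_subset[OF XI(1), of Plus 0] I.bd_dim[OF XI(1), of b Plus 0] v by auto
  have len: "length v = N" using I.cell_F[OF XI(1)] vb(1) by (auto simp: cube_faces_def)
  define p where "p = count_list v (Sgn Minus)"
  have vert: "v \<in> vertices N p" using vb len by (simp add: vertices_def p_def)
  have "0 < p"
  proof (rule ccontr)
    assume "\<not> 0 < p"
    then have "Sgn Minus \<notin> set v" by (simp add: p_def count_list_0_iff)
    moreover have "vertex_le v b" using v(3) vb(3,4) init_vertex[of b] by force
    ultimately have "v = b" unfolding vertex_le_def by (auto simp: list_all2_conv_all_nth intro!: nth_equalityI) (metis nth_mem)
    then show False using v I.flat_0_iff[OF XI(1)] XI(2) by simp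
  qed
  have "initial_germ X = corner_cell v (germ v X)" using v(1) by (simp add: initial_germ_def)
  moreover have "germ v X \<in> cells (\<Delta> (p - 1)) \<and> (\<forall>\<alpha> k. germ v (bd I \<alpha> (Suc k) X) = bd (\<Delta> (p - 1)) \<alpha> k (germ v X))"
    using germ_functor[OF cube simplex XI(1) X v(1)] unfolding p_def .
  ultimately show ?thesis using that[OF v(1) vert \<open>0 < p\<close>] by blast
qed

lemma initial_germ_functor: "omega_functor initial_germ (path_ocat I) E"
  unfolding omega_functor_def glob_map_def
proof (intro conjI ballI allI impI)
  fix X \<alpha> k assume X: "X \<in> cells (path_ocat I)"
  obtain v p where v: "src I 0 X = {v}" "v \<in> vertices N p" "0 < p" "initial_germ X = corner_cell v (germ v X)"
    "germ v X \<in> cells (\<Delta> (p - 1))" "\<And>\<alpha> k. germ v (bd I \<alpha> (Suc k) X) = bd (\<Delta> (p - 1)) \<alpha> k (germ v X)"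
    using path_cell[OF X] by metis
  show "initial_germ X \<in> cells E" unfolding v(4) by (rule corner_cell_cell[OF v(2,3,5)])
  have "src I 0 (bd I \<alpha> (Suc k) X) = {v}" using v(1) I.src_flat(2)[of X "Suc k"] X I.path_cell_iff by simp
  then show "initial_germ (bd (path_ocat I) \<alpha> k X) = bd E \<alpha> k (initial_germ X)"
    using v by (simp add: initial_germ_def path_simps corner_cell_bd vertices_def)
next
  fix k X Y assume XY: "composable (path_ocat I) k X Y"
  have c: "composable I (Suc k) X Y" using XY by (rule path_composableD)
  have X: "X \<in> cells (path_ocat I)" "Y \<in> cells (path_ocat I)" using XY by (simp_all add: composable_def)
  obtain v p where v: "src I 0 X = {v}" "v \<in> vertices N p" "0 < p" "initial_germ X = corner_cell v (germ v X)"
    "germ v X \<in> cells (\<Delta> (p - 1))" "\<And>\<alpha> k. germ v (bd I \<alpha> (Suc k) X) = bd (\<Delta> (p - 1)) \<alpha> k (germ v X)"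
    using path_cell[OF X(1)] by metis
  obtain u r where u: "src I 0 Y = {u}" "u \<in> vertices N r" "0 < r" "initial_germ Y = corner_cell u (germ u Y)"
    "germ u Y \<in> cells (\<Delta> (r - 1))" "\<And>\<alpha> k. germ u (bd I \<alpha> (Suc k) Y) = bd (\<Delta> (r - 1)) \<alpha> k (germ u Y)"
    using path_cell[OF X(2)] by metis
  have uv: "u = v" using I.bd_eq_below[OF c, of 0 Minus] u(1) v(1) by simp
  have p: "r = p" "count_list v (Sgn Minus) = p" using u(2) v(2) uv by (simp_all add: vertices_def)
  have "composable (\<Delta> (p - 1)) k (germ v X) (germ v Y)"
    using u(5) v(5) u(6)[of Minus k] v(6)[of Plus k] I.composable_eq[OF c] uv p by (simp add: composable_def)
  then have "cmp (\<Delta> (p - 1)) k (germ v X) (germ v Y) = germ v (X \<union> Y)"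
    unfolding germ_Un by (rule face_complex.cmp_Un[OF S])
  moreover have "initial_germ (cmp I (Suc k) X Y) = corner_cell v (germ v (X \<union> Y))"
    using I.bd_cmp_below[OF c, of 0 Minus] v(1) I.cmp_Un[OF c] by (simp add: initial_germ_def)
  ultimately show "initial_germ (cmp (path_ocat I) k X Y) = cmp E k (initial_germ X) (initial_germ Y)"
    using u(4) v(4) uv p by (simp add: path_simps corner_cell_cmp)
qed

lemma initial_germ_neg_gen: "(X, Y) \<in> neg_gen I \<Longrightarrow> initial_germ X = initial_germ Y"
proof -
  assume "(X, Y) \<in> neg_gen I"
  then obtain Z where Z: "Y = cmp I 0 X Z" "composable I 0 X Z" "X \<in> cells (path_ocat I)"
    unfolding neg_gen_def by blast
  obtain v where v: "src I 0 X = {v}" using path_cell[OF Z(3)] by metis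
  have nf: "\<not> I.flat 0 X" using Z(3) I.path_cell_iff by blast
  have Y: "Y = X \<union> Z" "src I 0 Y = {v}" using Z v I.cmp_Un[OF Z(2)] I.src_cmp[OF Z(2)] by simp_all
  have "germ v Z = {}" using I.germ_cmp_0[OF Z(2) nf v] by simp
  then have "germ v Y = germ v X" by (simp add: Y(1) germ_Un)
  then show "initial_germ X = initial_germ Y" using v Y(2) by (simp add: initial_germ_def)
qed

end

section \<open>The isomorphism\<close>

context corner begin

abbreviation "D \<equiv> neg_path_ocat I"

lemma omega_category_D: "omega_category D"
  by (rule omega_category_neg_path[OF I.D I.non_contracting])

definition germs :: "(letter list set set cterm set + letter list set) cterm set \<Rightarrow> nat \<times> nat \<times> nat list set" where
  "germs = (SOME T. omega_functor T D E \<and> (\<forall>X\<in>cells (path_ocat I). T (P.proj X) = initial_germ X))"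

lemma germs: "omega_functor germs D E" "X \<in> cells (path_ocat I) \<Longrightarrow> germs (P.proj X) = initial_germ X"
proof -
  have "\<exists>T. omega_functor T D E \<and> (\<forall>X\<in>cells (path_ocat I). T (P.proj X) = initial_germ X)"
    using P.neg_path_universal[OF omega_category_E initial_germ_functor initial_germ_neg_gen] by metis
  from someI_ex[OF this, folded germs_def]
  show "omega_functor germs D E" "X \<in> cells (path_ocat I) \<Longrightarrow> germs (P.proj X) = initial_germ X" by blast+
qed

definition faces :: "letter list set" where
  "faces = {w \<in> cube_faces N. 0 < cube_dim w}"

definition atom_class :: "letter list \<Rightarrow> (letter list set set cterm set + letter list set) cterm set" where
  "atom_class w = P.proj (cube_sub w)"

lemma atom_path: "w \<in> faces \<Longrightarrow> cube_sub w \<in> cells (path_ocat I)"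
proof -
  assume w: "w \<in> faces"
  then have "w \<in> cube_faces N" "0 < cube_dim w" by (simp_all add: faces_def)
  then show ?thesis using I.path_cell_iff I.sub_cell I.sub_refl I.flat_dim[of 0 "cube_sub w" w] by auto
qed

lemma germs_atom:
  assumes "w \<in> faces"
  shows "germs (atom_class w) = corner_cell (init w) (simplex_sub (zeros 0 w))"
proof -
  have "src I 0 (cube_sub w) = {init w}" using I.atom_ends assms by (simp add: faces_def)
  then show ?thesis using germs(2)[OF atom_path[OF assms]] by (simp add: atom_class_def initial_germ_def germ_sub)
qed

text \<open>Along \<open>*\<^sub>0\<close> the second factor is forgotten, and all other compositions are compositions of paths.\<close>

lemma proj_generated:
  assumes "X \<in> cells I"
  shows "X \<in> cells (path_ocat I) \<Longrightarrow> P.proj X \<in> generated D (atom_class ` faces)"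
  using assms
proof (induction rule: I.cell_induct)
  case (atom w)
  have "0 < cube_dim w"
    using atom.prems I.flat_sub[OF atom.hyps] I.path_cell_iff by (cases "cube_dim w") auto
  then have "w \<in> faces" using atom.hyps by (simp add: faces_def)
  then show ?case by (auto simp: atom_class_def intro: generated.base)
next
  case (comp m A B)
  have AB: "A \<in> cells I" "B \<in> cells I" using I.composable_cells comp.hyps by blast+
  note cU = I.cmp_Un[OF comp.hyps]
  show ?case
  proof (cases m)
    case 0
    consider "I.flat 0 A" | "\<not> I.flat 0 A" "I.flat 0 B" | "\<not> I.flat 0 A" "\<not> I.flat 0 B" by blast
    then show ?thesis
    proof cases
      case 1
      then have "A \<union> B = B" using I.cmp_flat_left[OF comp.hyps] 0 cU by simp
      then show ?thesis using comp by simp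
    next
      case 2
      then have "A \<union> B = A" using I.cmp_flat_right[OF comp.hyps] 0 cU by simp
      then show ?thesis using comp by simp
    next
      case 3
      have "(A, A \<union> B) \<in> neg_gen I"
        unfolding neg_gen_def using comp.hyps comp.prems 3 AB 0 cU I.path_cell_iff
        by (auto intro!: exI[of _ A] exI[of _ B])
      then have "P.proj (A \<union> B) = P.proj A" using P.proj_neg_gen by metis
      then show ?thesis using comp.IH(1) 3(1) AB(1) I.path_cell_iff by simp
    qed
  next
    case (Suc k)
    have e: "bd I \<alpha> 0 A = bd I \<alpha> 0 B" "bd I \<alpha> 0 (A \<union> B) = bd I \<alpha> 0 A" for \<alpha>
      using I.bd_eq_below[OF comp.hyps, of 0] I.bd_Un[OF comp.hyps, of 0] Suc by simp_all
    have C: "A \<union> B \<in> cells I" "\<not> I.flat 0 (A \<union> B)" using comp.prems(1) I.path_cell_iff by blast+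
    have ABp: "A \<in> cells (path_ocat I)" "B \<in> cells (path_ocat I)"
      using C I.flat_0_iff AB e by (simp_all add: I.path_cell_iff)
    have c: "composable (path_ocat I) k A B"
      using ABp comp.hyps Suc by (simp add: composable_def path_simps)
    have "P.proj (A \<union> B) = cmp D k (P.proj A) (P.proj B)"
      using functor_cmp[OF P.proj_functor c] cU Suc by (simp add: path_simps)
    then show ?thesis
      using generated.comp[OF comp.IH(1)[OF ABp(1)] comp.IH(2)[OF ABp(2)] functor_composable[OF P.proj_functor c]] by simp
  qed
qed

lemma D_generated: "c \<in> cells D \<Longrightarrow> c \<in> generated D (atom_class ` faces)"
proof -
  assume "c \<in> cells D"
  then have "c \<in> spanned D (P.proj ` cells (path_ocat I))" by (rule P.neg_path_spanned)
  then show ?thesis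
  proof (induction rule: spanned.induct)
    case (base x)
    then show ?case using proj_generated I.path_cell_iff by blast
  next
    case (bd x \<alpha> n)
    from bd.IH show ?case
    proof (induction rule: generated.induct)
      case (base x)
      then obtain w where w: "w \<in> faces" "x = P.proj (cube_sub w)" by (auto simp: atom_class_def)
      have "bd D \<alpha> n x = P.proj (bd (path_ocat I) \<alpha> n (cube_sub w))"
        using functor_bd[OF P.proj_functor atom_path[OF w(1)]] w(2) by simp
      moreover have "bd (path_ocat I) \<alpha> n (cube_sub w) \<in> cells (path_ocat I)"
        by (rule omega_categoryD(3)[OF P.P atom_path[OF w(1)]])
      ultimately show ?case using proj_generated I.path_cell_iff by simp
    next
      case (comp x y m)
      note c = comp.hyps(3)
      show ?case
      proof (cases "n = m")
        case True
        then show ?thesis using comp.IH omega_categoryD(8,9)[OF omega_category_D c] by (cases \<alpha>) simp_all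
      next
        case False
        then show ?thesis using generated.comp[OF comp.IH composable_bd[OF omega_category_D c False]]
            omega_categoryD(10)[OF omega_category_D c False] by simp
      qed
    qed
  next
    case (cmp x y n)
    show ?case by (rule generated.comp[OF cmp.IH cmp.hyps(3)])
  qed
qed

text \<open>The faces of the cube that correspond to the simplex faces in a cell of the coproduct. They recover
  the cell (\<open>faces_over_inj\<close>) and serve as the support of the cells that are mapped to it.\<close>

definition faces_over :: "nat \<times> nat \<times> nat list set \<Rightarrow> letter list set" where
  "faces_over c = {w \<in> faces. \<exists>Y. c = corner_cell (init w) Y \<and> zeros 0 w \<in> Y}"

lemma init_vertices: "w \<in> faces \<Longrightarrow> init w \<in> vertices N (count_list (init w) (Sgn Minus))"
  using init_in_vertices by (simp add: faces_def)

lemma faces_over_corner_cell: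
  assumes "v \<in> vertices N p"
  shows "faces_over (corner_cell v Y) = {w \<in> faces. init w = v \<and> zeros 0 w \<in> Y}"
  unfolding faces_over_def using corner_cell_inj[OF assms init_vertices] by blast

lemma faces_over_zeros:
  assumes v: "v \<in> vertices N p" "0 < p" and Y: "Y \<in> cells (\<Delta> (p - 1))"
  shows "zeros 0 ` faces_over (corner_cell v Y) = Y" "faces_over (corner_cell v Y) \<noteq> {}"
proof -
  interpret S: face_complex "simplex_faces (p - 1)" simplex_sub simplex_dim simplex_bdy "\<Delta> (p - 1)"
    by (rule S)
  have "\<exists>w\<in>faces. init w = v \<and> zeros 0 w = y" if "y \<in> Y" for y
  proof -
    have "y \<in> simplex_faces (p - 1)" using S.cell_F[OF Y] that by blast
    then show ?thesis using face_of_vertex[OF v(1) _ v(2)] unfolding faces_def by blast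
  qed
  then show z: "zeros 0 ` faces_over (corner_cell v Y) = Y" unfolding faces_over_corner_cell[OF v(1)] by blast
  show "faces_over (corner_cell v Y) \<noteq> {}" using z S.cell_nonempty[OF Y] by auto
qed

lemma faces_over_inj: "inj_on faces_over (cells E)"
proof (rule inj_onI)
  fix c d assume cd: "c \<in> cells E" "d \<in> cells E" "faces_over c = faces_over d"
  obtain p v Y where c: "v \<in> vertices N p" "0 < p" "Y \<in> cells (\<Delta> (p - 1))" "c = corner_cell v Y"
    using corner_cell_cases[OF cd(1)] .
  obtain r u Z where d: "u \<in> vertices N r" "0 < r" "Z \<in> cells (\<Delta> (r - 1))" "d = corner_cell u Z"
    using corner_cell_cases[OF cd(2)] .
  obtain w where "w \<in> faces_over c" using faces_over_zeros(2)[OF c(1-3)] c(4) by blast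
  then have "w \<in> faces_over (corner_cell v Y)" "w \<in> faces_over (corner_cell u Z)" using cd(3) c(4) d(4) by simp_all
  then have "u = v" by (simp add: faces_over_corner_cell[OF c(1)] faces_over_corner_cell[OF d(1)])
  moreover have "Y = Z" using faces_over_zeros(1)[OF c(1-3)] faces_over_zeros(1)[OF d(1-3)] cd(3) c(4) d(4) by simp
  ultimately show "c = d" using c(4) d(4) by simp
qed

definition vertex_code :: "letter list \<Rightarrow> nat" where
  "vertex_code = (SOME f. inj_on f (init ` faces))"

lemma vertex_code_inj: "inj_on vertex_code (init ` faces)"
proof -
  have "init ` faces \<subseteq> (\<Union>p\<in>{..N}. vertices N p)"
  proof
    fix v assume "v \<in> init ` faces"
    then have v: "v \<in> vertices N (count_list v (Sgn Minus))" using init_vertices by blast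
    moreover have "count_list v (Sgn Minus) \<le> N" using v count_le_length[of v "Sgn Minus"] by (simp add: vertices_def)
    ultimately show "v \<in> (\<Union>p\<in>{..N}. vertices N p)" by blast
  qed
  moreover have "finite (\<Union>p\<in>{..N}. vertices N p)" using vertices_card by blast
  ultimately have "finite (init ` faces)" by (rule finite_subset)
  then have "\<exists>f :: letter list \<Rightarrow> nat. inj_on f (init ` faces)" using finite_imp_inj_to_nat_seg by metis
  from someI_ex[OF this] show ?thesis unfolding vertex_code_def .
qed

text \<open>Only faces with a common initial vertex have to be compared by the Gray order. Its values lie between
  0 and 1, so that twice a number of the initial vertex makes the rank injective.\<close>

definition face_rank :: "letter list \<Rightarrow> real" where
  "face_rank w = 2 * real (vertex_code (init w)) + gray (zeros 0 w)"

lemma face_rank_inj: "inj_on face_rank faces"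
proof (rule inj_onI)
  fix u w assume uw: "u \<in> faces" "w \<in> faces" "face_rank u = face_rank w"
  have g: "0 \<le> gray (zeros 0 x) \<and> gray (zeros 0 x) \<le> 1" if "x \<in> faces" for x
    using gray_simplex_face[OF zeros_face[of x]] that by (simp add: faces_def)
  have "\<bar>real (vertex_code (init u)) - real (vertex_code (init w))\<bar> < 1"
    using uw(3) g[OF uw(1)] g[OF uw(2)] unfolding face_rank_def by linarith
  then have c: "vertex_code (init u) = vertex_code (init w)" by linarith
  then have i: "init u = init w" using vertex_code_inj uw(1,2) by (auto simp: inj_on_def)
  have "gray (zeros 0 u) = gray (zeros 0 w)" using uw(3) c unfolding face_rank_def by simp
  then have "zeros 0 u = zeros 0 w" using gray_inj zeros_sorted by blast
  then show "u = w" by (rule zeros_inj[OF i])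
qed

lemma germs_cell: "c \<in> cells D \<Longrightarrow> germs c \<in> cells E"
  by (rule functor_cell[OF germs(1)])

lemma bd_atom_faces_over:
  assumes w: "w \<in> faces" and u: "u \<in> faces_over (germs (bd D \<alpha> k (atom_class w)))"
  shows "init u = init w" "u \<in> faces"
    "zeros 0 u \<in> bd (\<Delta> (count_list (init w) (Sgn Minus) - 1)) \<alpha> k (simplex_sub (zeros 0 w))"
proof -
  have gw: "atom_class w \<in> cells D" unfolding atom_class_def by (rule functor_cell[OF P.proj_functor atom_path[OF w]])
  have "germs (bd D \<alpha> k (atom_class w)) = corner_cell (init w) (bd (\<Delta> (count_list (init w) (Sgn Minus) - 1)) \<alpha> k (simplex_sub (zeros 0 w)))"
    unfolding functor_bd[OF germs(1) gw] germs_atom[OF w] corner_cell_bd ..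
  then show "init u = init w" "u \<in> faces"
    "zeros 0 u \<in> bd (\<Delta> (count_list (init w) (Sgn Minus) - 1)) \<alpha> k (simplex_sub (zeros 0 w))"
    using u faces_over_corner_cell[OF init_vertices[OF w]] by auto
qed

lemma minus_pos: "w \<in> faces \<Longrightarrow> 0 < count_list (init w) (Sgn Minus)"
  using zeros_sorted[of 0 w] length_zeros[of 0 w] unfolding faces_def count_minus_init
  by (cases "zeros 0 w") auto

lemma atom_class_cell: "w \<in> faces \<Longrightarrow> atom_class w \<in> cells D"
  unfolding atom_class_def by (rule functor_cell[OF P.proj_functor atom_path])

lemma face_rank_bd:
  assumes w: "w \<in> faces" and k: "k < cube_dim w - 1"
    and u: "u \<in> faces_over (germs (bd D \<alpha> k (atom_class w)))" "cube_dim u - 1 = k"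
  shows "case \<alpha> of Minus \<Rightarrow> face_rank u < face_rank w | Plus \<Rightarrow> face_rank w < face_rank u"
proof -
  note b = bd_atom_faces_over[OF w u(1)]
  have "simplex_dim (zeros 0 u) = k" "k < simplex_dim (zeros 0 w)"
    using dim_zeros[of u] dim_zeros[of w] b(2) w k u(2) by (simp_all add: faces_def)
  then have "case \<alpha> of Minus \<Rightarrow> gray (zeros 0 u) < gray (zeros 0 w) | Plus \<Rightarrow> gray (zeros 0 w) < gray (zeros 0 u)"
    using simplex_bd_gray[OF simplex zeros_face _ b(3)] w by (simp add: faces_def)
  then show ?thesis using b(1) by (cases \<alpha>) (simp_all add: face_rank_def)
qed

lemma faces_over_bd_ex:
  assumes w: "w \<in> faces" and k: "k < cube_dim w - 1"
  shows "\<exists>u\<in>faces_over (germs (bd D \<alpha> k (atom_class w))). cube_dim u - 1 = k"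
proof -
  let ?p = "count_list (init w) (Sgn Minus)"
  interpret S: face_complex "simplex_faces (?p - 1)" simplex_sub simplex_dim simplex_bdy "\<Delta> (?p - 1)"
    by (rule S)
  have w': "0 < cube_dim w" using w by (simp add: faces_def)
  have "k < simplex_dim (zeros 0 w)" using dim_zeros[OF w'] k by simp
  then obtain z where z: "z \<in> bd (\<Delta> (?p - 1)) \<alpha> k (simplex_sub (zeros 0 w))" "simplex_dim z = k"
    using simplex_bd_ex[OF simplex zeros_face[OF w']] by blast
  have "z \<in> simplex_faces (?p - 1)"
    using S.cell_F[OF S.bd_cell[OF S.sub_cell[OF zeros_face[OF w']]]] z(1) by blast
  then obtain u where u: "u \<in> cube_faces N" "0 < cube_dim u" "init u = init w" "zeros 0 u = z"
    using face_of_vertex[OF init_vertices[OF w] _ minus_pos[OF w]] by blast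
  have "germs (bd D \<alpha> k (atom_class w)) = corner_cell (init w) (bd (\<Delta> (?p - 1)) \<alpha> k (simplex_sub (zeros 0 w)))"
    unfolding functor_bd[OF germs(1) atom_class_cell[OF w]] germs_atom[OF w] corner_cell_bd ..
  then have "u \<in> faces_over (germs (bd D \<alpha> k (atom_class w)))"
    unfolding faces_over_corner_cell[OF init_vertices[OF w]] using u z(1) by (simp add: faces_def faces_over_corner_cell[OF init_vertices[OF w]])
  moreover have "cube_dim u - 1 = k" using dim_zeros[OF u(2)] u(4) z(2) by simp
  ultimately show ?thesis by blast
qed

lemma faces_over_bd_dim:
  assumes c: "c \<in> cells D" and u: "u \<in> faces_over (germs (bd D \<alpha> k c))"
  shows "cube_dim u - 1 \<le> k"
proof -
  obtain p v Y where v: "v \<in> vertices N p" "0 < p" "Y \<in> cells (\<Delta> (p - 1))" "germs c = corner_cell v Y"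
    using corner_cell_cases[OF germs_cell[OF c]] .
  have p: "count_list v (Sgn Minus) = p" using v(1) by (simp add: vertices_def)
  have "germs (bd D \<alpha> k c) = corner_cell v (bd (\<Delta> (p - 1)) \<alpha> k Y)"
    unfolding functor_bd[OF germs(1) c] v(4) corner_cell_bd p ..
  then have "zeros 0 u \<in> bd (\<Delta> (p - 1)) \<alpha> k Y" "u \<in> faces" using u faces_over_corner_cell[OF v(1)] by auto
  moreover from this have "simplex_dim (zeros 0 u) \<le> k" using face_complex.bd_dim[OF S v(3)] by blast
  ultimately show ?thesis using dim_zeros[of u] by (simp add: faces_def)
qed

lemma faces_over_atom:
  assumes w: "w \<in> faces"
  shows "w \<in> faces_over (germs (atom_class w))"
    "u \<in> faces_over (germs (atom_class w)) \<Longrightarrow> u \<noteq> w \<Longrightarrow> cube_dim u - 1 < cube_dim w - 1"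
proof -
  let ?n = "count_list (init w) (Sgn Minus) - 1"
  have w': "0 < cube_dim w" using w by (simp add: faces_def)
  have s: "faces_over (germs (atom_class w)) = {u \<in> faces. init u = init w \<and> zeros 0 u \<in> simplex_sub (zeros 0 w)}"
    unfolding germs_atom[OF w] by (rule faces_over_corner_cell[OF init_vertices[OF w]])
  interpret S: face_complex "simplex_faces ?n" simplex_sub simplex_dim simplex_bdy "\<Delta> ?n" by (rule S)
  show "w \<in> faces_over (germs (atom_class w))" unfolding s using w S.sub_refl[OF zeros_face[OF w']] by simp
  assume u: "u \<in> faces_over (germs (atom_class w))" "u \<noteq> w"
  then have u': "u \<in> faces" "init u = init w" "zeros 0 u \<in> simplex_sub (zeros 0 w)" unfolding s by blast+
  have "zeros 0 u \<noteq> zeros 0 w" using zeros_inj[OF u'(2)] u(2) by blast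
  then have "simplex_dim (zeros 0 u) < simplex_dim (zeros 0 w)" using S.sub_dim[OF zeros_face[OF w'] u'(3)] by blast
  then show "cube_dim u - 1 < cube_dim w - 1" using dim_zeros[OF w'] dim_zeros[of u] u'(1) by (simp add: faces_def)
qed

lemma faces_over_cmp:
  assumes ab: "composable D m a b"
  shows "faces_over (germs (cmp D m a b)) = faces_over (germs a) \<union> faces_over (germs b)"
proof -
  have cE: "composable E m (germs a) (germs b)" by (rule functor_composable[OF germs(1) ab])
  then have cells: "germs a \<in> cells E" "germs b \<in> cells E" by (simp_all add: composable_def)
  obtain p v Y where c: "v \<in> vertices N p" "0 < p" "Y \<in> cells (\<Delta> (p - 1))" "germs a = corner_cell v Y"
    using corner_cell_cases[OF cells(1)] .
  obtain r u Z where d: "u \<in> vertices N r" "0 < r" "Z \<in> cells (\<Delta> (r - 1))" "germs b = corner_cell u Z"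
    using corner_cell_cases[OF cells(2)] .
  have p: "count_list v (Sgn Minus) = p" "count_list u (Sgn Minus) = r" using c d by (simp_all add: vertices_def)
  have "corner_cell v (tgt (\<Delta> (p - 1)) m Y) = corner_cell u (src (\<Delta> (r - 1)) m Z)"
    using composable_def[THEN iffD1, OF cE] unfolding c(4) d(4) corner_cell_bd p by blast
  from corner_cell_inj[OF c(1) d(1) this]
  have uv: "u = v" "r = p" "tgt (\<Delta> (p - 1)) m Y = src (\<Delta> (p - 1)) m Z" using p by auto
  then have "composable (\<Delta> (p - 1)) m Y Z" using c(3) d(3) by (simp add: composable_def)
  then have "cmp (\<Delta> (p - 1)) m Y Z = Y \<union> Z" by (rule face_complex.cmp_Un[OF S])
  then have "germs (cmp D m a b) = corner_cell v (Y \<union> Z)"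
    using functor_cmp[OF germs(1) ab] c(4) d(4) uv p by (simp add: corner_cell_cmp)
  then show ?thesis unfolding c(4) d(4) uv(1) by (simp only: faces_over_corner_cell[OF c(1)]) blast
qed

lemma rigid_D: "rigid D faces (\<lambda>w. cube_dim w - 1) face_rank atom_class (\<lambda>c. faces_over (germs c))"
proof unfold_locales
  show "omega_category D" by (rule omega_category_D)
  show "inj_on face_rank faces" by (rule face_rank_inj)
  show "c \<in> generated D (atom_class ` faces)" if "c \<in> cells D" for c using D_generated[OF that] .
  show "faces_over (germs (bd D \<alpha> k a)) = faces_over (germs (bd D \<alpha> k b))"
    if "a \<in> cells D" "b \<in> cells D" "faces_over (germs a) = faces_over (germs b)" for a b \<alpha> k
  proof -
    have "germs a = germs b" using faces_over_inj germs_cell that by (auto simp: inj_on_def)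
    then show ?thesis using functor_bd[OF germs(1)] that(1,2) by simp
  qed
  show "faces_over (germs (cmp D m a b)) = faces_over (germs a) \<union> faces_over (germs b)" if "composable D m a b" for m a b
    by (rule faces_over_cmp[OF that])
  show "cube_dim f - 1 \<le> k" if "c \<in> cells D" "f \<in> faces_over (germs (bd D \<alpha> k c))" for c \<alpha> k f
    by (rule faces_over_bd_dim[OF that])
  fix w assume w: "w \<in> faces"
  show "atom_class w \<in> cells D" by (rule atom_class_cell[OF w])
  show "bd D \<alpha> (cube_dim w - 1) (atom_class w) = atom_class w" for \<alpha>
  proof -
    have w': "w \<in> cube_faces N" "0 < cube_dim w" using w by (simp_all add: faces_def)
    then have "bd (path_ocat I) \<alpha> (cube_dim w - 1) (cube_sub w) = cube_sub w"
      using I.flat_eq[OF I.flat_sub[OF w'(1)]] by (simp add: path_simps)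
    then show ?thesis unfolding atom_class_def using functor_bd[OF P.proj_functor atom_path[OF w]] by metis
  qed
  show "w \<in> faces_over (germs (atom_class w))" by (rule faces_over_atom(1)[OF w])
  show "cube_dim f - 1 < cube_dim w - 1" if "f \<in> faces_over (germs (atom_class w))" "f \<noteq> w" for f
    by (rule faces_over_atom(2)[OF w that])
  fix k assume k: "k < cube_dim w - 1"
  show "face_rank f < face_rank w" if "f \<in> faces_over (germs (src D k (atom_class w)))" "cube_dim f - 1 = k" for f
    using face_rank_bd[OF w k that] by simp
  show "face_rank w < face_rank f" if "f \<in> faces_over (germs (tgt D k (atom_class w)))" "cube_dim f - 1 = k" for f
    using face_rank_bd[OF w k that] by simp
  show "\<exists>f\<in>faces_over (germs (bd D \<alpha> k (atom_class w))). cube_dim f - 1 = k" for \<alpha>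
    by (rule faces_over_bd_ex[OF w k])
qed

lemma germs_inj: "inj_on germs (cells D)"
  using rigid.supp_inj[OF rigid_D] by (auto simp: inj_on_def)

text \<open>By induction on the composition of \<open>Y\<close> from simplex faces; injectivity makes the preimages of two
  composable cells composable.\<close>

lemma germs_surj:
  assumes v: "v \<in> vertices N p" "0 < p" and Y: "Y \<in> cells (\<Delta> (p - 1))"
  shows "\<exists>c\<in>cells D. germs c = corner_cell v Y"
proof -
  interpret S: face_complex "simplex_faces (p - 1)" simplex_sub simplex_dim simplex_bdy "\<Delta> (p - 1)"
    by (rule S)
  have p: "count_list v (Sgn Minus) = p" using v(1) by (simp add: vertices_def)
  have "Y \<in> generated (\<Delta> (p - 1)) (simplex_sub ` simplex_faces (p - 1))" using Y S.cells_generated by simp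
  then show ?thesis
  proof (induction rule: generated.induct)
    case (base Y)
    then obtain y where y: "y \<in> simplex_faces (p - 1)" "Y = simplex_sub y" by blast
    obtain w where w: "w \<in> cube_faces N" "0 < cube_dim w" "init w = v" "zeros 0 w = y"
      using face_of_vertex[OF v(1) y(1) v(2)] .
    then have f: "w \<in> faces" by (simp add: faces_def)
    then show ?case using germs_atom[OF f] atom_class_cell[OF f] w y by auto
  next
    case (comp A B m)
    obtain a b where ab: "a \<in> cells D" "germs a = corner_cell v A" "b \<in> cells D" "germs b = corner_cell v B"
      using comp.IH by blast
    have "germs (tgt D m a) = germs (src D m b)"
      using functor_bd[OF germs(1)] ab S.composable_eq[OF comp.hyps(3)] by (simp add: corner_cell_bd p)
    then have "tgt D m a = src D m b"
      using inj_onD[OF germs_inj] omega_categoryD(3)[OF omega_category_D] ab by blast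
    then have c: "composable D m a b" using ab by (simp add: composable_def)
    have "germs (cmp D m a b) = corner_cell v (cmp (\<Delta> (p - 1)) m A B)"
      using functor_cmp[OF germs(1) c] ab by (simp add: corner_cell_cmp p)
    then show ?case using omega_categoryD(2)[OF omega_category_D c] by blast
  qed
qed

lemma neg_path_cube: "ocat_iso D E"
proof (rule bij_functor_iso[OF omega_category_D germs(1)])
  have "cells E \<subseteq> germs ` cells D"
  proof
    fix c assume "c \<in> cells E"
    then obtain p v Y where v: "v \<in> vertices N p" "0 < p" "Y \<in> cells (\<Delta> (p - 1))" "c = corner_cell v Y"
      using corner_cell_cases by blast
    from germs_surj[OF v(1-3)] obtain d where "d \<in> cells D" "germs d = c" unfolding v(4) by blast
    then show "c \<in> germs ` cells D" by blast
  qed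
  then show "bij_betw germs (cells D) (cells E)"
    unfolding bij_betw_def using germs_inj germs_cell by blast
qed

end

theorem corollary4p10:
  fixes n :: nat and I :: "letter list set ocat" and \<Delta> :: "nat \<Rightarrow> nat list set ocat"
  assumes "is_cube (n + 1) I" and "\<And>k. is_simplex k (\<Delta> k)"
  shows "ocat_iso (neg_path_ocat I)
    (coprod {1..n + 1} (\<lambda>p. coprod {..<(n + 1) choose p} (\<lambda>_. \<Delta> (p - 1))))"
proof -
  obtain e where e: "\<forall>p. bij_betw (e p) (vertices (n + 1) p) {..<(n + 1) choose p}"
    using vertices_enum by blast
  interpret corner "n + 1" I \<Delta> e
    by unfold_locales (use assms e in auto)
  show ?thesis using neg_path_cube by (simp only: E_def)
qed

end
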